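(* Let $A,B\in\mathbb{B}(\mathscr{H})$ be positive operators and let $m,m',M,M'$ be positive real numbers satisfying either one of the following conditions: (1) $0<m\le B\le m'<M'\le A\le M$; (2) $0<m\le A\le m'<M'\le B\le M$. Then for every positive unital linear map $\Phi:\mathbb{B}(\mathscr{H})\to\mathbb{B}(\mathscr{K})$, every $0\le\nu\le 1$ and every $p\ge 2$, $$\Phi^{p}\big(A\nabla_\nu B+2rMm(A^{-1}\nabla B^{-1}-A^{-1}\sharp B^{-1})\big)\le\left(\frac{K(h)}{4^{\frac{2}{p}-1}K(\sqrt{h'})^{r_1}}\right)^{p}\Phi^{p}(A\sharp_\nu B)$$ and $$\Phi^{p}\big(A\nabla_\nu B+2rMm(A^{-1}\nabla B^{-1}-A^{-1}\sharp B^{-1})\big)\le\left(\frac{K(h)}{4^{\frac{2}{p}-1}K(\sqrt{h'})^{r_1}}\right)^{p}\big(\Phi(A)\sharp_\nu\Phi(B)\big)^{p},$$ where $r=\min\{\nu,1-\nu\}$, $r_1=\min\{2r,1-2r\}$, $h=\frac{M}{m}$, $h'=\frac{M'}{m'}$.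
   Context: $\mathscr{H}$ and $\mathscr{K}$ are complex Hilbert spaces; $\mathbb{B}(\mathscr{H})$ is the $C^*$-algebra of bounded linear operators on $\mathscr{H}$ with identity $I$. For self-adjoint $X,Y$, $X\le Y$ means $Y-X$ is positive, i.e. $\langle (Y-X)x,x\rangle\ge 0$ for all $x$. A scalar $c$ in an operator inequality stands for $cI$. A linear map $\Phi$ is positive if $\Phi(X)\ge0$ whenever $X\ge0$, and unital if $\Phi(I)=I$. $\Phi^{p}(X)$ denotes $(\Phi(X))^{p}$ (functional calculus). For positive invertible $X,Y$ and $0\le\nu\le1$: $X\nabla_\nu Y=(1-\nu)X+\nu Y$ and $X\sharp_\nu Y=X^{1/2}(X^{-1/2}YX^{-1/2})^{\nu}X^{1/2}$; $\nabla$ and $\sharp$ denote $\nabla_{1/2}$ and $\sharp_{1/2}$. The Kantorovich constant is $K(t)=\frac{(1+t)^2}{4t}$ for $t>0$. *)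

theory Defs
  imports "HOL-Analysis.Analysis" "HOL-Computational_Algebra.Polynomial"
begin

class complex_vector = real_vector +
  fixes scaleC :: "complex \<Rightarrow> 'a \<Rightarrow> 'a" (infixr "*\<^sub>C" 75)
  assumes scaleC_add_right: "c *\<^sub>C (x + y) = c *\<^sub>C x + c *\<^sub>C y"
    and scaleC_add_left: "(c + d) *\<^sub>C x = c *\<^sub>C x + d *\<^sub>C x"
    and scaleC_scaleC: "c *\<^sub>C d *\<^sub>C x = (c * d) *\<^sub>C x"
    and scaleC_of_real: "complex_of_real r *\<^sub>C x = r *\<^sub>R x"

text \<open>The inner product is linear in its first argument.\<close>

class complex_inner = complex_vector + real_normed_vector +
  fixes cinner :: "'a \<Rightarrow> 'a \<Rightarrow> complex"
  assumes cinner_commute: "cinner x y = cnj (cinner y x)"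
    and cinner_add_left: "cinner (x + y) z = cinner x z + cinner y z"
    and cinner_scaleC_left: "cinner (c *\<^sub>C x) y = c * cinner x y"
    and cinner_self: "cinner x x = complex_of_real ((norm x)\<^sup>2)"

class complex_hilbert = complex_inner + complete_space

instantiation complex :: complex_hilbert
begin

definition scaleC_complex :: "complex \<Rightarrow> complex \<Rightarrow> complex"
  where "scaleC_complex c x = c * x"

definition cinner_complex :: "complex \<Rightarrow> complex \<Rightarrow> complex"
  where "cinner_complex x y = x * cnj y"

instance
proof
  show "cinner x x = complex_of_real ((norm x)\<^sup>2)" for x :: complex
    unfolding cinner_complex_def by (rule complex_norm_square[symmetric])
qed (simp_all add: scaleC_complex_def cinner_complex_def algebra_simps scaleR_conv_of_real)

end

lemma norm_scaleC: "norm (c *\<^sub>C x) = cmod c * norm x" for x :: "'a::complex_inner"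
proof -
  have "cinner (c *\<^sub>C x) (c *\<^sub>C x) = c * (cnj c * cinner x x)"
    by (metis cinner_commute cinner_scaleC_left complex_cnj_mult)
  then have "complex_of_real ((norm (c *\<^sub>C x))\<^sup>2) = complex_of_real ((cmod c * norm x)\<^sup>2)"
    by (simp add: cinner_self complex_norm_square[of c, symmetric] power_mult_distrib
        mult.assoc[symmetric] del: of_real_power)
  then have "(norm (c *\<^sub>C x))\<^sup>2 = (cmod c * norm x)\<^sup>2"
    by (simp only: of_real_eq_iff)
  then show ?thesis
    by (simp add: power2_eq_iff_nonneg)
qed

lemma bounded_linear_scaleC: "bounded_linear (\<lambda>x::'a::complex_inner. c *\<^sub>C x)"
proof (rule bounded_linear_intro[where K = "cmod c"])
  show "c *\<^sub>C (r *\<^sub>R x) = r *\<^sub>R (c *\<^sub>C x)" for r and x :: 'a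
    by (simp add: scaleC_of_real[symmetric] scaleC_scaleC mult.commute)
qed (simp_all add: scaleC_add_right norm_scaleC mult.commute)

text \<open>\<open>'a \<Rightarrow>\<^sub>L 'a\<close> consists of the bounded real-linear maps; the algebra of bounded operators on
  the complex Hilbert space \<open>'a\<close> is the subset of the complex-linear ones, with the
  operator norm of \<open>'a \<Rightarrow>\<^sub>L 'a\<close>.\<close>

definition bounded_ops :: "('a::complex_hilbert \<Rightarrow>\<^sub>L 'a) set"
  where "bounded_ops = {T. \<forall>c x. blinfun_apply T (c *\<^sub>C x) = c *\<^sub>C blinfun_apply T x}"

lift_definition op_scaleC :: "complex \<Rightarrow> ('a::complex_hilbert \<Rightarrow>\<^sub>L 'a) \<Rightarrow> ('a \<Rightarrow>\<^sub>L 'a)"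
  is "\<lambda>c T x. c *\<^sub>C T x"
  by (rule bounded_linear_compose[OF bounded_linear_scaleC])

definition op_selfadjoint :: "('a::complex_hilbert \<Rightarrow>\<^sub>L 'a) \<Rightarrow> bool"
  where "op_selfadjoint T \<longleftrightarrow> T \<in> bounded_ops \<and>
    (\<forall>x y. cinner (blinfun_apply T x) y = cinner x (blinfun_apply T y))"

definition op_positive :: "('a::complex_hilbert \<Rightarrow>\<^sub>L 'a) \<Rightarrow> bool"
  where "op_positive T \<longleftrightarrow> T \<in> bounded_ops \<and>
    (\<forall>x. cinner (blinfun_apply T x) x \<in> \<real> \<and> 0 \<le> Re (cinner (blinfun_apply T x) x))"

definition op_le :: "('a::complex_hilbert \<Rightarrow>\<^sub>L 'a) \<Rightarrow> ('a \<Rightarrow>\<^sub>L 'a) \<Rightarrow> bool"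
  where "op_le X Y \<longleftrightarrow> op_selfadjoint X \<and> op_selfadjoint Y \<and> op_positive (Y - X)"

abbreviation op_scalar :: "real \<Rightarrow> ('a::complex_hilbert \<Rightarrow>\<^sub>L 'a)"
  where "op_scalar c \<equiv> c *\<^sub>R id_blinfun"

definition op_is_inverse :: "('a::complex_hilbert \<Rightarrow>\<^sub>L 'a) \<Rightarrow> ('a \<Rightarrow>\<^sub>L 'a) \<Rightarrow> bool"
  where "op_is_inverse T S \<longleftrightarrow>
    S \<in> bounded_ops \<and> T o\<^sub>L S = id_blinfun \<and> S o\<^sub>L T = id_blinfun"

definition op_inverse :: "('a::complex_hilbert \<Rightarrow>\<^sub>L 'a) \<Rightarrow> ('a \<Rightarrow>\<^sub>L 'a)"
  where "op_inverse T = (THE S. op_is_inverse T S)"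

definition op_spectrum :: "('a::complex_hilbert \<Rightarrow>\<^sub>L 'a) \<Rightarrow> complex set"
  where "op_spectrum T = {z. \<not> (\<exists>S. op_is_inverse (T - op_scaleC z id_blinfun) S)}"

definition op_poly :: "real poly \<Rightarrow> ('a::complex_hilbert \<Rightarrow>\<^sub>L 'a) \<Rightarrow> ('a \<Rightarrow>\<^sub>L 'a)"
  where "op_poly q T = (\<Sum>i\<le>degree q. coeff q i *\<^sub>R (((o\<^sub>L) T ^^ i) id_blinfun))"

text \<open>For self-adjoint \<open>T\<close> (whose spectrum is real) and \<open>f\<close> continuous on the spectrum, \<open>f(T)\<close>
  is the operator-norm limit of \<open>q\<^sub>n(T)\<close> for any polynomials \<open>q\<^sub>n\<close> tending to \<open>f\<close> uniformly on the
  spectrum. Not meaningful for other \<open>T\<close> and \<open>f\<close>.\<close>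

definition op_fun :: "(real \<Rightarrow> real) \<Rightarrow> ('a::complex_hilbert \<Rightarrow>\<^sub>L 'a) \<Rightarrow> ('a \<Rightarrow>\<^sub>L 'a)"
  where "op_fun f T = (THE S. \<forall>q :: nat \<Rightarrow> real poly.
    uniform_limit {t. complex_of_real t \<in> op_spectrum T} (\<lambda>n. poly (q n)) f sequentially
      \<longrightarrow> (\<lambda>n. op_poly (q n) T) \<longlonglongrightarrow> S)"

definition op_powr :: "('a::complex_hilbert \<Rightarrow>\<^sub>L 'a) \<Rightarrow> real \<Rightarrow> ('a \<Rightarrow>\<^sub>L 'a)"
  where "op_powr T p = op_fun (\<lambda>t. t powr p) T"

definition arith_mean ::
    "real \<Rightarrow> ('a::complex_hilbert \<Rightarrow>\<^sub>L 'a) \<Rightarrow> ('a \<Rightarrow>\<^sub>L 'a) \<Rightarrow> ('a \<Rightarrow>\<^sub>L 'a)"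
  where "arith_mean \<nu> X Y = (1 - \<nu>) *\<^sub>R X + \<nu> *\<^sub>R Y"

definition geom_mean ::
    "real \<Rightarrow> ('a::complex_hilbert \<Rightarrow>\<^sub>L 'a) \<Rightarrow> ('a \<Rightarrow>\<^sub>L 'a) \<Rightarrow> ('a \<Rightarrow>\<^sub>L 'a)"
  where "geom_mean \<nu> X Y =
    op_powr X (1/2) o\<^sub>L op_powr (op_powr X (-1/2) o\<^sub>L Y o\<^sub>L op_powr X (-1/2)) \<nu> o\<^sub>L op_powr X (1/2)"

text \<open>Only the values of \<open>\<Phi>\<close> on \<^const>\<open>bounded_ops\<close> are constrained.\<close>

definition op_linear_map ::
    "(('a::complex_hilbert \<Rightarrow>\<^sub>L 'a) \<Rightarrow> ('b::complex_hilbert \<Rightarrow>\<^sub>L 'b)) \<Rightarrow> bool"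
  where "op_linear_map \<Phi> \<longleftrightarrow>
    (\<forall>X\<in>bounded_ops. \<Phi> X \<in> bounded_ops) \<and>
    (\<forall>X\<in>bounded_ops. \<forall>Y\<in>bounded_ops. \<Phi> (X + Y) = \<Phi> X + \<Phi> Y) \<and>
    (\<forall>c. \<forall>X\<in>bounded_ops. \<Phi> (op_scaleC c X) = op_scaleC c (\<Phi> X))"

definition positive_unital_map ::
    "(('a::complex_hilbert \<Rightarrow>\<^sub>L 'a) \<Rightarrow> ('b::complex_hilbert \<Rightarrow>\<^sub>L 'b)) \<Rightarrow> bool"
  where "positive_unital_map \<Phi> \<longleftrightarrow> op_linear_map \<Phi> \<and>
    (\<forall>X. op_positive X \<longrightarrow> op_positive (\<Phi> X)) \<and> \<Phi> id_blinfun = id_blinfun"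

definition kantorovich :: "real \<Rightarrow> real"
  where "kantorovich t = (1 + t)\<^sup>2 / (4 * t)"

end

theory Submission
  imports Defs "HOL-Computational_Algebra.Fundamental_Theorem_Algebra"
begin

text \<open>
  Put \<open>P = A\<^sup>-\<^sup>1\<close>, \<open>Q = B\<^sup>-\<^sup>1\<close>, \<open>s = M + m\<close>, \<open>\<kappa> = K(\<surd>h')\<close> to the power \<open>r\<^sub>1\<close>, \<open>c = M m \<kappa>\<close>, let \<open>G\<close> be the
  geometric mean of \<open>A\<close> and \<open>B\<close> of weight \<open>\<nu>\<close>, and let \<open>U\<close> be the operator to which \<open>\<Phi>\<close> is applied on
  the left-hand side. The hypotheses enter through the single inequality \<open>U + c G\<^sup>-\<^sup>1 \<le> s\<close>. It combines
  \<open>t + M m / t \<le> M + m\<close> on \<open>[m, M]\<close>, applied to \<open>A\<close> and \<open>B\<close> (\<open>op_add_inverse_le\<close>), with Young's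
  inequality for \<open>P\<close> and \<open>Q\<close>, strengthened by the Kantorovich constant and by a multiple of the
  difference of their arithmetic and geometric means (\<open>op_refined_young\<close>); the geometric mean of
  \<open>P\<close> and \<open>Q\<close> is \<open>G\<^sup>-\<^sup>1\<close>.

  Applying \<open>\<Phi>\<close> gives \<open>s - \<Phi>(U) \<ge> c \<Phi>(G\<^sup>-\<^sup>1)\<close>. Choi's inequality (\<open>positive_map_inverse_le\<close>) turns
  this into \<open>(s - \<Phi>(U))\<^sup>-\<^sup>1 \<le> c\<^sup>-\<^sup>1 \<Phi>(G)\<close>, and \<open>\<Phi>(G)\<close> is at most the geometric mean of \<open>\<Phi>(A)\<close> and
  \<open>\<Phi>(B)\<close> by Ando's inequality (\<open>positive_map_geom_mean_le\<close>). So both parts of the theorem follow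
  from the implication (\<open>op_powr_le_of_inverse_le\<close>): if \<open>(s - X)\<^sup>-\<^sup>1 \<le> c\<^sup>-\<^sup>1 Y\<close> then \<open>X\<^sup>p\<close> is at most
  \<open>s\<^sup>2\<^sup>p / (16 c\<^sup>p)\<close> times \<open>Y\<^sup>p\<close>. Although \<open>t\<^sup>p\<close> is not operator monotone, this needs the operator order
  only once: both powers are compared with the two sides of the hypothesis by scalar inequalities,
  one in the functional calculus of \<open>X\<close> and one in that of \<open>Y\<close>.

  The results on positive maps rest on one fact (\<open>positive_map_quadratic_form\<close>): a positive map
  preserves positivity of \<open>2\<times>2\<close> block matrices whose entries are functions of one self-adjoint operator.
  The Bernstein polynomials of that operator are a positive partition of the identity, which reduces
  the claim to scalar matrices. The functional calculus itself comes from the bound of \<open>\<parallel>q(T)\<parallel>\<close> by the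
  supremum of \<open>\<bar>q\<bar>\<close> on the spectrum (\<open>norm_op_poly_le\<close>).
\<close>

instance complex_hilbert \<subseteq> banach ..

section \<open>The real inner product and self-adjoint operators\<close>

definition ip :: "'a::complex_inner \<Rightarrow> 'a \<Rightarrow> real"
  where "ip x y = Re (cinner x y)"

lemma ip_commute: "ip x y = ip y x"
  unfolding ip_def by (subst cinner_commute) simp

lemma ip_self: "ip x x = (norm x)\<^sup>2"
  by (simp add: ip_def cinner_self del: of_real_power)

lemma ip_add_left: "ip (x + y) z = ip x z + ip y z"
  by (simp add: ip_def cinner_add_left)

lemma ip_add_right: "ip z (x + y) = ip z x + ip z y"
  by (simp add: ip_add_left ip_commute[of z])

lemma ip_scaleR_left: "ip (c *\<^sub>R x) z = c * ip x z"
  by (simp add: ip_def cinner_scaleC_left scaleC_of_real[symmetric])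

lemma ip_scaleR_right: "ip z (c *\<^sub>R x) = c * ip z x"
  by (simp add: ip_scaleR_left ip_commute[of z])

lemma ip_minus_left: "ip (- x) z = - ip x z"
  using ip_scaleR_left[of "-1" x z] by simp

lemma ip_minus_right: "ip z (- x) = - ip z x"
  by (simp add: ip_minus_left ip_commute[of z])

lemma ip_diff_left: "ip (x - y) z = ip x z - ip y z"
  using ip_add_left[of x "-y" z] by (simp add: ip_minus_left)

lemma ip_diff_right: "ip z (x - y) = ip z x - ip z y"
  by (simp add: ip_diff_left ip_commute[of z])

lemma ip_zero_left [simp]: "ip 0 z = 0"
  using ip_scaleR_left[of 0 0 z] by simp

lemma ip_zero_right [simp]: "ip z 0 = 0"
  by (simp add: ip_commute[of z])

lemmas ip_simps = ip_add_left ip_add_right ip_diff_left ip_diff_right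
  ip_scaleR_left ip_scaleR_right ip_minus_left ip_minus_right

lemma ip_sum_left: "ip (\<Sum>i\<in>I. f i) z = (\<Sum>i\<in>I. ip (f i) z)"
  by (induction I rule: infinite_finite_induct) (auto simp: ip_simps)

lemma Im_cinner: "Im (cinner x y) = ip x (\<i> *\<^sub>C y)"
proof -
  have "cinner x (\<i> *\<^sub>C y) = cnj (\<i> * cinner y x)"
    by (subst cinner_commute) (simp add: cinner_scaleC_left)
  also have "\<dots> = - \<i> * cinner x y"
    by (subst (2) cinner_commute) simp
  finally show ?thesis by (simp add: ip_def)
qed

lemma ip_le_norm: "ip x y \<le> norm x * norm y"
proof (cases "x = 0 \<or> y = 0")
  case False
  have "0 \<le> ip (norm y *\<^sub>R x - norm x *\<^sub>R y) (norm y *\<^sub>R x - norm x *\<^sub>R y)"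
    by (simp add: ip_self)
  also have "\<dots> = 2 * (norm x * norm y) * (norm x * norm y - ip x y)"
    by (simp only: ip_simps ip_commute[of y x]) (simp add: ip_self algebra_simps power2_eq_square)
  finally have "0 \<le> 2 * (norm x * norm y) * (norm x * norm y - ip x y)" .
  moreover have "0 < 2 * (norm x * norm y)"
    using False by simp
  ultimately have "0 \<le> norm x * norm y - ip x y"
    by (metis less_le_not_le mult_pos_neg not_le)
  then show ?thesis by simp
qed auto

lemma abs_ip_le_norm: "\<bar>ip x y\<bar> \<le> norm x * norm y"
  using ip_le_norm[of x y] ip_le_norm[of "-x" y] by (simp add: ip_minus_left)

lemma bounded_bilinear_ip: "bounded_bilinear ip"
  by (rule bounded_bilinear.intro)
    (auto simp: ip_simps abs_ip_le_norm intro!: exI[of _ 1])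

lemmas tendsto_ip = bounded_bilinear.tendsto[OF bounded_bilinear_ip]

lemma norm_le_of_ip:
  assumes "0 \<le> c" "\<And>y. ip z y \<le> c * norm y"
  shows "norm z \<le> c"
  using assms(2)[of z] assms(1) by (cases "z = 0") (auto simp: ip_self power2_eq_square)

subsection \<open>Self-adjoint operators\<close>

lemma bounded_opsD: "T \<in> bounded_ops \<Longrightarrow> blinfun_apply T (c *\<^sub>C x) = c *\<^sub>C blinfun_apply T x"
  by (simp add: bounded_ops_def)

lemma scaleC_scaleR: "c *\<^sub>C (r *\<^sub>R x) = r *\<^sub>R (c *\<^sub>C x)"
  by (simp add: scaleC_of_real[symmetric] scaleC_scaleC mult.commute)

lemma bounded_ops_add: "S \<in> bounded_ops \<Longrightarrow> T \<in> bounded_ops \<Longrightarrow> S + T \<in> bounded_ops"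
  by (simp add: bounded_ops_def blinfun.add_left scaleC_add_right)

lemma bounded_ops_scaleR: "T \<in> bounded_ops \<Longrightarrow> r *\<^sub>R T \<in> bounded_ops"
  by (simp add: bounded_ops_def blinfun.scaleR_left scaleC_scaleR)

lemma bounded_ops_compose: "S \<in> bounded_ops \<Longrightarrow> T \<in> bounded_ops \<Longrightarrow> S o\<^sub>L T \<in> bounded_ops"
  by (simp add: bounded_ops_def)

lemma bounded_ops_id: "id_blinfun \<in> bounded_ops"
  by (simp add: bounded_ops_def)

lemma op_selfadjoint_iff:
  "op_selfadjoint T \<longleftrightarrow> T \<in> bounded_ops \<and>
    (\<forall>x y. ip (blinfun_apply T x) y = ip x (blinfun_apply T y))"
proof
  assume T: "T \<in> bounded_ops \<and> (\<forall>x y. ip (blinfun_apply T x) y = ip x (blinfun_apply T y))"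
  have "cinner (blinfun_apply T x) y = cinner x (blinfun_apply T y)" for x y
  proof (rule complex_eqI)
    show "Re (cinner (blinfun_apply T x) y) = Re (cinner x (blinfun_apply T y))"
      using T by (simp add: ip_def)
    show "Im (cinner (blinfun_apply T x) y) = Im (cinner x (blinfun_apply T y))"
      using T by (simp add: Im_cinner bounded_opsD[symmetric])
  qed
  then show "op_selfadjoint T"
    using T by (simp add: op_selfadjoint_def)
qed (simp add: op_selfadjoint_def ip_def)

lemma op_selfadjoint_ip: "op_selfadjoint T \<Longrightarrow> ip (blinfun_apply T x) y = ip x (blinfun_apply T y)"
  by (simp add: op_selfadjoint_iff)

lemma op_selfadjoint_bounded_ops: "op_selfadjoint T \<Longrightarrow> T \<in> bounded_ops"
  by (simp add: op_selfadjoint_def)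

lemma op_selfadjoint_add: "op_selfadjoint S \<Longrightarrow> op_selfadjoint T \<Longrightarrow> op_selfadjoint (S + T)"
  by (auto simp: op_selfadjoint_iff bounded_ops_add blinfun.add_left ip_simps)

lemma op_selfadjoint_scaleR: "op_selfadjoint T \<Longrightarrow> op_selfadjoint (c *\<^sub>R T)"
  by (auto simp: op_selfadjoint_iff bounded_ops_scaleR blinfun.scaleR_left ip_simps)

lemma op_selfadjoint_diff: "op_selfadjoint S \<Longrightarrow> op_selfadjoint T \<Longrightarrow> op_selfadjoint (S - T)"
  using op_selfadjoint_add[of S "(-1) *\<^sub>R T"] op_selfadjoint_scaleR[of T "-1"] by simp

lemma op_selfadjoint_id: "op_selfadjoint id_blinfun"
  by (auto simp: op_selfadjoint_iff bounded_ops_id)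

lemma op_selfadjoint_zero: "op_selfadjoint 0"
  using op_selfadjoint_scaleR[OF op_selfadjoint_id, of 0] by simp

lemma op_selfadjoint_sum: "(\<And>i. i \<in> I \<Longrightarrow> op_selfadjoint (f i)) \<Longrightarrow> op_selfadjoint (\<Sum>i\<in>I. f i)"
  by (induction I rule: infinite_finite_induct) (auto simp: op_selfadjoint_zero op_selfadjoint_add)

lemma op_selfadjoint_congruence:
  "op_selfadjoint S \<Longrightarrow> op_selfadjoint T \<Longrightarrow> op_selfadjoint (S o\<^sub>L T o\<^sub>L S)"
  by (auto simp: op_selfadjoint_iff bounded_ops_compose)

lemma op_selfadjoint_compose:
  "op_selfadjoint S \<Longrightarrow> op_selfadjoint T \<Longrightarrow> S o\<^sub>L T = T o\<^sub>L S \<Longrightarrow> op_selfadjoint (S o\<^sub>L T)"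
  by (simp add: op_selfadjoint_iff bounded_ops_compose) (metis blinfun_apply_blinfun_compose)

lemma op_selfadjoint_limit:
  assumes "\<And>n. op_selfadjoint (T n)" "T \<longlonglongrightarrow> S"
  shows "op_selfadjoint S"
  unfolding op_selfadjoint_iff bounded_ops_def
proof (intro conjI CollectI allI)
  have lim: "(\<lambda>n. blinfun_apply (T n) x) \<longlonglongrightarrow> blinfun_apply S x" for x
    by (intro blinfun.tendsto assms(2) tendsto_const)
  show "blinfun_apply S (c *\<^sub>C x) = c *\<^sub>C blinfun_apply S x" for c x
  proof (rule LIMSEQ_unique[OF lim])
    have "blinfun_apply (T n) (c *\<^sub>C x) = c *\<^sub>C blinfun_apply (T n) x" for n
      using assms(1)[of n] by (simp add: op_selfadjoint_iff bounded_ops_def)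
    then show "(\<lambda>n. blinfun_apply (T n) (c *\<^sub>C x)) \<longlonglongrightarrow> c *\<^sub>C blinfun_apply S x"
      by (simp add: bounded_linear.tendsto[OF bounded_linear_scaleC lim])
  qed
  show "ip (blinfun_apply S x) y = ip x (blinfun_apply S y)" for x y
  proof (rule LIMSEQ_unique)
    show "(\<lambda>n. ip (blinfun_apply (T n) x) y) \<longlonglongrightarrow> ip (blinfun_apply S x) y"
      by (intro tendsto_ip lim tendsto_const)
    show "(\<lambda>n. ip (blinfun_apply (T n) x) y) \<longlonglongrightarrow> ip x (blinfun_apply S y)"
      unfolding op_selfadjoint_ip[OF assms(1)] by (intro tendsto_ip lim tendsto_const)
  qed
qed

text \<open>A complex quadratic form that takes only real values belongs to a self-adjoint operator, by
  polarization.\<close>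

lemma op_positive_iff:
  "op_positive T \<longleftrightarrow> op_selfadjoint T \<and> (\<forall>x. 0 \<le> ip (blinfun_apply T x) x)"
proof (intro iffI conjI allI)
  assume T: "op_positive T"
  then show "0 \<le> ip (blinfun_apply T x) x" for x
    by (simp add: op_positive_def ip_def)
  have ops: "T \<in> bounded_ops" using T by (simp add: op_positive_def)
  have real: "ip (blinfun_apply T x) (\<i> *\<^sub>C x) = 0" for x
    using T unfolding Im_cinner[symmetric]
    by (auto simp: op_positive_def complex_is_Real_iff)
  have skew: "ip (blinfun_apply T x) (\<i> *\<^sub>C y) + ip (blinfun_apply T y) (\<i> *\<^sub>C x) = 0" for x y
    using real[of "x + y"] real[of x] real[of y]
    by (simp add: blinfun.add_right scaleC_add_right ip_simps)
  have ii: "\<i> *\<^sub>C \<i> *\<^sub>C x = - x" for x :: 'a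
    using scaleC_of_real[of "-1" x] by (simp add: scaleC_scaleC)
  have iip: "ip (\<i> *\<^sub>C u) (\<i> *\<^sub>C v) = ip u v" for u v :: 'a
  proof -
    have "cinner (\<i> *\<^sub>C u) (\<i> *\<^sub>C v) = \<i> * cnj (\<i> * cinner v u)"
      by (subst cinner_scaleC_left, subst cinner_commute) (simp add: cinner_scaleC_left)
    also have "\<dots> = cinner u v"
      by (subst (2) cinner_commute) simp
    finally show ?thesis by (simp add: ip_def)
  qed
  have "ip (blinfun_apply T x) y = ip x (blinfun_apply T y)" for x y
  proof -
    have "ip (blinfun_apply T x) (\<i> *\<^sub>C (\<i> *\<^sub>C y)) + ip (blinfun_apply T (\<i> *\<^sub>C y)) (\<i> *\<^sub>C x) = 0"
      by (rule skew)
    then show ?thesis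
      by (simp add: bounded_opsD[OF ops] ii iip ip_simps ip_commute)
  qed
  then show "op_selfadjoint T"
    using ops by (simp add: op_selfadjoint_iff)
next
  assume T: "op_selfadjoint T \<and> (\<forall>x. 0 \<le> ip (blinfun_apply T x) x)"
  have "cinner (blinfun_apply T x) x = cnj (cinner (blinfun_apply T x) x)" for x
    using T by (subst cinner_commute) (auto simp: op_selfadjoint_def)
  then show "op_positive T"
    using T by (auto simp: op_positive_def op_selfadjoint_def ip_def Reals_cnj_iff)
qed

lemma op_le_iff:
  "op_le X Y \<longleftrightarrow> op_selfadjoint X \<and> op_selfadjoint Y \<and>
    (\<forall>x. ip (blinfun_apply X x) x \<le> ip (blinfun_apply Y x) x)"
  by (auto simp: op_le_def op_positive_iff op_selfadjoint_diff blinfun.diff_left ip_simps)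

lemma op_le_trans [trans]: "op_le X Y \<Longrightarrow> op_le Y Z \<Longrightarrow> op_le X Z"
  by (meson op_le_iff order_trans)

lemma op_le_add: "op_le X Y \<Longrightarrow> op_le X' Y' \<Longrightarrow> op_le (X + X') (Y + Y')"
  by (auto simp: op_le_iff op_selfadjoint_add blinfun.add_left ip_simps intro: add_mono)

lemma op_le_scaleR: "0 \<le> c \<Longrightarrow> op_le X Y \<Longrightarrow> op_le (c *\<^sub>R X) (c *\<^sub>R Y)"
  by (auto simp: op_le_iff op_selfadjoint_scaleR blinfun.scaleR_left ip_simps intro: mult_left_mono)

lemma ip_congruence:
  "op_selfadjoint S \<Longrightarrow>
    ip (blinfun_apply (S o\<^sub>L X o\<^sub>L S) x) y = ip (blinfun_apply X (blinfun_apply S x)) (blinfun_apply S y)"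
  by (simp add: op_selfadjoint_iff)

lemma op_le_congruence:
  "op_selfadjoint S \<Longrightarrow> op_le X Y \<Longrightarrow> op_le (S o\<^sub>L X o\<^sub>L S) (S o\<^sub>L Y o\<^sub>L S)"
  by (simp add: op_le_iff op_selfadjoint_congruence ip_congruence del: blinfun_apply_blinfun_compose)

text \<open>This confines the spectrum to \<open>[a, b]\<close>, the interval on which functions of \<open>T\<close> are approximated by
  polynomials.\<close>

definition op_between :: "real \<Rightarrow> real \<Rightarrow> ('a::complex_hilbert \<Rightarrow>\<^sub>L 'a) \<Rightarrow> bool"
  where "op_between a b T \<longleftrightarrow> op_selfadjoint T \<and>
    (\<forall>x. a * (norm x)\<^sup>2 \<le> ip (blinfun_apply T x) x \<and> ip (blinfun_apply T x) x \<le> b * (norm x)\<^sup>2)"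

lemma op_between_selfadjoint: "op_between a b T \<Longrightarrow> op_selfadjoint T"
  by (simp add: op_between_def)

lemma op_between_iff: "op_between a b T \<longleftrightarrow> op_le (op_scalar a) T \<and> op_le T (op_scalar b)"
  by (auto simp: op_between_def op_le_iff op_selfadjoint_id op_selfadjoint_scaleR
      blinfun.scaleR_left ip_simps ip_self)

lemma op_between_mono: "op_between a b T \<Longrightarrow> a' \<le> a \<Longrightarrow> b \<le> b' \<Longrightarrow> op_between a' b' T"
  unfolding op_between_def by (meson mult_right_mono order_trans zero_le_power2)

lemma op_between_positive: "op_between a b T \<Longrightarrow> 0 \<le> a \<Longrightarrow> op_positive T"
  unfolding op_between_def op_positive_iff
  by (blast intro: order_trans[OF mult_nonneg_nonneg[OF _ zero_le_power2]])

text \<open>For \<open>x\<close> and \<open>y\<close> of equal norm the hypothesis bounds \<open>\<langle>Kx, y\<rangle>\<close> by \<open>c \<parallel>x\<parallel> \<parallel>y\<parallel>\<close>; rescaling gives this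
  for all \<open>x\<close> and \<open>y\<close>.\<close>

lemma norm_le_of_bilinear_form:
  assumes "0 \<le> c"
    and form: "\<And>x y. 2 * ip (blinfun_apply K x) y \<le> c * ((norm x)\<^sup>2 + (norm y)\<^sup>2)"
  shows "norm K \<le> c"
proof (rule norm_blinfun_bound)
  show "norm (blinfun_apply K x) \<le> c * norm x" for x
  proof (rule norm_le_of_ip)
    show "0 \<le> c * norm x" using \<open>0 \<le> c\<close> by simp
    show "ip (blinfun_apply K x) y \<le> c * norm x * norm y" for y
    proof (cases "x = 0 \<or> y = 0")
      case False
      have "2 * ip (blinfun_apply K (norm y *\<^sub>R x)) (norm x *\<^sub>R y)
          \<le> c * ((norm (norm y *\<^sub>R x))\<^sup>2 + (norm (norm x *\<^sub>R y))\<^sup>2)"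
        by (rule form)
      then have "(norm x * norm y) * ip (blinfun_apply K x) y \<le> (norm x * norm y) * (c * norm x * norm y)"
        by (simp add: blinfun.scaleR_right ip_simps power_mult_distrib power2_eq_square algebra_simps)
      then show ?thesis using False by (simp add: mult_le_cancel_left)
    qed auto
  qed
qed fact

text \<open>Polarize \<open>4 \<langle>Tx, y\<rangle> = \<langle>T(x+y), x+y\<rangle> - \<langle>T(x-y), x-y\<rangle>\<close> and use the parallelogram identity.\<close>

lemma norm_le_of_quadratic_form:
  assumes T: "op_selfadjoint T" and "0 \<le> c"
    and bound: "\<And>x. \<bar>ip (blinfun_apply T x) x\<bar> \<le> c * (norm x)\<^sup>2"
  shows "norm T \<le> c"
proof (rule norm_le_of_bilinear_form)
  show "2 * ip (blinfun_apply T x) y \<le> c * ((norm x)\<^sup>2 + (norm y)\<^sup>2)" for x y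
  proof -
    have "4 * ip (blinfun_apply T x) y =
        ip (blinfun_apply T (x + y)) (x + y) - ip (blinfun_apply T (x - y)) (x - y)"
      using op_selfadjoint_ip[OF T, of y x]
      by (simp add: blinfun.add_right blinfun.diff_right ip_simps ip_commute[of y])
    also have "\<dots> \<le> c * (norm (x + y))\<^sup>2 + c * (norm (x - y))\<^sup>2"
      using bound[of "x + y"] bound[of "x - y"] by (simp add: abs_le_iff)
    also have "\<dots> = 2 * (c * ((norm x)\<^sup>2 + (norm y)\<^sup>2))"
      by (simp add: ip_self[symmetric] ip_simps algebra_simps)
    finally show ?thesis by simp
  qed
qed fact

lemma op_between_norm:
  assumes "op_selfadjoint T"
  shows "op_between (- norm T) (norm T) T"
proof -
  have "\<bar>ip (blinfun_apply T x) x\<bar> \<le> norm T * (norm x)\<^sup>2" for x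
    using abs_ip_le_norm[of "blinfun_apply T x" x] norm_blinfun[of T x]
    by (smt (verit) mult.assoc mult_right_mono norm_ge_zero power2_eq_square)
  then show ?thesis
    using assms unfolding op_between_def by (auto simp: abs_le_iff minus_le_iff)
qed

lemma norm_le_op_between: "op_between (- c) c T \<Longrightarrow> 0 \<le> c \<Longrightarrow> norm T \<le> c"
  by (rule norm_le_of_quadratic_form) (auto simp: op_between_def abs_le_iff minus_le_iff)

lemma op_between_limit:
  assumes "\<And>n. op_between a b (T n)" "T \<longlonglongrightarrow> S"
  shows "op_between a b S"
  unfolding op_between_def
proof (intro conjI allI)
  show "op_selfadjoint S"
    using op_selfadjoint_limit[OF op_between_selfadjoint[OF assms(1)] assms(2)] .
  have lim: "(\<lambda>n. ip (blinfun_apply (T n) x) x) \<longlonglongrightarrow> ip (blinfun_apply S x) x" for x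
    by (intro tendsto_ip blinfun.tendsto assms(2) tendsto_const)
  show "a * (norm x)\<^sup>2 \<le> ip (blinfun_apply S x) x" for x
    using assms(1) by (intro LIMSEQ_le_const[OF lim]) (auto simp: op_between_def)
  show "ip (blinfun_apply S x) x \<le> b * (norm x)\<^sup>2" for x
    using assms(1) by (intro LIMSEQ_le_const2[OF lim]) (auto simp: op_between_def)
qed

lemma op_le_limit:
  assumes le: "\<And>n. op_le (X n) (Y n)" and X: "X \<longlonglongrightarrow> X'" and Y: "Y \<longlonglongrightarrow> Y'"
  shows "op_le X' Y'"
  unfolding op_le_iff
proof (intro conjI allI)
  show "op_selfadjoint X'" using le by (intro op_selfadjoint_limit[OF _ X]) (simp add: op_le_iff)
  show "op_selfadjoint Y'" using le by (intro op_selfadjoint_limit[OF _ Y]) (simp add: op_le_iff)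
  fix x
  have "(\<lambda>n. ip (blinfun_apply (X n) x) x) \<longlonglongrightarrow> ip (blinfun_apply X' x) x"
    "(\<lambda>n. ip (blinfun_apply (Y n) x) x) \<longlonglongrightarrow> ip (blinfun_apply Y' x) x"
    by (intro tendsto_ip blinfun.tendsto X Y tendsto_const)+
  then show "ip (blinfun_apply X' x) x \<le> ip (blinfun_apply Y' x) x"
    by (rule LIMSEQ_le) (use le in \<open>auto simp: op_le_iff\<close>)
qed

subsection \<open>Inverses\<close>

lemma op_inverse_eqI:
  assumes "op_is_inverse T S" shows "op_inverse T = S"
  unfolding op_inverse_def
proof (rule the_equality)
  show "S' = S" if "op_is_inverse T S'" for S'
  proof -
    have "S' = S' o\<^sub>L (T o\<^sub>L S)" using assms by (simp add: op_is_inverse_def blinfun_eqI)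
    also have "\<dots> = (S' o\<^sub>L T) o\<^sub>L S" by (simp add: blinfun_eqI)
    also have "\<dots> = S" using that by (simp add: op_is_inverse_def blinfun_eqI)
    finally show ?thesis .
  qed
qed fact

lemma op_is_inverseI:
  assumes "T \<in> bounded_ops" "T o\<^sub>L S = id_blinfun" "S o\<^sub>L T = id_blinfun"
  shows "op_is_inverse T S"
proof -
  have TS: "blinfun_apply T (blinfun_apply S x) = x" and ST: "blinfun_apply S (blinfun_apply T x) = x" for x
    using assms(2,3) by (metis blinfun_apply_blinfun_compose blinfun_apply_id_blinfun id_apply)+
  have "blinfun_apply S (c *\<^sub>C x) = c *\<^sub>C blinfun_apply S x" for c x
    by (metis TS ST assms(1) bounded_opsD)
  then show ?thesis
    using assms by (simp add: op_is_inverse_def bounded_ops_def)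
qed

definition op_invertible :: "('a::complex_hilbert \<Rightarrow>\<^sub>L 'a) \<Rightarrow> bool"
  where "op_invertible T \<longleftrightarrow> (\<exists>S. op_is_inverse T S)"

lemma op_invertible_compose:
  assumes "op_invertible S" "op_invertible T"
  shows "op_invertible (S o\<^sub>L T)"
proof -
  obtain S' T' where *: "op_is_inverse S S'" "op_is_inverse T T'"
    using assms by (auto simp: op_invertible_def)
  have "op_is_inverse (S o\<^sub>L T) (T' o\<^sub>L S')"
    unfolding op_is_inverse_def
  proof (intro conjI)
    show "T' o\<^sub>L S' \<in> bounded_ops"
      using * by (auto simp: op_is_inverse_def intro: bounded_ops_compose)
    have "blinfun_apply T (blinfun_apply T' x) = x" "blinfun_apply T' (blinfun_apply T x) = x"
      "blinfun_apply S (blinfun_apply S' x) = x" "blinfun_apply S' (blinfun_apply S x) = x" for x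
      using * unfolding op_is_inverse_def
      by (metis blinfun_apply_blinfun_compose blinfun_apply_id_blinfun id_apply)+
    then show "(S o\<^sub>L T) o\<^sub>L (T' o\<^sub>L S') = id_blinfun" "(T' o\<^sub>L S') o\<^sub>L (S o\<^sub>L T) = id_blinfun"
      by (auto intro!: blinfun_eqI)
  qed
  then show ?thesis by (auto simp: op_invertible_def)
qed

lemma op_invertible_scaleR:
  assumes "op_invertible T" "c \<noteq> 0"
  shows "op_invertible (c *\<^sub>R T)"
proof -
  obtain S where "op_is_inverse T S" using assms by (auto simp: op_invertible_def)
  then have "op_is_inverse (c *\<^sub>R T) ((1 / c) *\<^sub>R S)"
    using \<open>c \<noteq> 0\<close> unfolding op_is_inverse_def
    by (simp add: bounded_ops_scaleR bounded_bilinear.scaleR_left[OF bounded_bilinear_blinfun_compose]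
        bounded_bilinear.scaleR_right[OF bounded_bilinear_blinfun_compose])
  then show ?thesis by (auto simp: op_invertible_def)
qed

lemma op_invertible_id: "op_invertible id_blinfun"
  unfolding op_invertible_def op_is_inverse_def
  by (intro exI[of _ id_blinfun]) (auto simp: bounded_ops_id intro: blinfun_eqI)

text \<open>A self-adjoint \<open>T \<ge> \<epsilon> > 0\<close> is onto because, for large \<open>c\<close>, the equation \<open>T x = y\<close> is the
  fixed point equation of the contraction \<open>x \<mapsto> (1 - T/c) x + y/c\<close>.\<close>

lemma op_invertible_of_lower_bound:
  assumes T: "op_selfadjoint T" and "0 < \<epsilon>"
    and lower: "\<And>x. \<epsilon> * (norm x)\<^sup>2 \<le> ip (blinfun_apply T x) x"
  shows "op_invertible T"
proof -
  define c where "c = norm T + \<epsilon>"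
  have c: "0 < c" "\<epsilon> \<le> c" using \<open>0 < \<epsilon>\<close> by (auto simp: c_def intro: add_nonneg_pos)
  define R where "R = id_blinfun - (1 / c) *\<^sub>R T"
  have R_apply: "blinfun_apply R x = x - (1 / c) *\<^sub>R blinfun_apply T x" for x
    by (simp add: R_def blinfun.diff_left blinfun.scaleR_left)
  have normR: "norm R \<le> 1 - \<epsilon> / c"
  proof (rule norm_le_of_quadratic_form)
    show "op_selfadjoint R"
      unfolding R_def by (intro op_selfadjoint_diff op_selfadjoint_id op_selfadjoint_scaleR T)
    show "0 \<le> 1 - \<epsilon> / c" using c by simp
    show "\<bar>ip (blinfun_apply R x) x\<bar> \<le> (1 - \<epsilon> / c) * (norm x)\<^sup>2" for x
    proof -
      have "ip (blinfun_apply T x) x \<le> norm T * (norm x)\<^sup>2"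
        using op_between_norm[OF T] by (simp add: op_between_def)
      also have "\<dots> \<le> c * (norm x)\<^sup>2"
        using \<open>0 < \<epsilon>\<close> by (intro mult_right_mono) (auto simp: c_def)
      finally have "(1 / c) * ip (blinfun_apply T x) x \<le> (norm x)\<^sup>2"
        using c by (simp add: field_simps)
      moreover have "(\<epsilon> / c) * (norm x)\<^sup>2 \<le> (1 / c) * ip (blinfun_apply T x) x"
        using lower[of x] c by (simp add: field_simps)
      ultimately show ?thesis
        by (simp add: R_apply ip_simps ip_self left_diff_distrib)
    qed
  qed
  have solution: "\<exists>!x. blinfun_apply T x = y" for y
  proof -
    have "\<exists>!x. blinfun_apply R x + (1 / c) *\<^sub>R y = x"
    proof (rule banach_fix_type)
      show "0 \<le> 1 - \<epsilon> / c" "1 - \<epsilon> / c < 1" using c \<open>0 < \<epsilon>\<close> by auto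
      show "\<forall>u v. dist (blinfun_apply R u + (1 / c) *\<^sub>R y) (blinfun_apply R v + (1 / c) *\<^sub>R y)
          \<le> (1 - \<epsilon> / c) * dist u v"
      proof (intro allI)
        fix u v
        have "dist (blinfun_apply R u + (1 / c) *\<^sub>R y) (blinfun_apply R v + (1 / c) *\<^sub>R y)
            = norm (blinfun_apply R (u - v))"
          by (simp add: dist_norm blinfun.diff_right)
        also have "\<dots> \<le> norm R * norm (u - v)" by (rule norm_blinfun)
        also have "\<dots> \<le> (1 - \<epsilon> / c) * norm (u - v)" by (intro mult_right_mono normR) simp
        finally show "dist (blinfun_apply R u + (1 / c) *\<^sub>R y) (blinfun_apply R v + (1 / c) *\<^sub>R y)
          \<le> (1 - \<epsilon> / c) * dist u v" by (simp add: dist_norm)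
      qed
    qed
    moreover have "blinfun_apply R x + (1 / c) *\<^sub>R y = x \<longleftrightarrow> blinfun_apply T x = y" for x
      using c by (auto simp: R_apply algebra_simps)
    ultimately show ?thesis by simp
  qed
  define g where "g y = (THE x. blinfun_apply T x = y)" for y
  have Tg: "blinfun_apply T (g y) = y" for y
    unfolding g_def by (rule theI') (rule solution)
  have gT: "g (blinfun_apply T x) = x" for x
    using Tg[of "blinfun_apply T x"] solution[of "blinfun_apply T x"] by auto
  have g_eqI: "g y = x" if "blinfun_apply T x = y" for x y using gT that by auto
  have below: "\<epsilon> * norm x \<le> norm (blinfun_apply T x)" for x
  proof (cases "x = 0")
    case False
    have "norm x * (\<epsilon> * norm x) \<le> norm x * norm (blinfun_apply T x)"
      using lower[of x] ip_le_norm[of "blinfun_apply T x" x]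
      by (simp add: power2_eq_square mult.assoc mult.commute mult.left_commute)
    then show ?thesis using False by simp
  qed simp
  have "bounded_linear g"
  proof (rule bounded_linear_intro[where K = "1 / \<epsilon>"])
    show "g (x + y) = g x + g y" for x y by (rule g_eqI) (simp add: blinfun.add_right Tg)
    show "g (r *\<^sub>R x) = r *\<^sub>R g x" for r x by (rule g_eqI) (simp add: blinfun.scaleR_right Tg)
    show "norm (g x) \<le> norm x * (1 / \<epsilon>)" for x
      using below[of "g x"] \<open>0 < \<epsilon>\<close> by (simp add: Tg field_simps)
  qed
  then have "blinfun_apply (Blinfun g) = g" by (rule bounded_linear_Blinfun_apply)
  then have "op_is_inverse T (Blinfun g)"
    using op_selfadjoint_bounded_ops[OF T]
    by (intro op_is_inverseI) (auto intro!: blinfun_eqI simp: Tg gT)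
  then show ?thesis by (auto simp: op_invertible_def)
qed

lemma op_invertible_of_upper_bound:
  assumes "op_selfadjoint T" "0 < \<epsilon>" "\<And>x. ip (blinfun_apply T x) x \<le> - \<epsilon> * (norm x)\<^sup>2"
  shows "op_invertible T"
proof -
  have "op_invertible ((-1) *\<^sub>R T)"
  proof (rule op_invertible_of_lower_bound[OF op_selfadjoint_scaleR \<open>0 < \<epsilon>\<close>])
    show "\<epsilon> * (norm x)\<^sup>2 \<le> ip (blinfun_apply ((-1) *\<^sub>R T) x) x" for x
      using assms(3)[of x] by (simp add: blinfun.minus_left ip_simps)
  qed fact
  from op_invertible_scaleR[OF this, of "-1"] show ?thesis by simp
qed

section \<open>Polynomials of a self-adjoint operator\<close>

lemmas blinfun_compose_simps =
  bounded_bilinear.add_left[OF bounded_bilinear_blinfun_compose]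
  bounded_bilinear.add_right[OF bounded_bilinear_blinfun_compose]
  bounded_bilinear.diff_left[OF bounded_bilinear_blinfun_compose]
  bounded_bilinear.diff_right[OF bounded_bilinear_blinfun_compose]
  bounded_bilinear.scaleR_left[OF bounded_bilinear_blinfun_compose]
  bounded_bilinear.scaleR_right[OF bounded_bilinear_blinfun_compose]

lemma blinfun_compose_assoc: "(S o\<^sub>L T) o\<^sub>L U = S o\<^sub>L (T o\<^sub>L U)"
  by (rule blinfun_eqI) simp

lemma blinfun_compose_id [simp]: "id_blinfun o\<^sub>L T = T" "T o\<^sub>L id_blinfun = T"
  by (auto intro: blinfun_eqI)

lemma op_poly_eq_sum:
  assumes "degree q \<le> n"
  shows "op_poly q T = (\<Sum>i\<le>n. coeff q i *\<^sub>R (((o\<^sub>L) T ^^ i) id_blinfun))"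
  unfolding op_poly_def
  by (rule sum.mono_neutral_left) (use assms in \<open>auto intro: coeff_eq_0\<close>)

lemma op_poly_add: "op_poly (p + q) T = op_poly p T + op_poly q T"
  by (simp add: op_poly_eq_sum[where n = "max (degree p) (degree q)"] degree_add_le
      sum.distrib scaleR_add_left)

lemma op_poly_smult: "op_poly (smult c q) T = c *\<^sub>R op_poly q T"
  by (simp add: op_poly_eq_sum[where n = "degree q"] degree_smult_le scaleR_sum_right)

lemma op_poly_0 [simp]: "op_poly 0 T = 0"
  by (simp add: op_poly_def)

lemma op_poly_pCons: "op_poly (pCons c q) T = c *\<^sub>R id_blinfun + (T o\<^sub>L op_poly q T)"
proof -
  have "op_poly (pCons c q) T =
      (\<Sum>i\<le>Suc (degree q). coeff (pCons c q) i *\<^sub>R (((o\<^sub>L) T ^^ i) id_blinfun))"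
    by (intro op_poly_eq_sum degree_pCons_le)
  also have "\<dots> = c *\<^sub>R id_blinfun + (\<Sum>i\<le>degree q. coeff q i *\<^sub>R (T o\<^sub>L ((o\<^sub>L) T ^^ i) id_blinfun))"
    by (subst sum.atMost_Suc_shift) simp
  also have "(\<Sum>i\<le>degree q. coeff q i *\<^sub>R (T o\<^sub>L ((o\<^sub>L) T ^^ i) id_blinfun)) = T o\<^sub>L op_poly q T"
    by (simp add: op_poly_def bounded_bilinear.sum_right[OF bounded_bilinear_blinfun_compose]
        blinfun_compose_simps)
  finally show ?thesis .
qed

lemma op_poly_diff: "op_poly (p - q) T = op_poly p T - op_poly q T"
  using op_poly_add[of p "smult (-1) q" T] op_poly_smult[of "-1" q T] by simp

lemma op_poly_const: "op_poly [:c:] T = op_scalar c"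
  by (simp add: op_poly_pCons)

lemma op_poly_linear: "op_poly [:c, d:] T = op_scalar c + d *\<^sub>R T"
  by (simp add: op_poly_pCons blinfun_compose_simps)

lemma op_poly_mult: "op_poly (p * q) T = op_poly p T o\<^sub>L op_poly q T"
  by (induction p)
    (simp_all add: op_poly_add op_poly_smult op_poly_pCons blinfun_compose_simps blinfun_compose_assoc)

lemma op_poly_sum: "op_poly (\<Sum>i\<in>I. q i) T = (\<Sum>i\<in>I. op_poly (q i) T)"
  by (induction I rule: infinite_finite_induct) (auto simp: op_poly_add)

lemma op_selfadjoint_op_poly:
  assumes "op_selfadjoint T" shows "op_selfadjoint (op_poly q T)"
proof (induction q)
  case (pCons c q)
  have "T = op_poly [:0, 1:] T" by (simp add: op_poly_linear)
  then have "T o\<^sub>L op_poly q T = op_poly q T o\<^sub>L T"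
    by (metis mult.commute op_poly_mult)
  then show ?case
    unfolding op_poly_pCons
    by (intro op_selfadjoint_add op_selfadjoint_scaleR op_selfadjoint_id op_selfadjoint_compose assms pCons)
qed (simp add: op_selfadjoint_zero)

subsection \<open>The spectrum\<close>

text \<open>For self-adjoint operators this is the whole spectrum.\<close>

definition real_spectrum :: "('a::complex_hilbert \<Rightarrow>\<^sub>L 'a) \<Rightarrow> real set"
  where "real_spectrum T = {t. complex_of_real t \<in> op_spectrum T}"

lemma real_spectrum_iff: "t \<in> real_spectrum T \<longleftrightarrow> \<not> op_invertible (T - op_scalar t)"
proof -
  have "op_scaleC (complex_of_real t) id_blinfun = (op_scalar t :: 'a \<Rightarrow>\<^sub>L 'a)"
    by (rule blinfun_eqI) (simp add: op_scaleC.rep_eq blinfun.scaleR_left scaleC_of_real)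
  then show ?thesis
    by (simp add: real_spectrum_def op_spectrum_def op_invertible_def)
qed

lemma real_spectrum_subset:
  assumes "op_between a b T" shows "real_spectrum T \<subseteq> {a..b}"
proof
  fix t assume t: "t \<in> real_spectrum T"
  have T: "op_selfadjoint T" using assms by (rule op_between_selfadjoint)
  have sa: "op_selfadjoint (T - op_scalar t)"
    by (intro op_selfadjoint_diff op_selfadjoint_scaleR op_selfadjoint_id T)
  have form: "ip (blinfun_apply (T - op_scalar t) x) x = ip (blinfun_apply T x) x - t * (norm x)\<^sup>2" for x
    by (simp add: blinfun.diff_left blinfun.scaleR_left ip_simps ip_self)
  have "\<not> t < a"
  proof
    assume "t < a"
    have "op_invertible (T - op_scalar t)"
    proof (rule op_invertible_of_lower_bound[OF sa])
      show "0 < a - t" using \<open>t < a\<close> by simp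
      show "(a - t) * (norm x)\<^sup>2 \<le> ip (blinfun_apply (T - op_scalar t) x) x" for x
        using assms unfolding form by (simp add: op_between_def left_diff_distrib)
    qed
    then show False using t by (simp add: real_spectrum_iff)
  qed
  moreover have "\<not> b < t"
  proof
    assume "b < t"
    have "op_invertible (T - op_scalar t)"
    proof (rule op_invertible_of_upper_bound[OF sa])
      show "0 < t - b" using \<open>b < t\<close> by simp
      show "ip (blinfun_apply (T - op_scalar t) x) x \<le> - (t - b) * (norm x)\<^sup>2" for x
        using assms unfolding form by (simp add: op_between_def left_diff_distrib)
    qed
    then show False using t by (simp add: real_spectrum_iff)
  qed
  ultimately show "t \<in> {a..b}" by simp
qed

lemma poly_map_poly_of_real_add:
  "poly (map_poly complex_of_real (p + q)) z = poly (map_poly complex_of_real p) z + poly (map_poly complex_of_real q) z"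
  by (induction p q rule: poly_induct2) (simp_all add: map_poly_pCons algebra_simps)

lemma poly_map_poly_of_real_smult:
  "poly (map_poly complex_of_real (smult c q)) z = complex_of_real c * poly (map_poly complex_of_real q) z"
  by (induction q) (simp_all add: map_poly_pCons algebra_simps)

lemma poly_map_poly_of_real_mult:
  "poly (map_poly complex_of_real (p * q)) z = poly (map_poly complex_of_real p) z * poly (map_poly complex_of_real q) z"
  by (induction p)
    (simp_all add: map_poly_pCons poly_map_poly_of_real_add poly_map_poly_of_real_smult algebra_simps)

lemma real_quadratic_dvd:
  assumes z: "poly (map_poly complex_of_real q) z = 0" and "Im z \<noteq> 0"
  shows "[:(cmod z)\<^sup>2, - 2 * Re z, 1:] dvd q"
proof -
  define d where "d = [:(cmod z)\<^sup>2, - 2 * Re z, 1:]"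
  have dz: "poly (map_poly complex_of_real d) z = 0"
    using cmod_power2[of z]
    by (simp add: d_def map_poly_pCons complex_eq_iff power2_eq_square algebra_simps)
  define e where "e = q mod d"
  have "q = q div d * d + e" by (simp add: e_def)
  then have "poly (map_poly complex_of_real q) z = poly (map_poly complex_of_real e) z"
    using dz by (metis poly_map_poly_of_real_add poly_map_poly_of_real_mult mult_zero_right add_0)
  then have ez: "poly (map_poly complex_of_real e) z = 0" using z by simp
  have "degree e < 2"
    using degree_mod_less[of d q] by (auto simp: d_def e_def)
  then have e: "e = [:coeff e 0, coeff e 1:]"
    by (intro poly_eqI) (auto simp: coeff_pCons coeff_eq_0 split: nat.splits)
  have "complex_of_real (coeff e 0) + z * complex_of_real (coeff e 1) = 0"
    using ez by (subst (asm) e) (simp add: map_poly_pCons)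
  then have "coeff e 1 = 0" "coeff e 0 = 0"
    using \<open>Im z \<noteq> 0\<close> by (auto simp: complex_eq_iff)
  then have "e = 0" using e by simp
  then show ?thesis unfolding d_def[symmetric] e_def by (simp add: mod_eq_0_iff_dvd)
qed

text \<open>Spectral mapping for real polynomials: split \<open>q\<close> into its real linear factors, whose values at
  \<open>T\<close> are invertible because their roots avoid the spectrum, and its irreducible quadratic factors
  \<open>(t - u)\<^sup>2 + v\<^sup>2\<close>, whose values at \<open>T\<close> are bounded below by \<open>v\<^sup>2 > 0\<close>.\<close>

lemma op_invertible_op_poly:
  assumes T: "op_selfadjoint T"
  shows "q \<noteq> 0 \<Longrightarrow> (\<And>t. t \<in> real_spectrum T \<Longrightarrow> poly q t \<noteq> 0) \<Longrightarrow> op_invertible (op_poly q T)"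
proof (induction "degree q" arbitrary: q rule: less_induct)
  case less
  show ?case
  proof (cases "degree q = 0")
    case True
    then obtain c where "q = [:c:]" by (rule degree_eq_zeroE)
    then show ?thesis
      using less.prems(1) by (simp add: op_poly_const op_invertible_scaleR op_invertible_id)
  next
    case False
    have "degree (map_poly complex_of_real q) \<noteq> 0"
      using False by (simp add: degree_map_poly)
    then obtain z where z: "poly (map_poly complex_of_real q) z = 0"
      using fundamental_theorem_of_algebra[of "map_poly complex_of_real q"]
      by (auto simp: constant_degree)
    have factor: ?thesis
      if d: "q = d * q'" "0 < degree d" and inv: "op_invertible (op_poly d T)" for d q'
    proof -
      have "q' \<noteq> 0" "d \<noteq> 0" using d less.prems(1) by auto
      then have "degree q' < degree q" using d by (simp add: degree_mult_eq)
      moreover have "poly q' t \<noteq> 0" if "t \<in> real_spectrum T" for t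
        using less.prems(2)[OF that] d by auto
      ultimately have "op_invertible (op_poly q' T)"
        using less.hyps \<open>q' \<noteq> 0\<close> by blast
      then show ?thesis
        unfolding \<open>q = d * q'\<close> op_poly_mult by (intro op_invertible_compose inv)
    qed
    show ?thesis
    proof (cases "Im z = 0")
      case True
      then have zr: "z = complex_of_real (Re z)" by (simp add: complex_eq_iff)
      have "complex_of_real (poly p (Re z)) = poly (map_poly complex_of_real p) z" for p
        by (subst (2) zr) (induction p, simp_all add: map_poly_pCons)
      then have root: "poly q (Re z) = 0" using z by (metis of_real_eq_0_iff)
      then obtain q' where q': "q = [:- Re z, 1:] * q'"
        by (auto simp: poly_eq_0_iff_dvd dvd_def)
      show ?thesis
      proof (rule factor[OF q'])
        have "Re z \<notin> real_spectrum T" using less.prems(2) root by blast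
        then show "op_invertible (op_poly [:- Re z, 1:] T)"
          by (simp add: real_spectrum_iff op_poly_linear)
      qed simp
    next
      case nonreal: False
      let ?d = "[:(cmod z)\<^sup>2, - 2 * Re z, 1:]"
      obtain q' where q': "q = ?d * q'"
        using real_quadratic_dvd[OF z nonreal] by (auto simp: dvd_def)
      show ?thesis
      proof (rule factor[OF q'])
        show "op_invertible (op_poly ?d T)"
        proof (rule op_invertible_of_lower_bound[OF op_selfadjoint_op_poly[OF T]])
          show "0 < (Im z)\<^sup>2" using nonreal by simp
          show "(Im z)\<^sup>2 * (norm x)\<^sup>2 \<le> ip (blinfun_apply (op_poly ?d T) x) x" for x
          proof -
            have "op_poly ?d T = op_scalar ((cmod z)\<^sup>2) - (2 * Re z) *\<^sub>R T + (T o\<^sub>L T)"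
              by (simp add: op_poly_pCons blinfun_compose_simps)
            then have "blinfun_apply (op_poly ?d T) x =
                (cmod z)\<^sup>2 *\<^sub>R x - (2 * Re z) *\<^sub>R blinfun_apply T x + blinfun_apply T (blinfun_apply T x)"
              by (simp add: blinfun.add_left blinfun.diff_left blinfun.scaleR_left)
            then have "ip (blinfun_apply (op_poly ?d T) x) x =
                (cmod z)\<^sup>2 * (norm x)\<^sup>2 - 2 * Re z * ip (blinfun_apply T x) x + (norm (blinfun_apply T x))\<^sup>2"
              using op_selfadjoint_ip[OF T, of "blinfun_apply T x" x]
              by (simp add: ip_simps ip_self)
            also have "\<dots> = (norm (blinfun_apply T x - Re z *\<^sub>R x))\<^sup>2 + (Im z)\<^sup>2 * (norm x)\<^sup>2"
              unfolding cmod_power2 ip_self[symmetric]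
              by (simp add: ip_simps ip_commute[of x "blinfun_apply T x"] power2_eq_square algebra_simps)
            finally have "ip (blinfun_apply (op_poly ?d T) x) x =
                (norm (blinfun_apply T x - Re z *\<^sub>R x))\<^sup>2 + (Im z)\<^sup>2 * (norm x)\<^sup>2" .
            then show ?thesis by simp
          qed
        qed
      qed simp
    qed
  qed
qed

text \<open>On unit vectors that almost attain \<open>\<kappa> = \<parallel>N\<parallel>\<close>,
  \<open>\<parallel>(\<kappa>\<^sup>2 - N\<^sup>2) x\<parallel>\<^sup>2 \<le> 2 \<kappa>\<^sup>2 (\<kappa>\<^sup>2 - \<parallel>N x\<parallel>\<^sup>2)\<close> is almost zero.\<close>

lemma norm_square_minus_square_not_invertible:
  assumes N: "op_selfadjoint N" and nontrivial: "\<exists>x::'a::complex_hilbert. x \<noteq> 0"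
  shows "\<not> op_invertible (op_scalar ((norm N)\<^sup>2) - (N o\<^sub>L N) :: 'a \<Rightarrow>\<^sub>L 'a)"
proof
  assume "op_invertible (op_scalar ((norm N)\<^sup>2) - (N o\<^sub>L N))"
  then obtain R where R: "R o\<^sub>L (op_scalar ((norm N)\<^sup>2) - (N o\<^sub>L N)) = id_blinfun"
    by (auto simp: op_invertible_def op_is_inverse_def)
  define \<kappa> where "\<kappa> = norm N"
  define \<rho> where "\<rho> = norm R"
  have "0 \<le> \<kappa>" by (simp add: \<kappa>_def)
  have key: "(norm x)\<^sup>2 \<le> \<rho>\<^sup>2 * (2 * \<kappa>\<^sup>2 * (\<kappa>\<^sup>2 * (norm x)\<^sup>2 - (norm (blinfun_apply N x))\<^sup>2))" for x
  proof -
    let ?y = "blinfun_apply N (blinfun_apply N x)"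
    have "x = blinfun_apply R (\<kappa>\<^sup>2 *\<^sub>R x - ?y)"
      using arg_cong[OF R, of "\<lambda>T. blinfun_apply T x"]
      by (simp add: blinfun.diff_left blinfun.scaleR_left \<kappa>_def)
    then have "norm x \<le> \<rho> * norm (\<kappa>\<^sup>2 *\<^sub>R x - ?y)"
      using norm_blinfun[of R "\<kappa>\<^sup>2 *\<^sub>R x - ?y"] by (simp add: \<rho>_def)
    then have bound: "(norm x)\<^sup>2 \<le> \<rho>\<^sup>2 * (norm (\<kappa>\<^sup>2 *\<^sub>R x - ?y))\<^sup>2"
      using power_mono[of "norm x" "\<rho> * norm (\<kappa>\<^sup>2 *\<^sub>R x - ?y)" 2] by (simp add: power_mult_distrib)
    have "norm ?y \<le> \<kappa> * norm (blinfun_apply N x)" "norm (blinfun_apply N x) \<le> \<kappa> * norm x"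
      unfolding \<kappa>_def by (rule norm_blinfun)+
    then have N1: "(norm ?y)\<^sup>2 \<le> \<kappa>\<^sup>2 * (norm (blinfun_apply N x))\<^sup>2"
      and N2: "(norm (blinfun_apply N x))\<^sup>2 \<le> \<kappa>\<^sup>2 * (norm x)\<^sup>2"
      by (metis norm_ge_zero power_mono power_mult_distrib)+
    have "(norm (\<kappa>\<^sup>2 *\<^sub>R x - ?y))\<^sup>2 =
        \<kappa>\<^sup>2 * (\<kappa>\<^sup>2 * (norm x)\<^sup>2) - 2 * \<kappa>\<^sup>2 * (norm (blinfun_apply N x))\<^sup>2 + (norm ?y)\<^sup>2"
      using op_selfadjoint_ip[OF N, of x "blinfun_apply N x"]
      unfolding ip_self[symmetric]
      by (simp add: ip_simps ip_commute[of ?y x] algebra_simps)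
    also have "\<dots> \<le> 2 * \<kappa>\<^sup>2 * (\<kappa>\<^sup>2 * (norm x)\<^sup>2 - (norm (blinfun_apply N x))\<^sup>2)"
      using N1 mult_left_mono[OF N2, of "\<kappa>\<^sup>2"] by (simp add: algebra_simps)
    finally show ?thesis
      using bound by (meson mult_left_mono order_trans zero_le_power2)
  qed
  obtain x :: 'a where "x \<noteq> 0" using nontrivial by blast
  then have "\<rho>\<^sup>2 * (2 * \<kappa>\<^sup>2 * (\<kappa>\<^sup>2 * (norm x)\<^sup>2 - (norm (blinfun_apply N x))\<^sup>2)) > 0"
    using key[of x] by (smt (verit) norm_eq_zero zero_less_power2)
  then have "\<rho> \<noteq> 0" "\<kappa> \<noteq> 0" by auto
  define \<delta> where "\<delta> = 1 / (2 * \<rho>\<^sup>2 * \<kappa>\<^sup>2)"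
  have "0 < \<delta>" using \<open>\<rho> \<noteq> 0\<close> \<open>\<kappa> \<noteq> 0\<close> by (simp add: \<delta>_def)
  have bound: "(norm (blinfun_apply N x))\<^sup>2 \<le> (\<kappa>\<^sup>2 - \<delta>) * (norm x)\<^sup>2" for x
  proof -
    have "\<delta> * (norm x)\<^sup>2 \<le> \<kappa>\<^sup>2 * (norm x)\<^sup>2 - (norm (blinfun_apply N x))\<^sup>2"
      using key[of x] \<open>\<rho> \<noteq> 0\<close> \<open>\<kappa> \<noteq> 0\<close> by (simp add: \<delta>_def field_simps)
    then show ?thesis by (simp add: algebra_simps)
  qed
  have "0 \<le> (\<kappa>\<^sup>2 - \<delta>) * (norm x)\<^sup>2" by (rule order_trans[OF _ bound]) simp
  then have nonneg: "0 \<le> \<kappa>\<^sup>2 - \<delta>" using \<open>x \<noteq> 0\<close> by (simp add: zero_le_mult_iff)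
  have "norm N \<le> sqrt (\<kappa>\<^sup>2 - \<delta>)"
  proof (rule norm_blinfun_bound)
    show "norm (blinfun_apply N x) \<le> sqrt (\<kappa>\<^sup>2 - \<delta>) * norm x" for x
      using real_sqrt_le_mono[OF bound[of x]] by (simp add: real_sqrt_mult)
  qed (use nonneg in simp)
  then have "\<kappa>\<^sup>2 \<le> \<kappa>\<^sup>2 - \<delta>"
    using nonneg \<open>0 \<le> \<kappa>\<close> by (metis \<kappa>_def power_mono real_sqrt_pow2)
  then show False using \<open>0 < \<delta>\<close> by simp
qed

lemma op_poly_norm_minus_square:
  "op_poly ([:c:] - q * q) T = op_scalar c - (op_poly q T o\<^sub>L op_poly q T)"
  by (simp add: op_poly_diff op_poly_const op_poly_mult)

lemma real_spectrum_nonempty: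
  assumes T: "op_selfadjoint T" and nontrivial: "\<exists>x::'a::complex_hilbert. x \<noteq> 0"
  shows "real_spectrum (T :: 'a \<Rightarrow>\<^sub>L 'a) \<noteq> {}"
proof
  assume "real_spectrum T = {}"
  moreover have "[:(norm T)\<^sup>2:] - [:0, 1:] * [:0, 1:] \<noteq> 0" by simp
  ultimately have "op_invertible (op_poly ([:(norm T)\<^sup>2:] - [:0, 1:] * [:0, 1:]) T)"
    by (intro op_invertible_op_poly T) auto
  then have "op_invertible (op_scalar ((norm T)\<^sup>2) - (T o\<^sub>L T))"
    unfolding op_poly_norm_minus_square by (simp add: op_poly_linear)
  with norm_square_minus_square_not_invertible[OF T nontrivial] show False ..
qed

text \<open>On a nonzero space, with \<open>N = q(T)\<close>, the operator \<open>\<parallel>N\<parallel>\<^sup>2 - N\<^sup>2\<close> is a polynomial of \<open>T\<close> that is not invertible, so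
  \<open>\<bar>q\<bar> = \<parallel>N\<parallel>\<close> somewhere on the spectrum.\<close>

lemma norm_op_poly_le:
  assumes T: "op_selfadjoint T" and "0 \<le> \<epsilon>"
    and bound: "\<And>t. t \<in> real_spectrum T \<Longrightarrow> \<bar>poly q t\<bar> \<le> \<epsilon>"
  shows "norm (op_poly q T) \<le> \<epsilon>"
proof (cases "\<exists>x::'a. x \<noteq> 0")
  case False
  then have "op_poly q T = 0" by (intro blinfun_eqI) auto
  then show ?thesis using \<open>0 \<le> \<epsilon>\<close> by simp
next
  case True
  show ?thesis
  proof (rule ccontr)
    assume "\<not> ?thesis"
    then have big: "\<epsilon> < norm (op_poly q T)" by simp
    let ?d = "[:(norm (op_poly q T))\<^sup>2:] - q * q"
    have "\<exists>t\<in>real_spectrum T. poly ?d t = 0"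
    proof (cases "?d = 0")
      case True
      then have "poly ?d t = 0" for t by simp
      then show ?thesis using real_spectrum_nonempty[OF T \<open>\<exists>x. x \<noteq> 0\<close>] by blast
    next
      case False
      have "\<not> op_invertible (op_poly ?d T)"
        unfolding op_poly_norm_minus_square
        by (rule norm_square_minus_square_not_invertible[OF op_selfadjoint_op_poly[OF T] True])
      then show ?thesis using op_invertible_op_poly[OF T False] by blast
    qed
    then obtain t where t: "t \<in> real_spectrum T" "poly ?d t = 0" by blast
    then have "(poly q t)\<^sup>2 = (norm (op_poly q T))\<^sup>2"
      by (simp add: power2_eq_square)
    then have "\<bar>poly q t\<bar> = norm (op_poly q T)"
      by (metis abs_norm_cancel power2_abs power2_eq_iff_nonneg abs_ge_zero norm_ge_zero)
    with bound[OF t(1)] big show False by simp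
  qed
qed

text \<open>Apply the norm bound after subtracting the midpoint of \<open>c\<close> and \<open>d\<close>.\<close>

lemma op_between_op_poly:
  assumes T: "op_between a b T" and "a \<le> b"
    and bound: "\<And>t. t \<in> {a..b} \<Longrightarrow> c \<le> poly q t \<and> poly q t \<le> d"
  shows "op_between c d (op_poly q T)"
proof -
  have sa: "op_selfadjoint T" by (rule op_between_selfadjoint[OF T])
  let ?\<mu> = "(c + d) / 2" and ?\<rho> = "(d - c) / 2"
  have "c \<le> d" using bound[of a] \<open>a \<le> b\<close> by simp
  have "norm (op_poly (q - [:?\<mu>:]) T) \<le> ?\<rho>"
  proof (rule norm_op_poly_le[OF sa])
    show "\<bar>poly (q - [:?\<mu>:]) t\<bar> \<le> ?\<rho>" if "t \<in> real_spectrum T" for t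
    proof -
      have "t \<in> {a..b}" using real_spectrum_subset[OF T] that by blast
      from bound[OF this] have "- ?\<rho> \<le> poly q t - ?\<mu> \<and> poly q t - ?\<mu> \<le> ?\<rho>"
        by (simp add: field_simps)
      then have "\<bar>poly q t - ?\<mu>\<bar> \<le> ?\<rho>" by linarith
      then show ?thesis by simp
    qed
  qed (use \<open>c \<le> d\<close> in simp)
  then have "op_between (- ?\<rho>) ?\<rho> (op_poly (q - [:?\<mu>:]) T)"
    by (intro op_between_mono[OF op_between_norm[OF op_selfadjoint_op_poly[OF sa]]]) auto
  then show ?thesis
    using op_selfadjoint_op_poly[OF sa, of q]
    by (simp add: op_between_def op_poly_diff op_poly_const blinfun.diff_left blinfun.scaleR_left
        ip_simps ip_self field_simps)
qed

section \<open>Continuous functional calculus\<close>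

subsection \<open>Bernstein polynomials on an interval\<close>

definition bernstein_poly :: "real \<Rightarrow> real \<Rightarrow> nat \<Rightarrow> nat \<Rightarrow> real poly"
  where "bernstein_poly a b n k = smult (real (n choose k))
    ([:- a / (b - a), 1 / (b - a):] ^ k * [:b / (b - a), - 1 / (b - a):] ^ (n - k))"

text \<open>The node is \<open>a\<close> for \<open>n = 0\<close>, because \<open>k / 0 = 0\<close>.\<close>

definition bernstein_node :: "real \<Rightarrow> real \<Rightarrow> nat \<Rightarrow> nat \<Rightarrow> real"
  where "bernstein_node a b n k = a + (b - a) * (real k / real n)"

definition bernstein_approx :: "real \<Rightarrow> real \<Rightarrow> (real \<Rightarrow> real) \<Rightarrow> nat \<Rightarrow> real poly"
  where "bernstein_approx a b f n =
    (\<Sum>k\<le>n. smult (f (bernstein_node a b n k)) (bernstein_poly a b n k))"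

lemma poly_bernstein_poly:
  assumes "a < b" shows "poly (bernstein_poly a b n k) t = Bernstein n k ((t - a) / (b - a))"
proof -
  have "poly [:- a / (b - a), 1 / (b - a):] t = (t - a) / (b - a)"
    by (simp add: diff_divide_distrib)
  moreover have "poly [:b / (b - a), - 1 / (b - a):] t = 1 - (t - a) / (b - a)"
  proof -
    have "1 - (t - a) / (b - a) = (b - t) / (b - a)"
      using assms by (simp add: divide_simps)
    then show ?thesis by (simp add: diff_divide_distrib)
  qed
  ultimately show ?thesis
    by (simp only: bernstein_poly_def Bernstein_def poly_smult poly_mult poly_power mult.assoc)
qed

lemma bernstein_poly_nonneg:
  assumes "a < b" "t \<in> {a..b}" shows "0 \<le> poly (bernstein_poly a b n k) t"
  using assms by (auto simp: poly_bernstein_poly intro!: Bernstein_nonneg)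

lemma sum_bernstein_poly:
  assumes "a < b" shows "(\<Sum>k\<le>n. poly (bernstein_poly a b n k) t) = 1"
  using assms by (simp add: poly_bernstein_poly)

lemma bernstein_node_mem:
  assumes "a < b" "k \<le> n" shows "bernstein_node a b n k \<in> {a..b}"
proof -
  have "0 \<le> real k / real n" "real k / real n \<le> 1"
    using assms(2) by (auto simp: divide_le_eq_1)
  then have "0 \<le> (b - a) * (real k / real n)" "(b - a) * (real k / real n) \<le> (b - a) * 1"
    using assms(1) by (intro mult_nonneg_nonneg mult_left_mono; simp)+
  then show ?thesis by (simp add: bernstein_node_def)
qed

lemma uniform_limit_bernstein_approx:
  assumes "a < b" "continuous_on {a..b} f"
  shows "uniform_limit {a..b} (\<lambda>n. poly (bernstein_approx a b f n)) f sequentially"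
proof (rule uniform_limitI)
  fix e :: real assume "0 < e"
  define g where "g s = f (a + (b - a) * s)" for s
  have "continuous_on {0..1} g"
    unfolding g_def
  proof (rule continuous_on_compose2[OF assms(2)])
    show "(\<lambda>s. a + (b - a) * s) ` {0..1} \<subseteq> {a..b}"
    proof safe
      fix s :: real assume "s \<in> {0..1}"
      then have "0 \<le> (b - a) * s" "(b - a) * s \<le> (b - a) * 1"
        using assms(1) by (intro mult_nonneg_nonneg mult_left_mono; simp)+
      then show "a + (b - a) * s \<in> {a..b}" by simp
    qed
  qed (intro continuous_intros)
  from Bernstein_Weierstrass[OF this \<open>0 < e\<close>] obtain N where
    N: "\<And>n x. N \<le> n \<Longrightarrow> x \<in> {0..1} \<Longrightarrow> \<bar>g x - (\<Sum>k\<le>n. g (k/n) * Bernstein n k x)\<bar> < e"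
    by blast
  have "dist (poly (bernstein_approx a b f n) t) (f t) < e" if "N \<le> n" "t \<in> {a..b}" for n t
  proof -
    have "(t - a) / (b - a) \<in> {0..1}" using that assms(1) by auto
    from N[OF \<open>N \<le> n\<close> this] have "\<bar>f t - poly (bernstein_approx a b f n) t\<bar> < e"
      using assms(1)
      by (simp add: g_def bernstein_approx_def bernstein_node_def poly_sum poly_bernstein_poly)
    then show ?thesis by (simp add: dist_real_def abs_minus_commute)
  qed
  then show "\<forall>\<^sub>F n in sequentially. \<forall>t\<in>{a..b}. dist (poly (bernstein_approx a b f n) t) (f t) < e"
    unfolding eventually_sequentially by blast
qed

subsection \<open>Functions of an operator\<close>

text \<open>Any two polynomial sequences with the same uniform limit on the spectrum give the same operator
  limit, because \<open>\<parallel>q(T)\<parallel>\<close> is bounded by the supremum of \<open>\<bar>q\<bar>\<close> on the spectrum.\<close>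

lemma op_poly_tendsto_op_fun:
  assumes T: "op_between a b T" and "a < b" and f: "continuous_on {a..b} f"
    and q: "uniform_limit {a..b} (\<lambda>n. poly (q n)) f sequentially"
  shows "(\<lambda>n. op_poly (q n) T) \<longlonglongrightarrow> op_fun f T"
proof -
  have sa: "op_selfadjoint T" by (rule op_between_selfadjoint[OF T])
  let ?S = "real_spectrum T"
  have close: "norm (op_poly u T - op_poly v T) \<le> 2 * e"
    if "0 < e" "\<forall>t\<in>?S. dist (poly u t) (f t) < e" "\<forall>t\<in>?S. dist (poly v t) (f t) < e" for u v e
    unfolding op_poly_diff[symmetric]
  proof (rule norm_op_poly_le[OF sa])
    show "\<bar>poly (u - v) t\<bar> \<le> 2 * e" if "t \<in> ?S" for t
      using that \<open>\<forall>t\<in>?S. dist (poly u t) (f t) < e\<close> \<open>\<forall>t\<in>?S. dist (poly v t) (f t) < e\<close>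
      by (fastforce simp: dist_real_def)
  qed (use \<open>0 < e\<close> in simp)
  have q_S: "uniform_limit ?S (\<lambda>n. poly (q n)) f sequentially"
    using q real_spectrum_subset[OF T] by (rule uniform_limit_on_subset)
  have "Cauchy (\<lambda>n. op_poly (q n) T)"
  proof (rule metric_CauchyI)
    fix e :: real assume "0 < e"
    then obtain N where N: "\<And>n. N \<le> n \<Longrightarrow> \<forall>t\<in>?S. dist (poly (q n) t) (f t) < e / 4"
      using uniform_limitD[OF q_S, of "e / 4"] by (auto simp: eventually_sequentially)
    have "dist (op_poly (q m) T) (op_poly (q n) T) < e" if "N \<le> m" "N \<le> n" for m n
      using close[of "e / 4" "q m" "q n"] N[OF that(1)] N[OF that(2)] \<open>0 < e\<close>
      by (simp add: dist_norm)
    then show "\<exists>N. \<forall>m\<ge>N. \<forall>n\<ge>N. dist (op_poly (q m) T) (op_poly (q n) T) < e" by blast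
  qed
  then obtain L where L: "(\<lambda>n. op_poly (q n) T) \<longlonglongrightarrow> L"
    using Cauchy_convergent_iff convergent_def by blast
  have "op_fun f T = L"
    unfolding op_fun_def real_spectrum_def[symmetric]
  proof (rule the_equality)
    show "\<forall>p. uniform_limit ?S (\<lambda>n. poly (p n)) f sequentially \<longrightarrow> (\<lambda>n. op_poly (p n) T) \<longlonglongrightarrow> L"
    proof (intro allI impI)
      fix p :: "nat \<Rightarrow> real poly"
      assume p: "uniform_limit ?S (\<lambda>n. poly (p n)) f sequentially"
      have "(\<lambda>n. op_poly (p n) T - op_poly (q n) T) \<longlonglongrightarrow> 0"
      proof (rule metric_LIMSEQ_I)
        fix e :: real assume "0 < e"
        then have "\<forall>\<^sub>F n in sequentially. (\<forall>t\<in>?S. dist (poly (p n) t) (f t) < e / 4) \<and>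
            (\<forall>t\<in>?S. dist (poly (q n) t) (f t) < e / 4)"
          using uniform_limitD[OF p, of "e / 4"] uniform_limitD[OF q_S, of "e / 4"]
          by (intro eventually_conj) auto
        then obtain N where N: "\<And>n. N \<le> n \<Longrightarrow> (\<forall>t\<in>?S. dist (poly (p n) t) (f t) < e / 4) \<and>
            (\<forall>t\<in>?S. dist (poly (q n) t) (f t) < e / 4)"
          by (auto simp: eventually_sequentially)
        have "dist (op_poly (p n) T - op_poly (q n) T) 0 < e" if "N \<le> n" for n
          using close[of "e / 4" "p n" "q n"] N[OF that] \<open>0 < e\<close> by simp
        then show "\<exists>N. \<forall>n\<ge>N. dist (op_poly (p n) T - op_poly (q n) T) 0 < e" by blast
      qed
      from tendsto_add[OF this L] show "(\<lambda>n. op_poly (p n) T) \<longlonglongrightarrow> L" by simp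
    qed
    fix L' assume "\<forall>p. uniform_limit ?S (\<lambda>n. poly (p n)) f sequentially \<longrightarrow> (\<lambda>n. op_poly (p n) T) \<longlonglongrightarrow> L'"
    then have "(\<lambda>n. op_poly (q n) T) \<longlonglongrightarrow> L'" using q_S by blast
    then show "L' = L" using L LIMSEQ_unique by blast
  qed
  then show ?thesis using L by simp
qed

lemma bernstein_approx_tendsto_op_fun:
  assumes "op_between a b T" "a < b" "continuous_on {a..b} f"
  shows "(\<lambda>n. op_poly (bernstein_approx a b f n) T) \<longlonglongrightarrow> op_fun f T"
  using assms uniform_limit_bernstein_approx[OF assms(2,3)] by (rule op_poly_tendsto_op_fun)

lemma op_fun_eqI:
  assumes "op_between a b T" "a < b" "continuous_on {a..b} f"
    and "uniform_limit {a..b} (\<lambda>n. poly (q n)) f sequentially"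
    and "(\<lambda>n. op_poly (q n) T) \<longlonglongrightarrow> L"
  shows "op_fun f T = L"
  using op_poly_tendsto_op_fun[OF assms(1-4)] assms(5) LIMSEQ_unique by blast

lemma op_fun_poly:
  assumes "op_between a b T" "a < b"
  shows "op_fun (poly q) T = op_poly q T"
  by (rule op_fun_eqI[OF assms, where q = "\<lambda>_. q"]) (auto intro!: continuous_intros uniform_limitI)

lemma op_fun_cong:
  assumes "op_between a b T" "a < b" "continuous_on {a..b} f" "\<And>t. t \<in> {a..b} \<Longrightarrow> f t = g t"
  shows "op_fun g T = op_fun f T"
proof (rule op_fun_eqI[OF assms(1,2) _ _ bernstein_approx_tendsto_op_fun[OF assms(1-3)]])
  show "continuous_on {a..b} g" using assms(3,4) continuous_on_cong by metis
  show "uniform_limit {a..b} (\<lambda>n. poly (bernstein_approx a b f n)) g sequentially"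
  proof -
    have "uniform_limit {a..b} (\<lambda>n. poly (bernstein_approx a b f n)) g sequentially \<longleftrightarrow>
        uniform_limit {a..b} (\<lambda>n. poly (bernstein_approx a b f n)) f sequentially"
      by (rule uniform_limit_cong') (simp_all add: assms(4))
    then show ?thesis using uniform_limit_bernstein_approx[OF assms(2,3)] by simp
  qed
qed

lemma op_fun_const:
  assumes "op_between a b T" "a < b"
  shows "op_fun (\<lambda>t. c) T = op_scalar c"
proof -
  have "poly [:c:] = (\<lambda>t. c)" by (rule ext) simp
  then show ?thesis using op_fun_poly[OF assms, of "[:c:]"] by (simp add: op_poly_const)
qed

lemma op_fun_ident:
  assumes "op_between a b T" "a < b"
  shows "op_fun (\<lambda>t. t) T = T"
proof -
  have "poly [:0, 1:] = (\<lambda>t. t :: real)" by (rule ext) simp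
  then show ?thesis using op_fun_poly[OF assms, of "[:0, 1:]"] by (simp add: op_poly_linear)
qed

lemma op_fun_add:
  assumes "op_between a b T" "a < b" "continuous_on {a..b} f" "continuous_on {a..b} g"
  shows "op_fun (\<lambda>t. f t + g t) T = op_fun f T + op_fun g T"
proof (rule op_fun_eqI[OF assms(1,2), where q = "\<lambda>n. bernstein_approx a b f n + bernstein_approx a b g n"])
  show "continuous_on {a..b} (\<lambda>t. f t + g t)" by (intro continuous_intros assms)
  show "uniform_limit {a..b} (\<lambda>n. poly (bernstein_approx a b f n + bernstein_approx a b g n))
      (\<lambda>t. f t + g t) sequentially"
    unfolding poly_add by (intro uniform_limit_add uniform_limit_bernstein_approx assms)
  show "(\<lambda>n. op_poly (bernstein_approx a b f n + bernstein_approx a b g n) T)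
      \<longlonglongrightarrow> op_fun f T + op_fun g T"
    unfolding op_poly_add by (intro tendsto_add bernstein_approx_tendsto_op_fun assms)
qed

lemma op_fun_mult:
  assumes "op_between a b T" "a < b" "continuous_on {a..b} f" "continuous_on {a..b} g"
  shows "op_fun (\<lambda>t. f t * g t) T = op_fun f T o\<^sub>L op_fun g T"
proof (rule op_fun_eqI[OF assms(1,2), where q = "\<lambda>n. bernstein_approx a b f n * bernstein_approx a b g n"])
  show "continuous_on {a..b} (\<lambda>t. f t * g t)" by (intro continuous_intros assms)
  show "uniform_limit {a..b} (\<lambda>n. poly (bernstein_approx a b f n * bernstein_approx a b g n))
      (\<lambda>t. f t * g t) sequentially"
    unfolding poly_mult
    by (intro uniform_lim_mult uniform_limit_bernstein_approx assms compact_imp_bounded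
        compact_continuous_image) auto
  show "(\<lambda>n. op_poly (bernstein_approx a b f n * bernstein_approx a b g n) T)
      \<longlonglongrightarrow> (op_fun f T o\<^sub>L op_fun g T)"
    unfolding op_poly_mult
    by (intro bounded_bilinear.tendsto[OF bounded_bilinear_blinfun_compose]
        bernstein_approx_tendsto_op_fun assms)
qed

lemma op_fun_cmult:
  assumes "op_between a b T" "a < b" "continuous_on {a..b} f"
  shows "op_fun (\<lambda>t. c * f t) T = c *\<^sub>R op_fun f T"
  using op_fun_mult[OF assms(1,2) continuous_on_const assms(3), of c] op_fun_const[OF assms(1,2), of c]
  by (simp add: blinfun_compose_simps)

lemma op_fun_diff:
  assumes "op_between a b T" "a < b" "continuous_on {a..b} f" "continuous_on {a..b} g"
  shows "op_fun (\<lambda>t. f t - g t) T = op_fun f T - op_fun g T"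
  using op_fun_add[OF assms(1-3), of "\<lambda>t. (-1) * g t"] op_fun_cmult[OF assms(1,2,4), of "-1"] assms(4)
  by (simp add: continuous_on_minus)

text \<open>The values of a Bernstein approximation are convex combinations of values of \<open>f\<close>, so it obeys the
  same bounds as \<open>f\<close>.\<close>

lemma op_between_op_fun:
  assumes T: "op_between a b T" "a < b" "continuous_on {a..b} f"
    and bound: "\<And>t. t \<in> {a..b} \<Longrightarrow> c \<le> f t \<and> f t \<le> d"
  shows "op_between c d (op_fun f T)"
proof (rule op_between_limit[OF _ bernstein_approx_tendsto_op_fun[OF T]])
  show "op_between c d (op_poly (bernstein_approx a b f n) T)" for n
  proof (rule op_between_op_poly[OF T(1)])
    fix t assume t: "t \<in> {a..b}"
    have sum: "poly (bernstein_approx a b f n) t =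
        (\<Sum>k\<le>n. f (bernstein_node a b n k) * poly (bernstein_poly a b n k) t)"
      by (simp add: bernstein_approx_def poly_sum)
    have summand: "c * poly (bernstein_poly a b n k) t \<le> f (bernstein_node a b n k) * poly (bernstein_poly a b n k) t"
      "f (bernstein_node a b n k) * poly (bernstein_poly a b n k) t \<le> d * poly (bernstein_poly a b n k) t"
      if "k \<le> n" for k
      using bound[OF bernstein_node_mem[OF T(2) that]] bernstein_poly_nonneg[OF T(2) t]
      by (auto intro: mult_right_mono)
    have "c * (\<Sum>k\<le>n. poly (bernstein_poly a b n k) t) \<le> poly (bernstein_approx a b f n) t"
      "poly (bernstein_approx a b f n) t \<le> d * (\<Sum>k\<le>n. poly (bernstein_poly a b n k) t)"
      unfolding sum sum_distrib_left by (auto intro!: sum_mono summand)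
    then show "c \<le> poly (bernstein_approx a b f n) t \<and> poly (bernstein_approx a b f n) t \<le> d"
      by (simp add: sum_bernstein_poly[OF T(2)])
  qed (use T in simp)
qed

lemma continuous_on_interval_bounds:
  assumes "continuous_on {a..b::real} f"
  obtains B :: real where "\<And>t. t \<in> {a..b} \<Longrightarrow> \<bar>f t\<bar> \<le> B" "0 \<le> B"
proof -
  have "bounded (f ` {a..b})"
    by (intro compact_imp_bounded compact_continuous_image assms) simp
  then obtain B where "\<And>t. t \<in> {a..b} \<Longrightarrow> \<bar>f t\<bar> \<le> B"
    unfolding bounded_real by blast
  then have "\<And>t. t \<in> {a..b} \<Longrightarrow> \<bar>f t\<bar> \<le> max B 0" by (simp add: le_max_iff_disj)
  then show thesis using that[of "max B 0"] by simp
qed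

lemma op_selfadjoint_op_fun:
  assumes T: "op_between a b T" "a < b" "continuous_on {a..b} f"
  shows "op_selfadjoint (op_fun f T)"
proof -
  obtain B where "\<And>t. t \<in> {a..b} \<Longrightarrow> \<bar>f t\<bar> \<le> B"
    using continuous_on_interval_bounds[OF T(3)] by blast
  then have "op_between (- B) B (op_fun f T)"
    by (intro op_between_op_fun[OF T]) (auto simp: abs_le_iff minus_le_iff)
  then show ?thesis by (rule op_between_selfadjoint)
qed

lemma op_fun_mono:
  assumes T: "op_between a b T" "a < b" "continuous_on {a..b} f" "continuous_on {a..b} g"
    and le: "\<And>t. t \<in> {a..b} \<Longrightarrow> f t \<le> g t"
  shows "op_le (op_fun f T) (op_fun g T)"
proof -
  have cont: "continuous_on {a..b} (\<lambda>t. g t - f t)" by (intro continuous_intros T)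
  obtain B where "\<And>t. t \<in> {a..b} \<Longrightarrow> \<bar>g t - f t\<bar> \<le> B"
    using continuous_on_interval_bounds[OF cont] by blast
  then have "op_between 0 B (op_fun (\<lambda>t. g t - f t) T)"
    using le by (intro op_between_op_fun[OF T(1,2) cont]) (auto simp: abs_le_iff)
  then have "op_positive (op_fun g T - op_fun f T)"
    unfolding op_fun_diff[OF T(1,2,4,3)] by (rule op_between_positive) simp
  then show ?thesis
    unfolding op_le_def using op_selfadjoint_op_fun[OF T(1,2)] T(3,4) by blast
qed

lemma op_fun_tendsto:
  assumes T: "op_between a b T" "a < b"
    and f: "\<And>n. continuous_on {a..b} (f n)" "continuous_on {a..b} g"
    and lim: "uniform_limit {a..b} f g sequentially"
  shows "(\<lambda>n. op_fun (f n) T) \<longlonglongrightarrow> op_fun g T"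
proof (rule metric_LIMSEQ_I)
  fix e :: real assume "0 < e"
  then have "\<exists>N. \<forall>n\<ge>N. \<forall>t\<in>{a..b}. dist (f n t) (g t) < e / 2"
    using uniform_limitD[OF lim, of "e / 2"] by (simp add: eventually_sequentially)
  then obtain N where N: "\<And>n t. N \<le> n \<Longrightarrow> t \<in> {a..b} \<Longrightarrow> dist (f n t) (g t) < e / 2"
    by blast
  have "dist (op_fun (f n) T) (op_fun g T) < e" if "N \<le> n" for n
  proof -
    have "op_between (- (e / 2)) (e / 2) (op_fun (\<lambda>t. f n t - g t) T)"
    proof (rule op_between_op_fun[OF T])
      show "continuous_on {a..b} (\<lambda>t. f n t - g t)" by (intro continuous_intros f)
      show "- (e / 2) \<le> f n t - g t \<and> f n t - g t \<le> e / 2" if "t \<in> {a..b}" for t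
        using N[OF \<open>N \<le> n\<close> that] unfolding dist_real_def by linarith
    qed
    then have "norm (op_fun (f n) T - op_fun g T) \<le> e / 2"
      unfolding op_fun_diff[OF T f(1) f(2)] using \<open>0 < e\<close> by (intro norm_le_op_between) auto
    then show ?thesis using \<open>0 < e\<close> by (simp add: dist_norm)
  qed
  then show "\<exists>N. \<forall>n\<ge>N. dist (op_fun (f n) T) (op_fun g T) < e" by blast
qed

lemma op_fun_compose:
  assumes T: "op_between a b T" "a < b" and g: "continuous_on {a..b} g"
    and img: "\<And>t. t \<in> {a..b} \<Longrightarrow> g t \<in> {c..d}" and "c < d" and f: "continuous_on {c..d} f"
  shows "op_fun f (op_fun g T) = op_fun (\<lambda>t. f (g t)) T"
proof (rule LIMSEQ_unique)
  have gT: "op_between c d (op_fun g T)"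
    using img by (intro op_between_op_fun[OF T g]) auto
  show "(\<lambda>n. op_poly (bernstein_approx c d f n) (op_fun g T)) \<longlonglongrightarrow> op_fun f (op_fun g T)"
    by (rule bernstein_approx_tendsto_op_fun[OF gT \<open>c < d\<close> f])
  have poly: "op_poly q (op_fun g T) = op_fun (\<lambda>t. poly q (g t)) T" for q
  proof (induction q)
    case 0
    show ?case using op_fun_const[OF T, of 0] by simp
  next
    case (pCons c q)
    have cq: "continuous_on {a..b} (\<lambda>t. poly q (g t))"
      by (intro continuous_intros g)
    have "op_fun (\<lambda>t. c + g t * poly q (g t)) T = op_fun (\<lambda>t. c) T + op_fun (\<lambda>t. g t * poly q (g t)) T"
      by (intro op_fun_add[OF T] continuous_intros g)
    also have "\<dots> = op_scalar c + (op_fun g T o\<^sub>L op_fun (\<lambda>t. poly q (g t)) T)"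
      by (simp add: op_fun_const[OF T] op_fun_mult[OF T g cq])
    finally show ?case by (simp add: op_poly_pCons pCons)
  qed
  show "(\<lambda>n. op_poly (bernstein_approx c d f n) (op_fun g T)) \<longlonglongrightarrow> op_fun (\<lambda>t. f (g t)) T"
    unfolding poly
  proof (rule op_fun_tendsto[OF T])
    show "continuous_on {a..b} (\<lambda>t. poly (bernstein_approx c d f n) (g t))" for n
      by (intro continuous_intros g)
    show "continuous_on {a..b} (\<lambda>t. f (g t))"
      using img by (intro continuous_on_compose2[OF f g]) auto
    show "uniform_limit {a..b} (\<lambda>n t. poly (bernstein_approx c d f n) (g t)) (\<lambda>t. f (g t)) sequentially"
      by (rule uniform_limit_compose'[OF uniform_limit_bernstein_approx[OF \<open>c < d\<close> f]])
        (use img in blast)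
  qed
qed

subsection \<open>Strictly positive operators\<close>

text \<open>The interval has positive length so that Bernstein polynomials can be transported to it.\<close>

definition op_spos :: "('a::complex_hilbert \<Rightarrow>\<^sub>L 'a) \<Rightarrow> bool"
  where "op_spos T \<longleftrightarrow> (\<exists>a b. 0 < a \<and> a < b \<and> op_between a b T)"

lemma op_sposE:
  assumes "op_spos T"
  obtains a b where "0 < a" "a < b" "op_between a b T"
  using assms by (auto simp: op_spos_def)

lemma op_sposI:
  assumes T: "op_selfadjoint T" and "0 < a" and lower: "\<And>x. a * (norm x)\<^sup>2 \<le> ip (blinfun_apply T x) x"
  shows "op_spos T"
proof -
  let ?b = "max a (norm T) + 1"
  have "ip (blinfun_apply T x) x \<le> ?b * (norm x)\<^sup>2" for x
  proof -
    have "ip (blinfun_apply T x) x \<le> norm T * (norm x)\<^sup>2"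
      using op_between_norm[OF T] by (simp add: op_between_def)
    also have "\<dots> \<le> ?b * (norm x)\<^sup>2"
      by (intro mult_right_mono) auto
    finally show ?thesis .
  qed
  then have "op_between a ?b T" using T lower by (simp add: op_between_def)
  then show ?thesis using \<open>0 < a\<close> unfolding op_spos_def by (intro exI[of _ a] exI[of _ ?b]) auto
qed

lemma op_between_spos: "op_between a b T \<Longrightarrow> 0 < a \<Longrightarrow> op_spos T"
  by (rule op_sposI) (auto simp: op_between_def)

lemma op_spos_selfadjoint: "op_spos T \<Longrightarrow> op_selfadjoint T"
  by (auto simp: op_spos_def intro: op_between_selfadjoint)

lemma op_spos_op_positive: "op_spos T \<Longrightarrow> op_positive T"
  by (auto simp: op_spos_def intro: op_between_positive)

lemma continuous_on_powr_positive: "0 < a \<Longrightarrow> continuous_on {a..b} (\<lambda>t. t powr p)" for a :: real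
  by (intro continuous_intros) auto

lemma op_spos_op_powr:
  assumes "op_spos T" shows "op_spos (op_powr T p)"
proof -
  obtain a b where ab: "0 < a" "a < b" and T: "op_between a b T" using assms by (rule op_sposE)
  let ?c = "min (a powr p) (b powr p)" and ?d = "max (a powr p) (b powr p)"
  have "op_between ?c ?d (op_powr T p)"
    unfolding op_powr_def
  proof (rule op_between_op_fun[OF T \<open>a < b\<close> continuous_on_powr_positive[OF \<open>0 < a\<close>]])
    fix t assume t: "t \<in> {a..b}"
    show "?c \<le> t powr p \<and> t powr p \<le> ?d"
    proof (cases "0 \<le> p")
      case True
      then have "a powr p \<le> t powr p" "t powr p \<le> b powr p"
        using t ab by (auto intro: powr_mono2)
      then show ?thesis by auto
    next
      case False
      then have "b powr p \<le> t powr p" "t powr p \<le> a powr p"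
        using t ab by (auto intro: powr_mono2')
      then show ?thesis by auto
    qed
  qed
  then show ?thesis by (rule op_between_spos) (use ab in auto)
qed

lemma op_powr_add:
  assumes "op_spos T" shows "op_powr T p o\<^sub>L op_powr T q = op_powr T (p + q)"
proof -
  obtain a b where ab: "0 < a" "a < b" and T: "op_between a b T" using assms by (rule op_sposE)
  show ?thesis
    unfolding op_powr_def powr_add
    by (rule op_fun_mult[OF T \<open>a < b\<close>, symmetric]) (intro continuous_on_powr_positive \<open>0 < a\<close>)+
qed

lemma op_powr_zero:
  assumes "op_spos T" shows "op_powr T 0 = id_blinfun"
proof -
  obtain a b where ab: "0 < a" "a < b" and T: "op_between a b T" using assms by (rule op_sposE)
  have "op_fun (\<lambda>t. t powr 0) T = op_fun (\<lambda>t. 1) T"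
    using ab by (intro op_fun_cong[OF T]) auto
  then show ?thesis by (simp add: op_powr_def op_fun_const[OF T \<open>a < b\<close>])
qed

lemma op_powr_one:
  assumes "op_spos T" shows "op_powr T 1 = T"
proof -
  obtain a b where ab: "0 < a" "a < b" and T: "op_between a b T" using assms by (rule op_sposE)
  have "op_fun (\<lambda>t. t powr 1) T = op_fun (\<lambda>t. t) T"
    using ab by (intro op_fun_cong[OF T]) auto
  then show ?thesis by (simp add: op_powr_def op_fun_ident[OF T \<open>a < b\<close>])
qed

lemma op_powr_cancel:
  assumes "op_spos T" "p + q = 0" shows "op_powr T p o\<^sub>L op_powr T q = id_blinfun"
  using op_powr_add[OF assms(1), of p q] assms by (simp add: op_powr_zero)

lemma op_powr_powr:
  assumes "op_spos T" shows "op_powr (op_powr T p) q = op_powr T (p * q)"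
proof -
  obtain a b where ab: "0 < a" "a < b" and T: "op_between a b T" using assms by (rule op_sposE)
  let ?c = "min (a powr p) (b powr p)" and ?d = "max (a powr p) (b powr p) + 1"
  have "op_fun (\<lambda>t. t powr q) (op_fun (\<lambda>t. t powr p) T) = op_fun (\<lambda>t. (t powr p) powr q) T"
  proof (rule op_fun_compose[OF T \<open>a < b\<close> continuous_on_powr_positive[OF \<open>0 < a\<close>]])
    fix t assume t: "t \<in> {a..b}"
    show "t powr p \<in> {?c..?d}"
    proof (cases "0 \<le> p")
      case True
      then have "a powr p \<le> t powr p" "t powr p \<le> b powr p"
        using t ab by (auto intro: powr_mono2)
      then show ?thesis by auto
    next
      case False
      then have "b powr p \<le> t powr p" "t powr p \<le> a powr p"
        using t ab by (auto intro: powr_mono2')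
      then show ?thesis by auto
    qed
  next
    show "?c < ?d" by linarith
    show "continuous_on {?c..?d} (\<lambda>t. t powr q)"
      using ab by (intro continuous_on_powr_positive) auto
  qed
  then show ?thesis by (simp add: op_powr_def powr_powr)
qed

lemma op_is_inverse_op_powr:
  assumes "op_spos T" shows "op_is_inverse T (op_powr T (-1))"
proof (rule op_is_inverseI)
  show "T \<in> bounded_ops" using assms by (intro op_selfadjoint_bounded_ops op_spos_selfadjoint)
  show "T o\<^sub>L op_powr T (-1) = id_blinfun" "op_powr T (-1) o\<^sub>L T = id_blinfun"
    using op_powr_cancel[OF assms, of 1 "-1"] op_powr_cancel[OF assms, of "-1" 1]
    by (simp_all add: op_powr_one[OF assms])
qed

lemma op_inverse_eq_op_powr: "op_spos T \<Longrightarrow> op_inverse T = op_powr T (-1)"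
  by (intro op_inverse_eqI op_is_inverse_op_powr)

lemma op_spos_congruence:
  assumes S: "op_spos S" and T: "op_spos T"
  shows "op_spos (S o\<^sub>L T o\<^sub>L S)"
proof -
  have sa: "op_selfadjoint S" by (rule op_spos_selfadjoint[OF S])
  obtain a b where ab: "0 < a" "op_between a b T" using T by (rule op_sposE)
  have SS: "S o\<^sub>L S = op_powr S 2"
    using op_powr_add[OF S, of 1 1] by (simp add: op_powr_one[OF S])
  obtain c d where cd: "0 < c" "op_between c d (S o\<^sub>L S)"
    using op_spos_op_powr[OF S, of 2] unfolding SS[symmetric] by (rule op_sposE)
  have "ip (blinfun_apply (S o\<^sub>L S) x) x = (norm (blinfun_apply S x))\<^sup>2" for x
    by (simp add: op_selfadjoint_ip[OF sa, of _ x] ip_self)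
  then have lower: "c * (norm x)\<^sup>2 \<le> (norm (blinfun_apply S x))\<^sup>2" for x
    using cd(2) by (metis op_between_def)
  show ?thesis
  proof (rule op_sposI)
    show "op_selfadjoint (S o\<^sub>L T o\<^sub>L S)"
      by (intro op_selfadjoint_congruence sa op_spos_selfadjoint T)
    show "0 < a * c" using ab cd by simp
    show "a * c * (norm x)\<^sup>2 \<le> ip (blinfun_apply (S o\<^sub>L T o\<^sub>L S) x) x" for x
    proof -
      have "a * c * (norm x)\<^sup>2 \<le> a * (norm (blinfun_apply S x))\<^sup>2"
        using lower[of x] ab(1) by (simp add: mult.assoc)
      also have "\<dots> \<le> ip (blinfun_apply T (blinfun_apply S x)) (blinfun_apply S x)"
        using ab(2) by (simp add: op_between_def)
      also have "\<dots> = ip (blinfun_apply (S o\<^sub>L T o\<^sub>L S) x) x"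
        by (rule ip_congruence[OF sa, symmetric])
      finally show ?thesis .
    qed
  qed
qed

section \<open>Positive unital maps\<close>

subsection \<open>Elementary properties\<close>

lemma positive_unital_map_id: "positive_unital_map \<Phi> \<Longrightarrow> \<Phi> id_blinfun = id_blinfun"
  by (simp add: positive_unital_map_def)

lemma positive_unital_map_positive: "positive_unital_map \<Phi> \<Longrightarrow> op_positive X \<Longrightarrow> op_positive (\<Phi> X)"
  by (simp add: positive_unital_map_def)

lemma op_scaleC_of_real: "op_scaleC (complex_of_real c) X = c *\<^sub>R X"
  by (rule blinfun_eqI) (simp add: op_scaleC.rep_eq blinfun.scaleR_left scaleC_of_real)

lemma positive_unital_map_add:
  "positive_unital_map \<Phi> \<Longrightarrow> op_selfadjoint X \<Longrightarrow> op_selfadjoint Y \<Longrightarrow> \<Phi> (X + Y) = \<Phi> X + \<Phi> Y"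
  by (simp add: positive_unital_map_def op_linear_map_def op_selfadjoint_bounded_ops)

lemma positive_unital_map_scaleR:
  "positive_unital_map \<Phi> \<Longrightarrow> op_selfadjoint X \<Longrightarrow> \<Phi> (c *\<^sub>R X) = c *\<^sub>R \<Phi> X"
  unfolding op_scaleC_of_real[symmetric]
  by (simp add: positive_unital_map_def op_linear_map_def op_selfadjoint_bounded_ops)

lemma positive_unital_map_diff:
  "positive_unital_map \<Phi> \<Longrightarrow> op_selfadjoint X \<Longrightarrow> op_selfadjoint Y \<Longrightarrow> \<Phi> (X - Y) = \<Phi> X - \<Phi> Y"
  using positive_unital_map_add[of \<Phi> X "(-1) *\<^sub>R Y"] positive_unital_map_scaleR[of \<Phi> Y "-1"]
    op_selfadjoint_scaleR[of Y "-1"] by simp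

lemma positive_unital_map_sum:
  assumes "positive_unital_map \<Phi>" "\<And>i. i \<in> I \<Longrightarrow> op_selfadjoint (f i)"
  shows "\<Phi> (\<Sum>i\<in>I. f i) = (\<Sum>i\<in>I. \<Phi> (f i))"
proof -
  have "\<Phi> 0 = 0" using positive_unital_map_scaleR[OF assms(1) op_selfadjoint_id, of 0] by simp
  then show ?thesis
    using assms(2)
    by (induction I rule: infinite_finite_induct)
      (auto simp: positive_unital_map_add[OF assms(1)] op_selfadjoint_sum)
qed

text \<open>\<open>X\<close> is the difference of the positive operators \<open>X + \<parallel>X\<parallel>\<close> and \<open>\<parallel>X\<parallel>\<close>.\<close>

lemma positive_unital_map_selfadjoint:
  assumes \<Phi>: "positive_unital_map \<Phi>" and X: "op_selfadjoint X"
  shows "op_selfadjoint (\<Phi> X)"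
proof -
  have "op_le (op_scalar (- norm X)) X"
    using op_between_norm[OF X] by (simp add: op_between_iff)
  then have "op_positive (X + op_scalar (norm X))" by (simp add: op_le_def)
  then have "op_positive (\<Phi> (X + op_scalar (norm X)))"
    by (rule positive_unital_map_positive[OF \<Phi>])
  then have "op_selfadjoint (\<Phi> X + op_scalar (norm X))"
    using positive_unital_map_add[OF \<Phi> X op_selfadjoint_scaleR[OF op_selfadjoint_id], of "norm X"]
      positive_unital_map_scaleR[OF \<Phi> op_selfadjoint_id, of "norm X"]
    by (simp add: op_positive_iff positive_unital_map_id[OF \<Phi>])
  from op_selfadjoint_diff[OF this op_selfadjoint_scaleR[OF op_selfadjoint_id, of "norm X"]]
  show ?thesis by simp
qed

lemma positive_unital_map_mono:
  assumes \<Phi>: "positive_unital_map \<Phi>" and le: "op_le X Y"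
  shows "op_le (\<Phi> X) (\<Phi> Y)"
  using le positive_unital_map_positive[OF \<Phi>, of "Y - X"]
  by (simp add: op_le_def positive_unital_map_diff[OF \<Phi>] positive_unital_map_selfadjoint[OF \<Phi>])

lemma positive_unital_map_scalar: "positive_unital_map \<Phi> \<Longrightarrow> \<Phi> (op_scalar c) = op_scalar c"
  by (simp add: positive_unital_map_scaleR op_selfadjoint_id positive_unital_map_id)

lemma positive_unital_map_between:
  assumes \<Phi>: "positive_unital_map \<Phi>" and "op_between a b X"
  shows "op_between a b (\<Phi> X)"
  using assms(2) positive_unital_map_mono[OF \<Phi>] positive_unital_map_scalar[OF \<Phi>]
  unfolding op_between_iff by metis

lemma positive_unital_map_spos: "positive_unital_map \<Phi> \<Longrightarrow> op_spos X \<Longrightarrow> op_spos (\<Phi> X)"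
  using positive_unital_map_between unfolding op_spos_def by blast

text \<open>A positive unital map is a contraction on self-adjoint operators.\<close>

lemma positive_unital_map_tendsto:
  assumes \<Phi>: "positive_unital_map \<Phi>" and sa: "\<And>n. op_selfadjoint (X n)" and lim: "X \<longlonglongrightarrow> Y"
  shows "(\<lambda>n. \<Phi> (X n)) \<longlonglongrightarrow> \<Phi> Y"
proof -
  have saY: "op_selfadjoint Y" by (rule op_selfadjoint_limit[OF sa lim])
  have "norm (\<Phi> (X n) - \<Phi> Y) \<le> norm (X n - Y)" for n
  proof -
    have "op_between (- norm (X n - Y)) (norm (X n - Y)) (\<Phi> (X n - Y))"
      by (intro positive_unital_map_between[OF \<Phi>] op_between_norm op_selfadjoint_diff sa saY)
    then show ?thesis
      unfolding positive_unital_map_diff[OF \<Phi> sa saY] by (rule norm_le_op_between) simp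
  qed
  moreover have "(\<lambda>n. X n - Y) \<longlonglongrightarrow> 0"
    using lim by (rule LIM_zero)
  ultimately have "(\<lambda>n. \<Phi> (X n) - \<Phi> Y) \<longlonglongrightarrow> 0"
    by (rule Lim_null_comparison[OF always_eventually[OF allI] tendsto_norm_zero])
  then show ?thesis by (rule LIM_zero_cancel)
qed

text \<open>The choice \<open>S = \<Phi>(F\<^sup>2)\<^sup>-\<^sup>1\<^sup>/\<^sup>2\<close> makes the compressed map unital; it reduces statements about a pair
  of operators to statements about one.\<close>

lemma positive_unital_map_congruence:
  assumes \<Phi>: "positive_unital_map \<Phi>" and F: "op_selfadjoint F" and S: "op_selfadjoint S"
    and unital: "S o\<^sub>L \<Phi> (F o\<^sub>L F) o\<^sub>L S = id_blinfun"
  shows "positive_unital_map (\<lambda>X. S o\<^sub>L \<Phi> (F o\<^sub>L X o\<^sub>L F) o\<^sub>L S)"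
proof -
  have ops: "F \<in> bounded_ops" "S \<in> bounded_ops"
    using F S by (auto intro: op_selfadjoint_bounded_ops)
  have scaleC: "R o\<^sub>L op_scaleC c X o\<^sub>L R = op_scaleC c (R o\<^sub>L X o\<^sub>L R)"
    if "R \<in> bounded_ops" for R X and c
    using that by (intro blinfun_eqI) (simp add: op_scaleC.rep_eq bounded_opsD)
  have positive: "op_positive (R o\<^sub>L X o\<^sub>L R)" if "op_selfadjoint R" "op_positive X" for R X
    using that by (simp add: op_positive_iff op_selfadjoint_congruence ip_congruence
        del: blinfun_apply_blinfun_compose)
  have "op_linear_map (\<lambda>X. S o\<^sub>L \<Phi> (F o\<^sub>L X o\<^sub>L F) o\<^sub>L S)"
    using \<Phi> ops unfolding positive_unital_map_def op_linear_map_def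
    by (simp add: bounded_ops_compose scaleC blinfun_compose_simps)
  then show ?thesis
    using positive_unital_map_positive[OF \<Phi>] positive[OF F] positive[OF S] unital
    unfolding positive_unital_map_def by simp
qed

subsection \<open>Positivity of a block form on one operator\<close>

text \<open>Complete the square: with \<open>Q(z) = \<langle>Qz, z\<rangle>\<close>, the claimed form multiplied by \<open>u\<close> is
  \<open>Q(u x + v y) + (u w - v\<^sup>2) Q(y)\<close>. If \<open>u = 0\<close> then also \<open>v = 0\<close>.\<close>

lemma scalar_quadratic_form_times_positive:
  assumes Q: "op_positive Q" and form: "\<And>\<alpha> \<beta> :: real. 0 \<le> u * \<alpha>\<^sup>2 + 2 * v * (\<alpha> * \<beta>) + w * \<beta>\<^sup>2"
  shows "0 \<le> u * ip (blinfun_apply Q x) x + 2 * (v * ip (blinfun_apply Q x) y) + w * ip (blinfun_apply Q y) y"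
proof -
  have sa: "op_selfadjoint Q" and pos: "\<And>z. 0 \<le> ip (blinfun_apply Q z) z"
    using Q by (auto simp: op_positive_iff)
  have "0 \<le> u" "0 \<le> w" using form[of 1 0] form[of 0 1] by auto
  show ?thesis
  proof (cases "u = 0")
    case True
    have "v = 0"
    proof (rule ccontr)
      assume "v \<noteq> 0"
      \<comment> \<open>a form that is affine in \<open>\<alpha>\<close>; this \<open>\<alpha>\<close> gives it the value \<open>-1\<close>\<close>
      then show False using form[of "- (w + 1) / (2 * v)" 1] True by simp
    qed
    then show ?thesis using True \<open>0 \<le> w\<close> pos by simp
  next
    case False
    then have "0 < u" using \<open>0 \<le> u\<close> by simp
    have "0 \<le> u * (u * w - v\<^sup>2)"
      using form[of "- v" u] by (simp add: power2_eq_square algebra_simps)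
    then have det: "0 \<le> u * w - v\<^sup>2" using \<open>0 < u\<close> by (simp add: zero_le_mult_iff)
    have "0 \<le> ip (blinfun_apply Q (u *\<^sub>R x + v *\<^sub>R y)) (u *\<^sub>R x + v *\<^sub>R y)
        + (u * w - v\<^sup>2) * ip (blinfun_apply Q y) y"
      using pos det by (intro add_nonneg_nonneg mult_nonneg_nonneg)
    also have "\<dots> = u * (u * ip (blinfun_apply Q x) x + 2 * (v * ip (blinfun_apply Q x) y) + w * ip (blinfun_apply Q y) y)"
      using op_selfadjoint_ip[OF sa, of y x] ip_commute[of y "blinfun_apply Q x"]
      by (simp add: blinfun.add_right blinfun.scaleR_right ip_simps power2_eq_square algebra_simps)
    finally show ?thesis using \<open>0 < u\<close> by (simp add: zero_le_mult_iff)
  qed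
qed

text \<open>A positive map need not preserve positivity of operator matrices, but it does for matrices whose
  entries are functions of a single self-adjoint \<open>T\<close>. The Bernstein polynomials \<open>b\<^sub>k(T)\<close> are positive
  and sum to the identity, so \<open>u(T)\<close> is approximately \<open>\<Sum>\<^sub>k u(t\<^sub>k) b\<^sub>k(T)\<close>, and the form becomes a sum
  of scalar positive \<open>2\<times>2\<close> matrices tensored with the positive operators \<open>\<Phi>(b\<^sub>k(T))\<close>.\<close>

lemma positive_map_quadratic_form:
  assumes \<Phi>: "positive_unital_map \<Phi>" and T: "op_between a b T" "a < b"
    and cont: "continuous_on {a..b} u" "continuous_on {a..b} v" "continuous_on {a..b} w"
    and form: "\<And>t \<alpha> \<beta>. t \<in> {a..b} \<Longrightarrow> 0 \<le> u t * \<alpha>\<^sup>2 + 2 * v t * (\<alpha> * \<beta>) + w t * \<beta>\<^sup>2"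
  shows "0 \<le> ip (blinfun_apply (\<Phi> (op_fun u T)) x) x + 2 * ip (blinfun_apply (\<Phi> (op_fun v T)) x) y
    + ip (blinfun_apply (\<Phi> (op_fun w T)) y) y"
proof -
  have sa: "op_selfadjoint T" by (rule op_between_selfadjoint[OF T(1)])
  define P where "P n k = op_poly (bernstein_poly a b n k) T" for n k
  have saP: "op_selfadjoint (P n k)" for n k
    unfolding P_def by (rule op_selfadjoint_op_poly[OF sa])
  have posP: "op_positive (\<Phi> (P n k))" for n k
  proof (rule positive_unital_map_positive[OF \<Phi>])
    have "continuous_on {a..b} (poly (bernstein_poly a b n k))" by (intro continuous_intros)
    then obtain B where "\<And>t. t \<in> {a..b} \<Longrightarrow> \<bar>poly (bernstein_poly a b n k) t\<bar> \<le> B"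
      using continuous_on_interval_bounds by blast
    then have "op_between 0 B (P n k)"
      unfolding P_def using bernstein_poly_nonneg[OF T(2)] T(2)
      by (intro op_between_op_poly[OF T(1)]) (auto simp: abs_le_iff)
    then show "op_positive (P n k)" by (rule op_between_positive) simp
  qed
  define A where "A f n = op_poly (bernstein_approx a b f n) T" for f n
  have A: "\<Phi> (A f n) = (\<Sum>k\<le>n. f (bernstein_node a b n k) *\<^sub>R \<Phi> (P n k))" for f n
    unfolding A_def bernstein_approx_def op_poly_sum op_poly_smult P_def[symmetric]
    by (simp add: positive_unital_map_sum[OF \<Phi>] positive_unital_map_scaleR[OF \<Phi>]
        op_selfadjoint_scaleR saP)
  have lim: "(\<lambda>n. ip (blinfun_apply (\<Phi> (A f n)) z) z') \<longlonglongrightarrow> ip (blinfun_apply (\<Phi> (op_fun f T)) z) z'"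
    if "continuous_on {a..b} f" for f z z'
  proof -
    have "(\<lambda>n. \<Phi> (A f n)) \<longlonglongrightarrow> \<Phi> (op_fun f T)"
      unfolding A_def
      by (rule positive_unital_map_tendsto[OF \<Phi> op_selfadjoint_op_poly[OF sa]
            bernstein_approx_tendsto_op_fun[OF T that]])
    then show ?thesis by (intro tendsto_ip blinfun.tendsto tendsto_const)
  qed
  have nonneg: "0 \<le> ip (blinfun_apply (\<Phi> (A u n)) x) x + 2 * ip (blinfun_apply (\<Phi> (A v n)) x) y
      + ip (blinfun_apply (\<Phi> (A w n)) y) y" for n
  proof -
    have apply_A: "ip (blinfun_apply (\<Phi> (A f n)) z) z' =
        (\<Sum>k\<le>n. f (bernstein_node a b n k) * ip (blinfun_apply (\<Phi> (P n k)) z) z')" for f z z'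
      unfolding A by (simp add: blinfun.sum_left blinfun.scaleR_left ip_sum_left ip_scaleR_left)
    have "0 \<le> (\<Sum>k\<le>n. u (bernstein_node a b n k) * ip (blinfun_apply (\<Phi> (P n k)) x) x
        + 2 * (v (bernstein_node a b n k) * ip (blinfun_apply (\<Phi> (P n k)) x) y)
        + w (bernstein_node a b n k) * ip (blinfun_apply (\<Phi> (P n k)) y) y)"
      by (intro sum_nonneg scalar_quadratic_form_times_positive posP form bernstein_node_mem T(2)) simp
    then show ?thesis
      unfolding apply_A by (simp add: sum.distrib sum_distrib_left)
  qed
  show ?thesis
    by (rule LIMSEQ_le_const[OF tendsto_add[OF tendsto_add[OF lim[OF cont(1)]
            tendsto_mult[OF tendsto_const lim[OF cont(2)]]] lim[OF cont(3)]]])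
      (use nonneg in blast)
qed

text \<open>The block matrix with rows \<open>(t, -1)\<close> and \<open>(-1, 1/t)\<close> is positive; evaluate it at \<open>x = Z\<^sup>-\<^sup>1 y\<close>. For
  \<open>Z = \<Phi>(H)\<close> this is Choi's inequality \<open>\<Phi>(H)\<^sup>-\<^sup>1 \<le> \<Phi>(H\<^sup>-\<^sup>1)\<close>, and for the identity map it says that
  inversion reverses the order.\<close>

lemma positive_map_inverse_le:
  assumes \<Phi>: "positive_unital_map \<Phi>" and H: "op_spos H" and Z: "op_spos Z" and le: "op_le (\<Phi> H) Z"
  shows "op_le (op_powr Z (-1)) (\<Phi> (op_powr H (-1)))"
  unfolding op_le_iff
proof (intro conjI allI)
  show "op_selfadjoint (op_powr Z (-1))" by (intro op_spos_selfadjoint op_spos_op_powr Z)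
  show "op_selfadjoint (\<Phi> (op_powr H (-1)))"
    by (intro positive_unital_map_selfadjoint[OF \<Phi>] op_spos_selfadjoint op_spos_op_powr H)
  fix y
  define x where "x = blinfun_apply (op_powr Z (-1)) y"
  obtain a b where ab: "0 < a" "a < b" and T: "op_between a b H" using H by (rule op_sposE)
  have Zx: "blinfun_apply Z x = y"
    using op_is_inverse_op_powr[OF Z] unfolding x_def op_is_inverse_def
    by (metis blinfun_apply_blinfun_compose blinfun_apply_id_blinfun id_apply)
  have "0 \<le> ip (blinfun_apply (\<Phi> (op_fun (\<lambda>t. t) H)) x) x
      + 2 * ip (blinfun_apply (\<Phi> (op_fun (\<lambda>t. -1) H)) x) y
      + ip (blinfun_apply (\<Phi> (op_fun (\<lambda>t. t powr (-1)) H)) y) y"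
  proof (rule positive_map_quadratic_form[OF \<Phi> T ab(2)])
    fix t \<alpha> \<beta> :: real assume "t \<in> {a..b}"
    then have "0 < t" using ab by simp
    then have "t * \<alpha>\<^sup>2 + 2 * (-1) * (\<alpha> * \<beta>) + t powr (-1) * \<beta>\<^sup>2 = (t * \<alpha> - \<beta>)\<^sup>2 / t"
      by (simp add: powr_minus field_simps power2_eq_square)
    also have "\<dots> \<ge> 0" using \<open>0 < t\<close> by simp
    finally show "0 \<le> t * \<alpha>\<^sup>2 + 2 * (-1) * (\<alpha> * \<beta>) + t powr (-1) * \<beta>\<^sup>2" .
  qed (intro continuous_intros continuous_on_powr_positive ab)+
  moreover have "\<Phi> (op_fun (\<lambda>t. -1) H) = op_scalar (-1)"
    using op_fun_const[OF T ab(2), of "-1"] positive_unital_map_scalar[OF \<Phi>, of "-1"] by simp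
  ultimately have "0 \<le> ip (blinfun_apply (\<Phi> H) x) x - 2 * ip x y + ip (blinfun_apply (\<Phi> (op_powr H (-1))) y) y"
    by (simp add: op_fun_ident[OF T ab(2)] op_powr_def blinfun.minus_left ip_simps)
  moreover have "ip (blinfun_apply (\<Phi> H) x) x \<le> ip x y"
    using le Zx by (metis op_le_iff ip_commute)
  ultimately show "ip (blinfun_apply (op_powr Z (-1)) y) y \<le> ip (blinfun_apply (\<Phi> (op_powr H (-1))) y) y"
    unfolding x_def[symmetric] by simp
qed

subsection \<open>Jensen's inequality for powers\<close>

lemma norm_compose_self:
  assumes N: "op_selfadjoint N" shows "norm (N o\<^sub>L N) = (norm N)\<^sup>2"
proof (rule antisym)
  show "norm (N o\<^sub>L N) \<le> (norm N)\<^sup>2"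
    using norm_blinfun_compose[of N N] by (simp add: power2_eq_square)
  have "norm N \<le> sqrt (norm (N o\<^sub>L N))"
  proof (rule norm_blinfun_bound)
    fix x
    have "(norm (blinfun_apply N x))\<^sup>2 = ip (blinfun_apply (N o\<^sub>L N) x) x"
      by (simp add: op_selfadjoint_ip[OF N, of _ x] ip_self)
    also have "\<dots> \<le> norm (blinfun_apply (N o\<^sub>L N) x) * norm x" by (rule ip_le_norm)
    also have "\<dots> \<le> norm (N o\<^sub>L N) * norm x * norm x"
      by (intro mult_right_mono norm_blinfun) simp
    finally have "(norm (blinfun_apply N x))\<^sup>2 \<le> norm (N o\<^sub>L N) * (norm x)\<^sup>2"
      by (simp add: power2_eq_square mult.assoc)
    from real_sqrt_le_mono[OF this] show "norm (blinfun_apply N x) \<le> sqrt (norm (N o\<^sub>L N)) * norm x"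
      by (simp add: real_sqrt_mult)
  qed simp
  then show "(norm N)\<^sup>2 \<le> norm (N o\<^sub>L N)"
    by (metis norm_ge_zero power_mono real_sqrt_pow2)
qed

text \<open>The norm of a self-adjoint operator is its spectral radius, a similarity invariant: here
  \<open>\<parallel>N\<parallel>\<close> to the power \<open>2\<^sup>k\<close> stays bounded by \<open>\<parallel>S\<parallel> \<parallel>S'\<parallel>\<close>.\<close>

lemma norm_le_one_of_similar_contraction:
  fixes N S K S' :: "'a::complex_hilbert \<Rightarrow>\<^sub>L 'a"
  assumes N: "op_selfadjoint N" and similar: "N = S o\<^sub>L K o\<^sub>L S'" and inv: "S' o\<^sub>L S = id_blinfun"
    and K: "norm K \<le> 1"
  shows "norm N \<le> 1"
proof (rule ccontr)
  assume "\<not> norm N \<le> 1"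
  then have N1: "1 < norm N" by simp
  have powers: "\<exists>M Q. op_selfadjoint M \<and> norm M = norm N ^ (2 ^ k) \<and> M = S o\<^sub>L Q o\<^sub>L S' \<and> norm Q \<le> 1" for k
  proof (induction k)
    case 0
    show ?case using N similar K by auto
  next
    case (Suc k)
    then obtain M Q where M: "op_selfadjoint M" "norm M = norm N ^ (2 ^ k)" "M = S o\<^sub>L Q o\<^sub>L S'" "norm Q \<le> 1"
      by blast
    have "S' o\<^sub>L (S o\<^sub>L X) = X" for X :: "'a \<Rightarrow>\<^sub>L 'a"
      using inv by (simp flip: blinfun_compose_assoc)
    then have "M o\<^sub>L M = S o\<^sub>L (Q o\<^sub>L Q) o\<^sub>L S'"
      unfolding M(3) by (simp add: blinfun_compose_assoc)
    moreover have "op_selfadjoint (M o\<^sub>L M)" by (intro op_selfadjoint_compose M) simp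
    moreover have "norm (M o\<^sub>L M) = norm N ^ (2 ^ Suc k)"
      using norm_compose_self[OF M(1)] M(2) by (simp add: power_mult[symmetric] mult.commute)
    moreover have "norm (Q o\<^sub>L Q) \<le> 1"
      using norm_blinfun_compose[of Q Q] mult_le_one[OF M(4) norm_ge_zero M(4)] by linarith
    ultimately show ?case by blast
  qed
  have bound: "norm N ^ (2 ^ k) \<le> norm S * norm S'" for k
  proof -
    obtain M Q where M: "norm M = norm N ^ (2 ^ k)" "M = S o\<^sub>L Q o\<^sub>L S'" "norm Q \<le> 1"
      using powers[of k] by blast
    have "norm M \<le> norm (S o\<^sub>L Q) * norm S'" unfolding M(2) by (rule norm_blinfun_compose)
    also have "\<dots> \<le> (norm S * norm Q) * norm S'" by (intro mult_right_mono norm_blinfun_compose) simp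
    also have "\<dots> \<le> (norm S * 1) * norm S'" by (intro mult_right_mono mult_left_mono M) simp_all
    finally show ?thesis using M(1) by simp
  qed
  obtain n where "norm S * norm S' < norm N ^ n" using real_arch_pow[OF N1] by blast
  also have "\<dots> \<le> norm N ^ (2 ^ n)"
    using N1 by (intro power_increasing) (auto intro: less_imp_le)
  finally show False using bound[of n] by simp
qed

text \<open>Write \<open>D = \<Psi>(C)\<close> and \<open>Y = \<Psi>(C\<^sup>\<gamma>)\<close> with \<open>\<gamma> = (\<alpha> + \<beta>)/2\<close>. The positive block matrix with entries
  \<open>t\<^sup>\<alpha>, t\<^sup>\<gamma>, t\<^sup>\<beta>\<close> makes \<open>K = D\<^sup>-\<^sup>\<beta>\<^sup>/\<^sup>2 Y D\<^sup>-\<^sup>\<alpha>\<^sup>/\<^sup>2\<close> a contraction, and \<open>K\<close> is similar to the self-adjoint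
  \<open>D\<^sup>-\<^sup>\<gamma>\<^sup>/\<^sup>2 Y D\<^sup>-\<^sup>\<gamma>\<^sup>/\<^sup>2\<close>, which is therefore at most \<open>1\<close>. The same argument underlies Pedersen's proof of
  the Loewner--Heinz inequality.\<close>

lemma positive_map_powr_midpoint:
  assumes \<Psi>: "positive_unital_map \<Psi>" and C: "op_spos C"
    and \<alpha>: "op_le (\<Psi> (op_powr C \<alpha>)) (op_powr (\<Psi> C) \<alpha>)"
    and \<beta>: "op_le (\<Psi> (op_powr C \<beta>)) (op_powr (\<Psi> C) \<beta>)"
  defines "\<gamma> \<equiv> (\<alpha> + \<beta>) / 2"
  shows "op_le (\<Psi> (op_powr C \<gamma>)) (op_powr (\<Psi> C) \<gamma>)"
proof -
  define D where "D = \<Psi> C"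
  define Y where "Y = \<Psi> (op_powr C \<gamma>)"
  have D: "op_spos D" unfolding D_def by (rule positive_unital_map_spos[OF \<Psi> C])
  have saD: "op_selfadjoint (op_powr D q)" for q
    by (intro op_spos_selfadjoint op_spos_op_powr D)
  have saY: "op_selfadjoint Y"
    unfolding Y_def by (intro positive_unital_map_selfadjoint[OF \<Psi>] op_spos_selfadjoint op_spos_op_powr C)
  obtain a b where ab: "0 < a" "a < b" and T: "op_between a b C" using C by (rule op_sposE)
  have square: "ip (blinfun_apply (op_powr D q) x) x = (norm (blinfun_apply (op_powr D (q / 2)) x))\<^sup>2" for q x
  proof -
    have "op_powr D q = op_powr D (q / 2) o\<^sub>L op_powr D (q / 2)"
      by (simp add: op_powr_add[OF D])
    then show ?thesis
      by (simp add: op_selfadjoint_ip[OF saD, of _ _ x] ip_self)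
  qed
  have form: "2 * ip (blinfun_apply Y x) y
      \<le> (norm (blinfun_apply (op_powr D (\<alpha> / 2)) x))\<^sup>2 + (norm (blinfun_apply (op_powr D (\<beta> / 2)) y))\<^sup>2" for x y
  proof -
    have "0 \<le> ip (blinfun_apply (\<Psi> (op_fun (\<lambda>t. t powr \<alpha>) C)) x) x
        + 2 * ip (blinfun_apply (\<Psi> (op_fun (\<lambda>t. t powr \<gamma>) C)) x) (- y)
        + ip (blinfun_apply (\<Psi> (op_fun (\<lambda>t. t powr \<beta>) C)) (- y)) (- y)"
    proof (rule positive_map_quadratic_form[OF \<Psi> T ab(2)])
      fix t u v :: real assume "t \<in> {a..b}"
      have "t powr \<gamma> = t powr (\<alpha> / 2) * t powr (\<beta> / 2)"
        by (simp add: \<gamma>_def powr_add[symmetric] add_divide_distrib)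
      moreover have "t powr \<alpha> = t powr (\<alpha> / 2) * t powr (\<alpha> / 2)" "t powr \<beta> = t powr (\<beta> / 2) * t powr (\<beta> / 2)"
        by (simp_all add: powr_add[symmetric])
      ultimately have "t powr \<alpha> * u\<^sup>2 + 2 * t powr \<gamma> * (u * v) + t powr \<beta> * v\<^sup>2
          = (t powr (\<alpha> / 2) * u + t powr (\<beta> / 2) * v)\<^sup>2"
        by (simp add: power2_eq_square algebra_simps)
      then show "0 \<le> t powr \<alpha> * u\<^sup>2 + 2 * t powr \<gamma> * (u * v) + t powr \<beta> * v\<^sup>2" by simp
    qed (use ab in \<open>auto intro: continuous_on_powr_positive\<close>)
    then have "2 * ip (blinfun_apply Y x) y
        \<le> ip (blinfun_apply (\<Psi> (op_powr C \<alpha>)) x) x + ip (blinfun_apply (\<Psi> (op_powr C \<beta>)) y) y"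
      by (simp add: Y_def op_powr_def ip_simps blinfun.minus_right)
    also have "\<dots> \<le> ip (blinfun_apply (op_powr D \<alpha>) x) x + ip (blinfun_apply (op_powr D \<beta>) y) y"
      using \<alpha> \<beta> by (intro add_mono) (simp_all add: op_le_iff D_def)
    finally show ?thesis by (simp only: square)
  qed
  define K where "K = op_powr D (- \<beta> / 2) o\<^sub>L Y o\<^sub>L op_powr D (- \<alpha> / 2)"
  have cancel: "blinfun_apply (op_powr D (q / 2)) (blinfun_apply (op_powr D (- q / 2)) x) = x" for q x
    using op_powr_cancel[OF D, of "q / 2" "- q / 2"]
    by (metis blinfun_apply_blinfun_compose blinfun_apply_id_blinfun id_apply add.right_inverse minus_divide_left)
  have "norm K \<le> 1"
  proof (rule norm_le_of_bilinear_form)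
    fix x y
    have "ip (blinfun_apply K x) y
        = ip (blinfun_apply Y (blinfun_apply (op_powr D (- \<alpha> / 2)) x)) (blinfun_apply (op_powr D (- \<beta> / 2)) y)"
      using op_selfadjoint_ip[OF saD, of "- \<beta> / 2" _ y] by (simp add: K_def)
    then show "2 * ip (blinfun_apply K x) y \<le> 1 * ((norm x)\<^sup>2 + (norm y)\<^sup>2)"
      using form[of "blinfun_apply (op_powr D (- \<alpha> / 2)) x" "blinfun_apply (op_powr D (- \<beta> / 2)) y"]
      by (simp only: cancel) simp
  qed simp
  define N where "N = op_powr D (- \<gamma> / 2) o\<^sub>L Y o\<^sub>L op_powr D (- \<gamma> / 2)"
  have saN: "op_selfadjoint N" unfolding N_def by (intro op_selfadjoint_congruence saD saY)
  have "norm N \<le> 1"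
  proof (rule norm_le_one_of_similar_contraction[OF saN _ _ \<open>norm K \<le> 1\<close>])
    have "op_powr D ((\<beta> - \<alpha>) / 4) o\<^sub>L op_powr D (- \<beta> / 2) = op_powr D (- \<gamma> / 2)"
      "op_powr D (- \<alpha> / 2) o\<^sub>L op_powr D ((\<alpha> - \<beta>) / 4) = op_powr D (- \<gamma> / 2)"
      unfolding op_powr_add[OF D] by (rule arg_cong[where f = "op_powr D"]; simp add: \<gamma>_def field_simps)+
    then show "N = op_powr D ((\<beta> - \<alpha>) / 4) o\<^sub>L K o\<^sub>L op_powr D ((\<alpha> - \<beta>) / 4)"
      unfolding N_def K_def by (metis blinfun_compose_assoc)
    show "op_powr D ((\<alpha> - \<beta>) / 4) o\<^sub>L op_powr D ((\<beta> - \<alpha>) / 4) = id_blinfun"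
      by (rule op_powr_cancel[OF D]) (simp add: field_simps)
  qed
  then have "op_between (- 1) 1 N"
    by (intro op_between_mono[OF op_between_norm[OF saN]]) auto
  then have "op_le N id_blinfun" by (simp add: op_between_iff)
  from op_le_congruence[OF saD[of "\<gamma> / 2"] this]
  have "op_le (op_powr D (\<gamma> / 2) o\<^sub>L N o\<^sub>L op_powr D (\<gamma> / 2)) (op_powr D \<gamma>)"
    by (simp add: op_powr_add[OF D])
  moreover have "op_powr D (\<gamma> / 2) o\<^sub>L N o\<^sub>L op_powr D (\<gamma> / 2) = Y"
  proof (rule blinfun_eqI)
    have "blinfun_apply (op_powr D (- \<gamma> / 2)) (blinfun_apply (op_powr D (\<gamma> / 2)) x) = x" for x
      using cancel[of "- \<gamma>" x] by simp
    then show "blinfun_apply (op_powr D (\<gamma> / 2) o\<^sub>L N o\<^sub>L op_powr D (\<gamma> / 2)) x = blinfun_apply Y x" for x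
      using cancel[of \<gamma>] by (simp add: N_def)
  qed
  ultimately show ?thesis by (simp add: Y_def D_def)
qed

text \<open>\<open>t\<^sup>q\<close> is uniformly continuous in \<open>(q, t)\<close> on \<open>[0, 1] \<times> [a, b]\<close>.\<close>

lemma op_powr_tendsto_exponent:
  assumes C: "op_spos C" and lim: "q \<longlonglongrightarrow> \<nu>" and q: "\<And>n. q n \<in> {0..1}"
  shows "(\<lambda>n. op_powr C (q n)) \<longlonglongrightarrow> op_powr C \<nu>"
proof -
  obtain a b where ab: "0 < a" "a < b" and T: "op_between a b C" using C by (rule op_sposE)
  have \<nu>: "\<nu> \<in> {0..1}" using closed_sequentially[OF closed_atLeastAtMost _ lim] q by blast
  show ?thesis
    unfolding op_powr_def
  proof (rule op_fun_tendsto[OF T ab(2)])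
    let ?S = "{0..1} \<times> {a..b}"
    have "continuous_on ?S (\<lambda>z. snd z powr fst z)"
      using ab by (intro continuous_intros) auto
    then have unif: "uniformly_continuous_on ?S (\<lambda>z. snd z powr fst z)"
      by (intro compact_uniformly_continuous compact_Times) auto
    show "uniform_limit {a..b} (\<lambda>n t. t powr q n) (\<lambda>t. t powr \<nu>) sequentially"
    proof (rule uniform_limitI)
      fix e :: real assume "0 < e"
      then obtain d where "0 < d" and d: "\<And>z z'. z \<in> ?S \<Longrightarrow> z' \<in> ?S \<Longrightarrow> dist z' z < d \<Longrightarrow>
          dist (snd z' powr fst z') (snd z powr fst z) < e"
        using unif unfolding uniformly_continuous_on_def by metis
      have "\<forall>\<^sub>F n in sequentially. dist (q n) \<nu> < d" using lim \<open>0 < d\<close> by (rule tendstoD)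
      then show "\<forall>\<^sub>F n in sequentially. \<forall>t\<in>{a..b}. dist (t powr q n) (t powr \<nu>) < e"
      proof (rule eventually_mono)
        fix n assume n: "dist (q n) \<nu> < d"
        show "\<forall>t\<in>{a..b}. dist (t powr q n) (t powr \<nu>) < e"
        proof
          fix t assume "t \<in> {a..b}"
          then show "dist (t powr q n) (t powr \<nu>) < e"
            using d[of "(\<nu>, t)" "(q n, t)"] n q[of n] \<nu> by (simp add: dist_Pair_Pair)
        qed
      qed
    qed
  qed (use ab in \<open>auto intro: continuous_on_powr_positive\<close>)
qed

text \<open>The exponents \<open>0\<close> and \<open>1\<close> are trivial, midpoints give all dyadic exponents in between, and
  continuity in the exponent gives the rest.\<close>

lemma positive_map_powr_le:
  assumes \<Psi>: "positive_unital_map \<Psi>" and C: "op_spos C" and "0 \<le> \<nu>" "\<nu> \<le> 1"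
  shows "op_le (\<Psi> (op_powr C \<nu>)) (op_powr (\<Psi> C) \<nu>)"
proof -
  have D: "op_spos (\<Psi> C)" by (rule positive_unital_map_spos[OF \<Psi> C])
  have refl: "op_le X X" if "op_selfadjoint X" for X :: "'b \<Rightarrow>\<^sub>L 'b" using that by (simp add: op_le_iff)
  let ?E = "\<lambda>q. op_le (\<Psi> (op_powr C q)) (op_powr (\<Psi> C) q)"
  have dyadic: "?E (real k / 2 ^ n)" if "k \<le> 2 ^ n" for k n
    using that
  proof (induction n arbitrary: k)
    case 0
    then have "k = 0 \<or> k = 1" by auto
    then show ?case
      using refl[OF op_selfadjoint_id] refl[OF op_spos_selfadjoint[OF D]]
      by (auto simp: op_powr_zero[OF C] op_powr_zero[OF D] op_powr_one[OF C] op_powr_one[OF D]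
          positive_unital_map_id[OF \<Psi>])
  next
    case (Suc n)
    show ?case
    proof (cases "even k")
      case True
      then obtain j where "k = 2 * j" by (elim evenE)
      then show ?thesis using Suc.IH[of j] Suc.prems by simp
    next
      case False
      then obtain j where j: "k = 2 * j + 1" by (elim oddE)
      then have "j \<le> 2 ^ n" "Suc j \<le> 2 ^ n" using Suc.prems by auto
      from positive_map_powr_midpoint[OF \<Psi> C Suc.IH[OF this(1)] Suc.IH[OF this(2)]]
      show ?thesis by (simp add: j field_simps)
    qed
  qed
  \<comment> \<open>dyadic approximation of \<open>\<nu>\<close> from below\<close>
  define q where "q n = real (nat \<lfloor>\<nu> * 2 ^ n\<rfloor>) / 2 ^ n" for n
  have floor: "nat \<lfloor>\<nu> * 2 ^ n\<rfloor> \<le> 2 ^ n" for n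
  proof -
    have "\<nu> * 2 ^ n \<le> 1 * 2 ^ n" using \<open>\<nu> \<le> 1\<close> by (intro mult_right_mono) auto
    then have "\<nu> * 2 ^ n < 2 ^ n + 1" by linarith
    then have "\<lfloor>\<nu> * 2 ^ n\<rfloor> \<le> 2 ^ n" by (simp add: floor_le_iff)
    then show ?thesis by (simp add: nat_le_iff)
  qed
  have qE: "?E (q n)" for n unfolding q_def by (rule dyadic[OF floor])
  have q01: "q n \<in> {0..1}" for n
  proof -
    have "real (nat \<lfloor>\<nu> * 2 ^ n\<rfloor>) \<le> real (2 ^ n)" by (rule of_nat_mono[OF floor])
    then show ?thesis by (simp add: q_def)
  qed
  have "q \<longlonglongrightarrow> \<nu>"
  proof (rule tendsto_sandwich)
    have real_floor: "real (nat \<lfloor>\<nu> * 2 ^ n\<rfloor>) = real_of_int \<lfloor>\<nu> * 2 ^ n\<rfloor>" for n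
      using \<open>0 \<le> \<nu>\<close> by (simp add: of_nat_nat)
    show "\<forall>\<^sub>F n in sequentially. \<nu> - (1 / 2) ^ n \<le> q n"
    proof (rule always_eventually, rule allI)
      fix n
      have "\<nu> * 2 ^ n - 1 \<le> real_of_int \<lfloor>\<nu> * 2 ^ n\<rfloor>" by linarith
      then have "(\<nu> * 2 ^ n - 1) / 2 ^ n \<le> real_of_int \<lfloor>\<nu> * 2 ^ n\<rfloor> / 2 ^ n"
        by (rule divide_right_mono) simp
      then show "\<nu> - (1 / 2) ^ n \<le> q n"
        unfolding q_def real_floor by (simp add: diff_divide_distrib power_one_over)
    qed
    show "\<forall>\<^sub>F n in sequentially. q n \<le> \<nu>"
      unfolding q_def real_floor by (intro always_eventually allI) (simp add: divide_le_eq)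
    have "(\<lambda>n. \<nu> - (1 / 2 :: real) ^ n) \<longlonglongrightarrow> \<nu> - 0"
      by (intro tendsto_diff tendsto_const LIMSEQ_power_zero) simp
    then show "(\<lambda>n. \<nu> - (1 / 2 :: real) ^ n) \<longlonglongrightarrow> \<nu>" by simp
  qed simp
  note lim = op_powr_tendsto_exponent[OF _ this q01]
  show ?thesis
  proof (rule op_le_limit[OF qE _ lim[OF D]])
    show "(\<lambda>n. \<Psi> (op_powr C (q n))) \<longlonglongrightarrow> \<Psi> (op_powr C \<nu>)"
      by (rule positive_unital_map_tendsto[OF \<Psi> op_spos_selfadjoint[OF op_spos_op_powr[OF C]] lim[OF C]])
  qed
qed

subsection \<open>Geometric means\<close>

lemma op_spos_geom_mean:
  assumes "op_spos A" "op_spos B" shows "op_spos (geom_mean \<nu> A B)"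
  unfolding geom_mean_def by (intro op_spos_congruence op_spos_op_powr assms)

text \<open>Ando's inequality: Jensen's inequality for the unital map
  \<open>X \<mapsto> \<Phi>(A)\<^sup>-\<^sup>1\<^sup>/\<^sup>2 \<Phi>(A\<^sup>1\<^sup>/\<^sup>2 X A\<^sup>1\<^sup>/\<^sup>2) \<Phi>(A)\<^sup>-\<^sup>1\<^sup>/\<^sup>2\<close> at \<open>A\<^sup>-\<^sup>1\<^sup>/\<^sup>2 B A\<^sup>-\<^sup>1\<^sup>/\<^sup>2\<close>.\<close>

lemma positive_map_geom_mean_le:
  assumes \<Phi>: "positive_unital_map \<Phi>" and A: "op_spos A" and B: "op_spos B" and \<nu>: "0 \<le> \<nu>" "\<nu> \<le> 1"
  shows "op_le (\<Phi> (geom_mean \<nu> A B)) (geom_mean \<nu> (\<Phi> A) (\<Phi> B))"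
proof -
  have A': "op_spos (\<Phi> A)" by (rule positive_unital_map_spos[OF \<Phi> A])
  define F where "F = op_powr A (1/2)"
  define E where "E = op_powr A (-1/2)"
  define R where "R = op_powr (\<Phi> A) (1/2)"
  define S where "S = op_powr (\<Phi> A) (-1/2)"
  define C where "C = E o\<^sub>L B o\<^sub>L E"
  define \<Psi> where "\<Psi> X = S o\<^sub>L \<Phi> (F o\<^sub>L X o\<^sub>L F) o\<^sub>L S" for X
  have C: "op_spos C" unfolding C_def E_def by (intro op_spos_congruence op_spos_op_powr A B)
  have sa: "op_selfadjoint F" "op_selfadjoint E" "op_selfadjoint R" "op_selfadjoint S"
    unfolding F_def E_def R_def S_def by (intro op_spos_selfadjoint op_spos_op_powr A A')+
  have FF: "F o\<^sub>L F = A" and FE: "F o\<^sub>L E = id_blinfun" "E o\<^sub>L F = id_blinfun"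
    by (simp_all add: F_def E_def op_powr_add[OF A] op_powr_zero[OF A] op_powr_one[OF A])
  have RR: "R o\<^sub>L R = \<Phi> A" and RS: "R o\<^sub>L S = id_blinfun" "S o\<^sub>L R = id_blinfun"
    by (simp_all add: R_def S_def op_powr_add[OF A'] op_powr_zero[OF A'] op_powr_one[OF A'])
  have "S o\<^sub>L \<Phi> (F o\<^sub>L F) o\<^sub>L S = (S o\<^sub>L R) o\<^sub>L (R o\<^sub>L S)"
    by (simp add: FF RR[symmetric] blinfun_compose_assoc)
  then have \<Psi>: "positive_unital_map \<Psi>"
    unfolding \<Psi>_def by (intro positive_unital_map_congruence[OF \<Phi> sa(1) sa(4)]) (simp add: RS)
  have "F o\<^sub>L C o\<^sub>L F = (F o\<^sub>L E) o\<^sub>L B o\<^sub>L (E o\<^sub>L F)"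
    by (simp add: C_def blinfun_compose_assoc)
  then have "\<Psi> C = S o\<^sub>L \<Phi> B o\<^sub>L S" by (simp add: \<Psi>_def FE)
  then have "op_le (\<Psi> (op_powr C \<nu>)) (op_powr (S o\<^sub>L \<Phi> B o\<^sub>L S) \<nu>)"
    using positive_map_powr_le[OF \<Psi> C \<nu>] by simp
  from op_le_congruence[OF sa(3) this]
  have "op_le (R o\<^sub>L \<Psi> (op_powr C \<nu>) o\<^sub>L R) (geom_mean \<nu> (\<Phi> A) (\<Phi> B))"
    by (simp add: geom_mean_def R_def S_def)
  moreover have "R o\<^sub>L \<Psi> (op_powr C \<nu>) o\<^sub>L R = (R o\<^sub>L S) o\<^sub>L \<Phi> (F o\<^sub>L op_powr C \<nu> o\<^sub>L F) o\<^sub>L (S o\<^sub>L R)"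
    by (simp add: \<Psi>_def blinfun_compose_assoc)
  then have "R o\<^sub>L \<Psi> (op_powr C \<nu>) o\<^sub>L R = \<Phi> (geom_mean \<nu> A B)"
    by (simp add: RS geom_mean_def C_def F_def E_def)
  ultimately show ?thesis by simp
qed

text \<open>Both means are \<open>A\<^sup>1\<^sup>/\<^sup>2 C\<^sup>\<nu> A\<^sup>1\<^sup>/\<^sup>2\<close> or \<open>A\<^sup>-\<^sup>1\<^sup>/\<^sup>2 C\<^sup>-\<^sup>\<nu> A\<^sup>-\<^sup>1\<^sup>/\<^sup>2\<close> with the same \<open>C = A\<^sup>-\<^sup>1\<^sup>/\<^sup>2 B A\<^sup>-\<^sup>1\<^sup>/\<^sup>2\<close>.\<close>

lemma geom_mean_inverse:
  assumes A: "op_spos A" and B: "op_spos B"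
  shows "geom_mean \<nu> (op_powr A (-1)) (op_powr B (-1)) = op_powr (geom_mean \<nu> A B) (-1)"
proof -
  define F where "F = op_powr A (1/2)"
  define E where "E = op_powr A (-1/2)"
  define C where "C = E o\<^sub>L B o\<^sub>L E"
  have C: "op_spos C" unfolding C_def E_def by (intro op_spos_congruence op_spos_op_powr A B)
  have FE: "F o\<^sub>L E = id_blinfun" "E o\<^sub>L F = id_blinfun"
    by (simp_all add: F_def E_def op_powr_add[OF A] op_powr_zero[OF A])
  have cancel: "F o\<^sub>L (E o\<^sub>L X) = X" "E o\<^sub>L (F o\<^sub>L X) = X" for X :: "'a \<Rightarrow>\<^sub>L 'a"
    using FE by (simp_all flip: blinfun_compose_assoc)
  have B_cancel: "B o\<^sub>L (op_powr B (-1) o\<^sub>L X) = X" "op_powr B (-1) o\<^sub>L (B o\<^sub>L X) = X" for X :: "'a \<Rightarrow>\<^sub>L 'a"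
    using op_is_inverse_op_powr[OF B] by (simp_all add: op_is_inverse_def flip: blinfun_compose_assoc)
  have C_cancel: "op_powr C \<nu> o\<^sub>L (op_powr C (- \<nu>) o\<^sub>L X) = X" "op_powr C (- \<nu>) o\<^sub>L (op_powr C \<nu> o\<^sub>L X) = X"
    for X :: "'a \<Rightarrow>\<^sub>L 'a"
    by (simp_all add: op_powr_cancel[OF C] flip: blinfun_compose_assoc)
  have "op_is_inverse C (F o\<^sub>L op_powr B (-1) o\<^sub>L F)"
    using op_selfadjoint_bounded_ops[OF op_spos_selfadjoint[OF C]]
    by (intro op_is_inverseI) (simp_all add: C_def blinfun_compose_assoc cancel B_cancel FE)
  from op_inverse_eqI[OF this] have "F o\<^sub>L op_powr B (-1) o\<^sub>L F = op_powr C (-1)"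
    by (simp add: op_inverse_eq_op_powr[OF C])
  then have "geom_mean \<nu> (op_powr A (-1)) (op_powr B (-1)) = E o\<^sub>L op_powr C (- \<nu>) o\<^sub>L E"
    by (simp add: geom_mean_def op_powr_powr[OF A] op_powr_powr[OF C] F_def E_def)
  also have "\<dots> = op_inverse (geom_mean \<nu> A B)"
  proof (rule op_inverse_eqI[symmetric], rule op_is_inverseI)
    show "geom_mean \<nu> A B \<in> bounded_ops"
      by (intro op_selfadjoint_bounded_ops op_spos_selfadjoint op_spos_geom_mean A B)
    have G: "geom_mean \<nu> A B = F o\<^sub>L op_powr C \<nu> o\<^sub>L F"
      by (simp add: geom_mean_def C_def F_def E_def)
    show "geom_mean \<nu> A B o\<^sub>L (E o\<^sub>L op_powr C (- \<nu>) o\<^sub>L E) = id_blinfun"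
      "(E o\<^sub>L op_powr C (- \<nu>) o\<^sub>L E) o\<^sub>L geom_mean \<nu> A B = id_blinfun"
      by (simp_all add: G blinfun_compose_assoc cancel C_cancel FE)
  qed
  finally show ?thesis
    by (simp add: op_inverse_eq_op_powr[OF op_spos_geom_mean[OF A B]])
qed

section \<open>Young's inequality with the Kantorovich constant\<close>

lemma kantorovich_pos: "0 < t \<Longrightarrow> 0 < kantorovich t"
  by (simp add: kantorovich_def add_pos_pos)

lemma kantorovich_inverse: "0 < t \<Longrightarrow> kantorovich (1 / t) = kantorovich t"
  by (simp add: kantorovich_def field_simps power2_eq_square)

lemma kantorovich_mono:
  assumes "1 \<le> s" "s \<le> t" shows "kantorovich s \<le> kantorovich t"
proof -
  have "1 * 1 \<le> s * t" using assms by (intro mult_mono) auto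
  then have "0 \<le> (t - s) * (s * t - 1)" using assms by simp
  then show ?thesis
    using assms by (simp add: kantorovich_def divide_simps power2_eq_square) (simp add: algebra_simps)
qed

text \<open>Write \<open>(1 - \<mu>) + \<mu> x\<close> as a weighted arithmetic mean of \<open>(1 + x)/2\<close> and whichever of \<open>1\<close> and \<open>x\<close>
  carries the larger weight, and compare it with the weighted geometric mean of these two numbers. The
  constant appears because \<open>((1 + x)/2)\<^sup>2 = K(x) x\<close>.\<close>

lemma young_kantorovich:
  assumes "0 < x" "0 \<le> \<mu>" "\<mu> \<le> 1"
  shows "kantorovich x powr min \<mu> (1 - \<mu>) * x powr \<mu> \<le> (1 - \<mu>) + \<mu> * x"
proof -
  define y where "y = (1 + x) / 2"
  have "0 < y" using assms by (simp add: y_def)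
  have K: "kantorovich x powr \<theta> = y powr (2 * \<theta>) * x powr (- \<theta>)" for \<theta>
  proof -
    have "kantorovich x = y powr 2 * x powr (- 1)"
      using assms \<open>0 < y\<close> by (simp add: kantorovich_def y_def powr_minus power_divide field_simps)
    then have "kantorovich x powr \<theta> = (y powr 2) powr \<theta> * (x powr (- 1)) powr \<theta>"
      by (simp only: powr_mult powr_ge_zero)
    then show ?thesis by (simp only: powr_powr) simp
  qed
  have split: "kantorovich x powr \<theta> * x powr \<mu> = y powr (2 * \<theta>) * x powr (\<mu> - \<theta>)" for \<theta>
    unfolding K by (simp add: mult.assoc powr_add[symmetric])
  show ?thesis
  proof (cases "\<mu> \<le> 1 / 2")
    case True
    have "1 powr (1 - 2 * \<mu>) * y powr (2 * \<mu>) \<le> (1 - 2 * \<mu>) * 1 + 2 * \<mu> * y"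
      using True assms \<open>0 < y\<close> by (intro Youngs_inequality_0) auto
    moreover have "(1 - 2 * \<mu>) * 1 + 2 * \<mu> * y = (1 - \<mu>) + \<mu> * x"
      by (simp add: y_def field_simps)
    moreover have "min \<mu> (1 - \<mu>) = \<mu>" using True by simp
    ultimately show ?thesis using assms by (simp add: split)
  next
    case False
    have "x powr (2 * \<mu> - 1) * y powr (2 * (1 - \<mu>)) \<le> (2 * \<mu> - 1) * x + 2 * (1 - \<mu>) * y"
      using False assms \<open>0 < y\<close> by (intro Youngs_inequality_0) auto
    moreover have "(2 * \<mu> - 1) * x + 2 * (1 - \<mu>) * y = (1 - \<mu>) + \<mu> * x"
      by (simp add: y_def field_simps)
    moreover have "min \<mu> (1 - \<mu>) = 1 - \<mu>" "\<mu> - (1 - \<mu>) = 2 * \<mu> - 1" using False by simp_all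
    ultimately show ?thesis
      using split[of "1 - \<mu>"] by (simp add: mult.commute)
  qed
qed

text \<open>Subtracting \<open>r (1 - \<surd>t)\<^sup>2\<close> from \<open>(1 - \<nu>) + \<nu> t\<close> leaves a weighted arithmetic mean of \<open>\<surd>t\<close> and
  whichever of \<open>1\<close> and \<open>t\<close> carries the larger weight, to which the previous inequality applies with ratio \<open>\<surd>t\<close>.\<close>

lemma refined_young_kantorovich:
  assumes "0 < t" "0 \<le> \<nu>" "\<nu> \<le> 1"
    and r: "r = min \<nu> (1 - \<nu>)" and r1: "r\<^sub>1 = min (2 * r) (1 - 2 * r)"
  shows "kantorovich (sqrt t) powr r\<^sub>1 * t powr \<nu> - 2 * r * t powr (1/2) \<le> (1 - \<nu> - r) + (\<nu> - r) * t"
proof -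
  have x: "0 < sqrt t" using assms by simp
  have sqrt: "sqrt t = t powr (1/2)" using assms by (simp add: powr_half_sqrt)
  have power: "sqrt t powr q = t powr (q / 2)" for q by (simp add: sqrt powr_powr)
  show ?thesis
  proof (cases "\<nu> \<le> 1 / 2")
    case True
    then have "r = \<nu>" "r\<^sub>1 = min (2 * \<nu>) (1 - 2 * \<nu>)" using r r1 by auto
    then show ?thesis
      using young_kantorovich[OF x, of "2 * \<nu>"] True assms
      by (simp add: power sqrt[symmetric] algebra_simps)
  next
    case False
    then have rr: "r = 1 - \<nu>" "r\<^sub>1 = min (2 * \<nu> - 1) (1 - (2 * \<nu> - 1))" using r r1 by (auto simp: min.commute)
    have power_sum: "sqrt t * sqrt t powr (2 * \<nu> - 1) = t powr \<nu>"
      unfolding power unfolding sqrt powr_add[symmetric] by (simp add: field_simps)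
    have "kantorovich (sqrt t) powr r\<^sub>1 * t powr \<nu>
        = sqrt t * (kantorovich (sqrt t) powr r\<^sub>1 * sqrt t powr (2 * \<nu> - 1))"
      unfolding power_sum[symmetric] by (rule mult.left_commute)
    also have "\<dots> \<le> sqrt t * ((1 - (2 * \<nu> - 1)) + (2 * \<nu> - 1) * sqrt t)"
      unfolding rr(2) using young_kantorovich[OF x, of "2 * \<nu> - 1"] False assms
      by (intro mult_left_mono) auto
    also have "\<dots> = 2 * (1 - \<nu>) * sqrt t + (2 * \<nu> - 1) * (sqrt t * sqrt t)"
      by (simp only: distrib_left) (simp add: left_diff_distrib right_diff_distrib mult.commute mult.left_commute)
    also have "sqrt t * sqrt t = t" using assms by simp
    finally have "kantorovich (sqrt t) powr r\<^sub>1 * t powr \<nu> \<le> 2 * (1 - \<nu>) * sqrt t + (2 * \<nu> - 1) * t" .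
    then show ?thesis by (simp add: rr(1) sqrt[symmetric] algebra_simps)
  qed
qed

lemma op_le_add_right: "op_le X Y \<Longrightarrow> op_selfadjoint Z \<Longrightarrow> op_le (X + Z) (Y + Z)"
  by (rule op_le_add) (simp_all add: op_le_iff)

lemma op_spos_upper_between:
  assumes "op_spos T" "op_le T (op_scalar b)" "0 < b"
  obtains a where "0 < a" "a < b" "op_between a b T"
proof -
  obtain a\<^sub>0 b\<^sub>0 where a0: "0 < a\<^sub>0" "op_between a\<^sub>0 b\<^sub>0 T" using assms(1) by (rule op_sposE)
  have "op_between (min a\<^sub>0 (b / 2)) b T"
    using op_between_mono[OF a0(2) _ order_refl, of "min a\<^sub>0 (b / 2)"] assms(2) by (simp add: op_between_iff)
  then show thesis using a0(1) \<open>0 < b\<close> by (intro that[of "min a\<^sub>0 (b / 2)"]) auto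
qed

lemma op_lower_between:
  assumes "op_le (op_scalar a) T"
  obtains b where "a < b" "op_between a b T"
proof -
  have "op_between (- norm T) (max (norm T) (a + 1)) T"
    using assms by (intro op_between_mono[OF op_between_norm]) (auto simp: op_le_iff)
  then show thesis
    using assms by (intro that[of "max (norm T) (a + 1)"]) (auto simp: op_between_iff)
qed

lemma op_inverse_lower:
  assumes "op_spos T" "op_le T (op_scalar b)" "0 < b"
  shows "op_le (op_scalar (1 / b)) (op_powr T (-1))"
proof -
  obtain a where a: "0 < a" "a < b" and T: "op_between a b T" by (rule op_spos_upper_between[OF assms])
  have "op_between (1 / b) (1 / a) (op_powr T (-1))"
    unfolding op_powr_def using a
    by (intro op_between_op_fun[OF T] continuous_on_powr_positive) (auto simp: powr_minus field_simps)
  then show ?thesis by (simp add: op_between_iff)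
qed

lemma op_inverse_upper:
  assumes "op_le (op_scalar a) T" "0 < a"
  shows "op_le (op_powr T (-1)) (op_scalar (1 / a))"
proof -
  obtain b where b: "a < b" and T: "op_between a b T" by (rule op_lower_between[OF assms(1)])
  have "op_between (1 / b) (1 / a) (op_powr T (-1))"
    unfolding op_powr_def using b \<open>0 < a\<close>
    by (intro op_between_op_fun[OF T] continuous_on_powr_positive) (auto simp: powr_minus field_simps)
  then show ?thesis by (simp add: op_between_iff)
qed

text \<open>Inequalities between means of \<open>P\<close> and \<open>Q\<close> are scalar inequalities on an interval around the
  spectrum of \<open>P\<^sup>-\<^sup>1\<^sup>/\<^sup>2 Q P\<^sup>-\<^sup>1\<^sup>/\<^sup>2\<close>, transported by congruence with \<open>P\<^sup>1\<^sup>/\<^sup>2\<close>.\<close>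

lemma op_mean_le:
  assumes P: "op_spos P" and Q: "op_spos Q" and "0 < a" "a < b"
    and C: "op_between a b (op_powr P (-1/2) o\<^sub>L Q o\<^sub>L op_powr P (-1/2))"
    and scalar: "\<And>t. t \<in> {a..b} \<Longrightarrow> \<alpha> * t powr \<nu> + \<beta> * t powr \<mu> \<le> \<gamma> + \<delta> * t"
  shows "op_le (\<alpha> *\<^sub>R geom_mean \<nu> P Q + \<beta> *\<^sub>R geom_mean \<mu> P Q) (\<gamma> *\<^sub>R P + \<delta> *\<^sub>R Q)"
proof -
  define F where "F = op_powr P (1/2)"
  define E where "E = op_powr P (-1/2)"
  define C where "C = E o\<^sub>L Q o\<^sub>L E"
  have between: "op_between a b C" using assms(5) by (simp add: C_def E_def)
  have saF: "op_selfadjoint F" unfolding F_def by (intro op_spos_selfadjoint op_spos_op_powr P)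
  have FF: "F o\<^sub>L F = P" and FE: "F o\<^sub>L E = id_blinfun" "E o\<^sub>L F = id_blinfun"
    by (simp_all add: F_def E_def op_powr_add[OF P] op_powr_zero[OF P] op_powr_one[OF P])
  have "F o\<^sub>L C o\<^sub>L F = (F o\<^sub>L E) o\<^sub>L Q o\<^sub>L (E o\<^sub>L F)"
    by (simp add: C_def blinfun_compose_assoc)
  then have FCF: "F o\<^sub>L C o\<^sub>L F = Q" by (simp add: FE)
  note [continuous_intros] = continuous_on_powr_positive[OF \<open>0 < a\<close>]
  have "op_le (op_fun (\<lambda>t. \<alpha> * t powr \<nu> + \<beta> * t powr \<mu>) C) (op_fun (\<lambda>t. \<gamma> + \<delta> * t) C)"
    using scalar by (intro op_fun_mono[OF between \<open>a < b\<close>] continuous_intros)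
  moreover have "op_fun (\<lambda>t. \<alpha> * t powr \<nu> + \<beta> * t powr \<mu>) C = \<alpha> *\<^sub>R op_powr C \<nu> + \<beta> *\<^sub>R op_powr C \<mu>"
    by (subst op_fun_add[OF between \<open>a < b\<close>]; (intro continuous_intros)?)
      (simp add: op_powr_def op_fun_cmult[OF between \<open>a < b\<close>] continuous_on_powr_positive[OF \<open>0 < a\<close>])
  moreover have "op_fun (\<lambda>t. \<gamma> + \<delta> * t) C = op_scalar \<gamma> + \<delta> *\<^sub>R C"
    by (subst op_fun_add[OF between \<open>a < b\<close>]; (intro continuous_intros)?)
      (simp add: op_fun_const[OF between \<open>a < b\<close>] op_fun_ident[OF between \<open>a < b\<close>]
        op_fun_cmult[OF between \<open>a < b\<close> continuous_on_id])
  ultimately have "op_le (\<alpha> *\<^sub>R op_powr C \<nu> + \<beta> *\<^sub>R op_powr C \<mu>) (op_scalar \<gamma> + \<delta> *\<^sub>R C)" by simp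
  from op_le_congruence[OF saF this]
  have "op_le (\<alpha> *\<^sub>R (F o\<^sub>L op_powr C \<nu> o\<^sub>L F) + \<beta> *\<^sub>R (F o\<^sub>L op_powr C \<mu> o\<^sub>L F)) (\<gamma> *\<^sub>R P + \<delta> *\<^sub>R Q)"
    by (simp add: blinfun_compose_simps FF FCF)
  moreover have "geom_mean q P Q = F o\<^sub>L op_powr C q o\<^sub>L F" for q
    by (simp add: geom_mean_def C_def E_def F_def)
  ultimately show ?thesis by simp
qed

lemma geom_mean_le_arith_mean:
  assumes P: "op_spos P" and Q: "op_spos Q"
  shows "op_le (geom_mean (1/2) P Q) (arith_mean (1/2) P Q)"
proof -
  have "op_spos (op_powr P (-1/2) o\<^sub>L Q o\<^sub>L op_powr P (-1/2))"
    by (intro op_spos_congruence op_spos_op_powr P Q)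
  then obtain a b where ab: "0 < a" "a < b"
    and C: "op_between a b (op_powr P (-1/2) o\<^sub>L Q o\<^sub>L op_powr P (-1/2))" by (rule op_sposE)
  have "op_le (1 *\<^sub>R geom_mean (1/2) P Q + 0 *\<^sub>R geom_mean (1/2) P Q) ((1/2) *\<^sub>R P + (1/2) *\<^sub>R Q)"
  proof (rule op_mean_le[OF P Q ab C])
    fix t assume "t \<in> {a..b}"
    then have "0 < t" using ab by simp
    then show "1 * t powr (1/2) + 0 * t powr (1/2) \<le> 1/2 + 1/2 * t"
      using arith_geo_mean_sqrt[of 1 t] by (simp add: powr_half_sqrt)
  qed
  then show ?thesis by (simp add: arith_mean_def)
qed

text \<open>If \<open>P\<close> and \<open>Q\<close> are separated by the gap from \<open>c\<close> to \<open>d\<close>, then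
  \<open>P\<^sup>-\<^sup>1\<^sup>/\<^sup>2 Q P\<^sup>-\<^sup>1\<^sup>/\<^sup>2\<close> is at least \<open>d/c\<close> or at most \<open>c/d\<close>, where \<open>K(\<surd>t)\<close> is at least \<open>K(\<surd>(d/c))\<close>.\<close>

lemma op_refined_young:
  assumes P: "op_spos P" and Q: "op_spos Q" and "0 < c" "c \<le> d"
    and sep: "(op_le P (op_scalar c) \<and> op_le (op_scalar d) Q) \<or> (op_le Q (op_scalar c) \<and> op_le (op_scalar d) P)"
    and \<nu>: "0 \<le> \<nu>" "\<nu> \<le> 1" and r: "r = min \<nu> (1 - \<nu>)" and r1: "r\<^sub>1 = min (2 * r) (1 - 2 * r)"
  shows "op_le (kantorovich (sqrt (d / c)) powr r\<^sub>1 *\<^sub>R geom_mean \<nu> P Q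
      + (2 * r) *\<^sub>R (arith_mean (1/2) P Q - geom_mean (1/2) P Q)) (arith_mean \<nu> P Q)"
proof -
  define E where "E = op_powr P (-1/2)"
  define C where "C = E o\<^sub>L Q o\<^sub>L E"
  have saE: "op_selfadjoint E" unfolding E_def by (intro op_spos_selfadjoint op_spos_op_powr P)
  have EE: "E o\<^sub>L E = op_powr P (-1)" by (simp add: E_def op_powr_add[OF P])
  have scalar_congruence: "E o\<^sub>L op_scalar q o\<^sub>L E = q *\<^sub>R op_powr P (-1)" for q
    by (simp add: blinfun_compose_simps EE)
  have sposC: "op_spos C" unfolding C_def E_def by (intro op_spos_congruence op_spos_op_powr P Q)
  have "0 < d" using \<open>0 < c\<close> \<open>c \<le> d\<close> by simp
  obtain a b where ab: "0 < a" "a < b" and C: "op_between a b C"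
    and gap: "\<And>t. t \<in> {a..b} \<Longrightarrow> d / c \<le> t \<or> t \<le> c / d"
    using sep
  proof
    assume *: "op_le P (op_scalar c) \<and> op_le (op_scalar d) Q"
    have "op_le (d *\<^sub>R op_scalar (1 / c)) (d *\<^sub>R op_powr P (-1))"
      using * \<open>0 < c\<close> \<open>0 < d\<close> by (intro op_le_scaleR op_inverse_lower[OF P]) auto
    then have "op_le (op_scalar (d / c)) (E o\<^sub>L op_scalar d o\<^sub>L E)"
      by (simp add: scalar_congruence)
    also have "op_le (E o\<^sub>L op_scalar d o\<^sub>L E) C"
      unfolding C_def using * by (intro op_le_congruence[OF saE]) simp
    finally have "op_le (op_scalar (d / c)) C" .
    then obtain b where "d / c < b" "op_between (d / c) b C" by (rule op_lower_between)
    then show thesis using \<open>0 < c\<close> \<open>0 < d\<close> by (intro that[of "d / c" b]) auto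
  next
    assume *: "op_le Q (op_scalar c) \<and> op_le (op_scalar d) P"
    have "op_le (c *\<^sub>R op_powr P (-1)) (c *\<^sub>R op_scalar (1 / d))"
      using * \<open>0 < c\<close> \<open>0 < d\<close> by (intro op_le_scaleR op_inverse_upper) auto
    then have "op_le (E o\<^sub>L op_scalar c o\<^sub>L E) (op_scalar (c / d))"
      by (simp add: scalar_congruence)
    moreover have "op_le C (E o\<^sub>L op_scalar c o\<^sub>L E)"
      unfolding C_def using * by (intro op_le_congruence[OF saE]) simp
    ultimately have "op_le C (op_scalar (c / d))" by (rule op_le_trans[rotated])
    then obtain a where "0 < a" "a < c / d" "op_between a (c / d) C"
      using op_spos_upper_between[OF sposC] \<open>0 < c\<close> \<open>0 < d\<close> by (metis divide_pos_pos)
    then show thesis by (intro that[of a "c / d"]) auto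
  qed
  let ?\<kappa> = "kantorovich (sqrt (d / c)) powr r\<^sub>1"
  have "0 \<le> r" "r \<le> 1 / 2" using \<nu> r by (auto simp: min_def)
  then have r1_nonneg: "0 \<le> r\<^sub>1" using r1 by simp
  have "op_le (?\<kappa> *\<^sub>R geom_mean \<nu> P Q + (- 2 * r) *\<^sub>R geom_mean (1/2) P Q) ((1 - \<nu> - r) *\<^sub>R P + (\<nu> - r) *\<^sub>R Q)"
  proof (rule op_mean_le[OF P Q ab C[unfolded C_def E_def]])
    fix t assume t: "t \<in> {a..b}"
    then have "0 < t" using ab by simp
    have h: "1 \<le> sqrt (d / c)" using \<open>0 < c\<close> \<open>c \<le> d\<close> by simp
    have "kantorovich (sqrt (d / c)) \<le> kantorovich (sqrt t)"
      using gap[OF t]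
    proof
      assume "d / c \<le> t"
      then show ?thesis using h by (intro kantorovich_mono) auto
    next
      assume "t \<le> c / d"
      then have "d / c \<le> 1 / t" using \<open>0 < t\<close> \<open>0 < c\<close> \<open>0 < d\<close> by (simp add: field_simps)
      then have "kantorovich (sqrt (d / c)) \<le> kantorovich (1 / sqrt t)"
        using h real_sqrt_le_mono[of "d / c" "1 / t"] by (intro kantorovich_mono) (auto simp: real_sqrt_divide)
      then show ?thesis using \<open>0 < t\<close> by (simp add: kantorovich_inverse)
    qed
    then have "?\<kappa> \<le> kantorovich (sqrt t) powr r\<^sub>1"
      using h by (intro powr_mono2 r1_nonneg less_imp_le[OF kantorovich_pos]) auto
    then have "?\<kappa> * t powr \<nu> \<le> kantorovich (sqrt t) powr r\<^sub>1 * t powr \<nu>"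
      by (rule mult_right_mono) simp
    then show "?\<kappa> * t powr \<nu> + (- 2 * r) * t powr (1/2) \<le> (1 - \<nu> - r) + (\<nu> - r) * t"
      using refined_young_kantorovich[OF \<open>0 < t\<close> \<nu> r r1] by simp
  qed
  from op_le_add_right[OF this, of "r *\<^sub>R P + r *\<^sub>R Q"] show ?thesis
    using P Q
    by (simp add: arith_mean_def op_selfadjoint_add op_selfadjoint_scaleR op_spos_selfadjoint algebra_simps)
qed

section \<open>Powers of two operators from one inverse inequality\<close>

lemma four_powr_le:
  assumes "0 \<le> t" "t < 1" "2 \<le> (p::real)" shows "4 * t powr p \<le> 1 / (1 - t) - 1"
proof -
  have "t powr p \<le> t\<^sup>2"
    using powr_mono'[of 2 p t] assms by simp
  moreover have "4 * t\<^sup>2 \<le> 1 / (1 - t) - 1"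
  proof -
    have "0 \<le> t * (1 - 2 * t)\<^sup>2" using assms by simp
    then have "4 * t\<^sup>2 * (1 - t) \<le> t" by (simp add: power2_eq_square algebra_simps)
    then show ?thesis using assms by (simp add: field_simps)
  qed
  ultimately show ?thesis by linarith
qed

lemma minus_one_le_powr:
  assumes "0 < w" "2 \<le> (p::real)" shows "w - 1 \<le> 1 / 4 * w powr p"
proof (cases "w \<le> 1")
  case True
  have "w - 1 \<le> 0" using True by simp
  also have "0 \<le> 1 / 4 * w powr p" by simp
  finally show ?thesis .
next
  case False
  have "w - 1 \<le> w\<^sup>2 / 4"
    using zero_le_power2[of "w - 2"] by (simp add: power2_eq_square algebra_simps)
  moreover have "w\<^sup>2 \<le> w powr p"
    using powr_mono[of 2 p w] False assms by simp
  ultimately show ?thesis by simp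
qed

text \<open>After scaling to \<open>s = c = 1\<close> the proof is the chain
  \<open>4 X\<^sup>p \<le> (1 - X)\<^sup>-\<^sup>1 - 1 \<le> Y - 1 \<le> Y\<^sup>p / 4\<close>. Its middle step is the hypothesis. The outer steps are the
  scalar inequalities \<open>4 t\<^sup>p \<le> 4 t\<^sup>2 \<le> t/(1 - t)\<close> for \<open>0 \<le> t < 1\<close> and \<open>w - 1 \<le> w\<^sup>2/4 \<le> w\<^sup>p/4\<close> for
  \<open>w \<ge> 1\<close>.\<close>

lemma op_powr_le_of_inverse_le:
  assumes X: "op_positive X" and Z: "op_spos (op_scalar s - X)" and Y: "op_spos Y"
    and "0 < s" "0 < c" "2 \<le> p"
    and le: "op_le (op_powr (op_scalar s - X) (-1)) ((1 / c) *\<^sub>R Y)"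
  shows "op_le (op_powr X p) ((s powr (2 * p) / (16 * c powr p)) *\<^sub>R op_powr Y p)"
proof -
  obtain e e' where e: "0 < e" "op_between e e' (op_scalar s - X)" using Z by (rule op_sposE)
  \<comment> \<open>\<open>X \<le> s - e\<close> keeps the spectrum of \<open>X\<close> away from \<open>s\<close>; the second term makes \<open>[0, b]\<close> a proper
    interval when \<open>s - e \<le> 0\<close>.\<close>
  define b where "b = max (s - e) (s / 2)"
  have b: "0 < b" "b < s" using \<open>0 < s\<close> e(1) by (auto simp: b_def)
  have between: "op_between 0 b X"
    unfolding op_between_def
  proof (intro conjI allI)
    show "op_selfadjoint X" "0 * (norm x)\<^sup>2 \<le> ip (blinfun_apply X x) x" for x
      using X by (auto simp: op_positive_iff)
    fix x
    have "ip (blinfun_apply X x) x \<le> (s - e) * (norm x)\<^sup>2"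
      using e(2) by (simp add: op_between_def blinfun.diff_left blinfun.scaleR_left ip_simps ip_self algebra_simps)
    also have "\<dots> \<le> b * (norm x)\<^sup>2" by (intro mult_right_mono) (auto simp: b_def)
    finally show "ip (blinfun_apply X x) x \<le> b * (norm x)\<^sup>2" .
  qed
  have cont: "continuous_on {0..b} (\<lambda>t. 1 / (s - t))"
    using b by (intro continuous_intros) auto
  have cont_powr: "continuous_on {0..b} (\<lambda>t. t powr p)"
    using \<open>2 \<le> p\<close> by (intro continuous_on_powr' continuous_intros) auto
  have cont_lin: "continuous_on {0..b} (\<lambda>t. s - t)" by (intro continuous_intros)
  have resolvent: "op_fun (\<lambda>t. 1 / (s - t)) X = op_powr (op_scalar s - X) (-1)"
  proof -
    have lin: "op_fun (\<lambda>t. s - t) X = op_scalar s - X"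
      by (subst op_fun_diff[OF between b(1)]; (intro continuous_intros)?)
        (simp add: op_fun_const[OF between b(1)] op_fun_ident[OF between b(1)])
    have one: "op_fun (\<lambda>t. (s - t) * (1 / (s - t))) X = id_blinfun" "op_fun (\<lambda>t. (1 / (s - t)) * (s - t)) X = id_blinfun"
      using op_fun_cong[OF between b(1) continuous_on_const, of 1] b(2) op_fun_const[OF between b(1), of 1]
      by auto
    have "op_is_inverse (op_scalar s - X) (op_fun (\<lambda>t. 1 / (s - t)) X)"
    proof (rule op_is_inverseI)
      show "op_scalar s - X \<in> bounded_ops"
        by (intro op_selfadjoint_bounded_ops op_spos_selfadjoint Z)
      show "(op_scalar s - X) o\<^sub>L op_fun (\<lambda>t. 1 / (s - t)) X = id_blinfun"
        "op_fun (\<lambda>t. 1 / (s - t)) X o\<^sub>L (op_scalar s - X) = id_blinfun"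
        using op_fun_mult[OF between b(1) cont_lin cont] op_fun_mult[OF between b(1) cont cont_lin]
        unfolding one lin by simp_all
    qed
    from op_inverse_eqI[OF this] show ?thesis by (simp add: op_inverse_eq_op_powr[OF Z])
  qed
  have "op_le ((4 / s powr p) *\<^sub>R op_powr X p) (s *\<^sub>R op_powr (op_scalar s - X) (-1) - op_scalar 1)"
  proof -
    have "op_le (op_fun (\<lambda>t. (4 / s powr p) * t powr p) X) (op_fun (\<lambda>t. s * (1 / (s - t)) - 1) X)"
    proof (rule op_fun_mono[OF between b(1)])
      fix t assume t: "t \<in> {0..b}"
      have "4 * (t / s) powr p \<le> 1 / (1 - t / s) - 1"
        using t b \<open>0 < s\<close> \<open>2 \<le> p\<close> by (intro four_powr_le) auto
      moreover have "1 / (1 - t / s) = s * (1 / (s - t))"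
        using t b \<open>0 < s\<close> by (simp add: field_simps)
      ultimately show "(4 / s powr p) * t powr p \<le> s * (1 / (s - t)) - 1"
        using t \<open>0 < s\<close> by (simp add: powr_divide)
    qed (intro continuous_intros cont cont_powr)+
    moreover have "op_fun (\<lambda>t. s * (1 / (s - t)) - 1) X = s *\<^sub>R op_powr (op_scalar s - X) (-1) - op_scalar 1"
    proof -
      have "op_fun (\<lambda>t. s * (1 / (s - t)) - 1) X = op_fun (\<lambda>t. s * (1 / (s - t))) X - op_fun (\<lambda>t. 1) X"
        by (rule op_fun_diff[OF between b(1)]) (intro continuous_intros cont)+
      then show ?thesis
        by (simp only: op_fun_cmult[OF between b(1) cont] resolvent op_fun_const[OF between b(1)])
    qed
    ultimately show ?thesis
      by (simp only: op_powr_def op_fun_cmult[OF between b(1) cont_powr])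
  qed
  also have "op_le (s *\<^sub>R op_powr (op_scalar s - X) (-1) - op_scalar 1) ((s / c) *\<^sub>R Y - op_scalar 1)"
    using op_le_add_right[OF op_le_scaleR[OF less_imp_le[OF \<open>0 < s\<close>] le] op_selfadjoint_scaleR[OF op_selfadjoint_id], of "-1"]
    by simp
  also have "op_le ((s / c) *\<^sub>R Y - op_scalar 1) ((1 / 4 * (s / c) powr p) *\<^sub>R op_powr Y p)"
  proof -
    obtain y y' where y: "0 < y" "y < y'" and Y': "op_between y y' Y" using Y by (rule op_sposE)
    note cont = continuous_on_powr_positive[OF y(1)]
    have "op_le (op_fun (\<lambda>t. (s / c) * t - 1) Y) (op_fun (\<lambda>t. (1 / 4 * (s / c) powr p) * t powr p) Y)"
    proof (rule op_fun_mono[OF Y' y(2)])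
      fix t assume "t \<in> {y..y'}"
      then have t: "0 < t" using y by simp
      show "(s / c) * t - 1 \<le> (1 / 4 * (s / c) powr p) * t powr p"
        using minus_one_le_powr[of "(s / c) * t" p] t \<open>0 < s\<close> \<open>0 < c\<close> \<open>2 \<le> p\<close> by (simp only: powr_mult mult.assoc) simp
    qed (intro continuous_intros cont)+
    moreover have "op_fun (\<lambda>t. (s / c) * t - 1) Y = (s / c) *\<^sub>R Y - op_scalar 1"
      by (subst op_fun_diff[OF Y' y(2)]; (intro continuous_intros)?)
        (simp only: op_fun_const[OF Y' y(2)] op_fun_ident[OF Y' y(2)] op_fun_cmult[OF Y' y(2) continuous_on_id])
    ultimately show ?thesis by (simp only: op_powr_def op_fun_cmult[OF Y' y(2) cont])
  qed
  finally have "op_le ((4 / s powr p) *\<^sub>R op_powr X p) ((1 / 4 * (s / c) powr p) *\<^sub>R op_powr Y p)" .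
  from op_le_scaleR[OF _ this, of "s powr p / 4"]
  have "op_le (op_powr X p) ((s powr p / 4 * (1 / 4 * (s / c) powr p)) *\<^sub>R op_powr Y p)"
    using \<open>0 < s\<close> by simp
  moreover have "s powr p / 4 * (1 / 4 * (s / c) powr p) = s powr (2 * p) / (16 * c powr p)"
    by (simp only: mult_2 powr_add powr_divide) simp
  ultimately show ?thesis by (simp only:)
qed

section \<open>Powers of operator means under a positive map\<close>

text \<open>\<open>(t - m) (M - t) \<ge> 0\<close> on \<open>[m, M]\<close>, divided by \<open>t\<close>.\<close>

lemma op_add_inverse_le:
  assumes A: "op_between m M A" and "0 < m" "m < M"
  shows "op_le (A + (M * m) *\<^sub>R op_powr A (-1)) (op_scalar (M + m))"
proof -
  note cont = continuous_on_powr_positive[OF \<open>0 < m\<close>]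
  have "op_le (op_fun (\<lambda>t. t + (M * m) * t powr (-1)) A) (op_fun (\<lambda>t. M + m) A)"
  proof (rule op_fun_mono[OF A \<open>m < M\<close>])
    fix t assume t: "t \<in> {m..M}"
    then have "0 < t" using \<open>0 < m\<close> by simp
    have "0 \<le> (t - m) * (M - t)" using t by simp
    then have "t * t + M * m \<le> (M + m) * t" by (simp add: algebra_simps)
    then show "t + (M * m) * t powr (-1) \<le> M + m"
      using \<open>0 < t\<close> by (simp add: powr_minus field_simps)
  qed (intro continuous_intros cont)+
  moreover have "op_fun (\<lambda>t. t + (M * m) * t powr (-1)) A = A + (M * m) *\<^sub>R op_powr A (-1)"
    unfolding op_powr_def
    by (subst op_fun_add[OF A \<open>m < M\<close>]; (intro continuous_intros cont)?)
      (simp only: op_fun_ident[OF A \<open>m < M\<close>] op_fun_cmult[OF A \<open>m < M\<close> cont])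
  ultimately show ?thesis by (simp only: op_fun_const[OF A \<open>m < M\<close>])
qed

text \<open>The bound on \<open>U\<close> gives \<open>\<Phi>(c G\<^sup>-\<^sup>1) \<le> s - \<Phi>(U)\<close>, hence
  \<open>(s - \<Phi>(U))\<^sup>-\<^sup>1 \<le> \<Phi>((c G\<^sup>-\<^sup>1)\<^sup>-\<^sup>1) = c\<^sup>-\<^sup>1 \<Phi>(G) \<le> c\<^sup>-\<^sup>1 Y\<close>. Keeping \<open>Y\<close> free serves both \<open>Y = \<Phi>(G)\<close> and
  the geometric mean of the images.\<close>

lemma op_powr_positive_map_le:
  assumes \<Phi>: "positive_unital_map \<Phi>" and U: "op_positive U" and G: "op_spos G" and Y: "op_spos Y"
    and GY: "op_le (\<Phi> G) Y" and "0 < s" "0 < c" "2 \<le> p"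
    and le: "op_le (U + c *\<^sub>R op_powr G (-1)) (op_scalar s)"
  shows "op_le (op_powr (\<Phi> U) p) ((s powr (2 * p) / (16 * c powr p)) *\<^sub>R op_powr Y p)"
proof -
  define H where "H = op_powr G (-1)"
  have H: "op_spos H" unfolding H_def by (rule op_spos_op_powr[OF G])
  have saU: "op_selfadjoint U" using U by (simp add: op_positive_iff)
  have cH: "op_spos (c *\<^sub>R H)"
  proof -
    obtain a b where a: "0 < a" "op_between a b H" using H by (rule op_sposE)
    show ?thesis
    proof (rule op_sposI)
      show "op_selfadjoint (c *\<^sub>R H)" by (intro op_selfadjoint_scaleR op_spos_selfadjoint H)
      show "0 < c * a" using a \<open>0 < c\<close> by simp
      show "c * a * (norm x)\<^sup>2 \<le> ip (blinfun_apply (c *\<^sub>R H) x) x" for x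
        using a(2) \<open>0 < c\<close> by (simp add: op_between_def blinfun.scaleR_left ip_simps mult.assoc)
    qed
  qed
  have inverse: "op_powr (c *\<^sub>R H) (-1) = (1 / c) *\<^sub>R G"
  proof -
    have "op_powr H (-1) = G"
      by (simp add: H_def op_powr_powr[OF G] op_powr_one[OF G])
    then have "op_is_inverse H G" using op_is_inverse_op_powr[OF H] by simp
    then have "op_is_inverse (c *\<^sub>R H) ((1 / c) *\<^sub>R G)"
      using \<open>0 < c\<close> by (simp add: op_is_inverse_def bounded_ops_scaleR blinfun_compose_simps)
    then show ?thesis by (metis op_inverse_eqI op_inverse_eq_op_powr[OF cH])
  qed
  have "op_le (c *\<^sub>R H) (op_scalar s - U)"
    using op_le_add_right[OF le op_selfadjoint_scaleR[OF saU, of "-1"]] by (simp add: H_def)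
  from positive_unital_map_mono[OF \<Phi> this]
  have PhiH: "op_le (\<Phi> (c *\<^sub>R H)) (op_scalar s - \<Phi> U)"
    by (simp add: positive_unital_map_diff[OF \<Phi>] positive_unital_map_scalar[OF \<Phi>] saU
        op_selfadjoint_scaleR op_selfadjoint_id)
  obtain a b where a: "0 < a" "op_between a b (\<Phi> (c *\<^sub>R H))"
    using positive_unital_map_spos[OF \<Phi> cH] by (rule op_sposE)
  then have Z: "op_spos (op_scalar s - \<Phi> U)"
    using PhiH by (intro op_sposI[OF _ a(1)]) (auto simp: op_between_def op_le_iff intro: order_trans)
  show ?thesis
  proof (rule op_powr_le_of_inverse_le[OF positive_unital_map_positive[OF \<Phi> U] Z Y \<open>0 < s\<close> \<open>0 < c\<close> \<open>2 \<le> p\<close>])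
    have "op_le (op_powr (op_scalar s - \<Phi> U) (-1)) ((1 / c) *\<^sub>R \<Phi> G)"
      using positive_map_inverse_le[OF \<Phi> cH Z PhiH] op_spos_selfadjoint[OF G]
      by (simp only: inverse positive_unital_map_scaleR[OF \<Phi>])
    also have "op_le ((1 / c) *\<^sub>R \<Phi> G) ((1 / c) *\<^sub>R Y)"
      using \<open>0 < c\<close> by (intro op_le_scaleR GY) simp
    finally show "op_le (op_powr (op_scalar s - \<Phi> U) (-1)) ((1 / c) *\<^sub>R Y)" .
  qed
qed

lemma kantorovich_constant:
  assumes "0 < m" "0 < M" "0 < \<kappa>" "0 < (p::real)"
  shows "(kantorovich (M / m) / (4 powr (2 / p - 1) * \<kappa>)) powr p
    = (M + m) powr (2 * p) / (16 * (M * m * \<kappa>) powr p)"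
proof -
  have K: "kantorovich (M / m) = (M + m) powr 2 / (4 * (M * m))"
    using assms by (simp add: kantorovich_def field_simps power2_eq_square)
  have "(2 / p - 1) * p = 2 - p" using assms by (simp add: field_simps)
  then have four: "4 powr ((2 / p - 1) * p) = 16 / (4 :: real) powr p"
    by (simp only:) (simp add: powr_diff)
  have "(kantorovich (M / m) / (4 powr (2 / p - 1) * \<kappa>)) powr p
      = ((M + m) powr (2 * p) / (4 powr p * (M * m) powr p)) / (16 / 4 powr p * \<kappa> powr p)"
    unfolding K by (simp only: powr_divide powr_mult four powr_powr)
  also have "\<dots> = (M + m) powr (2 * p) / (16 * ((M * m) powr p * \<kappa> powr p))"
    by (simp add: field_simps)
  also have "\<dots> = (M + m) powr (2 * p) / (16 * (M * m * \<kappa>) powr p)"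
    using assms by (simp add: powr_mult)
  finally show ?thesis .
qed

theorem theorem2p6:
  fixes A B :: "'a::complex_hilbert \<Rightarrow>\<^sub>L 'a"
    and \<Phi> :: "('a \<Rightarrow>\<^sub>L 'a) \<Rightarrow> ('b::complex_hilbert \<Rightarrow>\<^sub>L 'b)"
    and m m' M M' \<nu> p r r\<^sub>1 h h' :: real
  assumes "op_positive A" and "op_positive B"
    and "0 < m" and "0 < m'" and "0 < M" and "0 < M'"
    and "(op_le (op_scalar m) B \<and> op_le B (op_scalar m') \<and> m' < M' \<and>
            op_le (op_scalar M') A \<and> op_le A (op_scalar M)) \<or>
         (op_le (op_scalar m) A \<and> op_le A (op_scalar m') \<and> m' < M' \<and>
            op_le (op_scalar M') B \<and> op_le B (op_scalar M))"
    and "positive_unital_map \<Phi>"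
    and "0 \<le> \<nu>" and "\<nu> \<le> 1" and "2 \<le> p"
    and "r = min \<nu> (1 - \<nu>)" and "r\<^sub>1 = min (2 * r) (1 - 2 * r)"
    and "h = M / m" and "h' = M' / m'"
  shows "op_le
      (op_powr (\<Phi> (arith_mean \<nu> A B + (2 * r * M * m) *\<^sub>R
          (arith_mean (1/2) (op_inverse A) (op_inverse B)
            - geom_mean (1/2) (op_inverse A) (op_inverse B)))) p)
      (((kantorovich h / (4 powr (2 / p - 1) * kantorovich (sqrt h') powr r\<^sub>1)) powr p)
        *\<^sub>R op_powr (\<Phi> (geom_mean \<nu> A B)) p)
    \<and> op_le
      (op_powr (\<Phi> (arith_mean \<nu> A B + (2 * r * M * m) *\<^sub>R
          (arith_mean (1/2) (op_inverse A) (op_inverse B)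
            - geom_mean (1/2) (op_inverse A) (op_inverse B)))) p)
      (((kantorovich h / (4 powr (2 / p - 1) * kantorovich (sqrt h') powr r\<^sub>1)) powr p)
        *\<^sub>R op_powr (geom_mean \<nu> (\<Phi> A) (\<Phi> B)) p)"
proof (cases "\<exists>x::'a. x \<noteq> 0")
  case False
  \<comment> \<open>On the zero space the order bounds do not even force \<open>m \<le> M\<close>; but then \<open>\<Phi>\<close> maps to the zero
    space too.\<close>
  have "\<Phi> 0 = 0"
    using positive_unital_map_scalar[OF \<open>positive_unital_map \<Phi>\<close>, of 0] by simp
  moreover have "id_blinfun = (0 :: 'a \<Rightarrow>\<^sub>L 'a)" using False by (intro blinfun_eqI) auto
  ultimately have "id_blinfun = (0 :: 'b \<Rightarrow>\<^sub>L 'b)"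
    using positive_unital_map_id[OF \<open>positive_unital_map \<Phi>\<close>] by simp
  then have "x = 0" for x :: 'b by (metis blinfun.zero_left blinfun_apply_id_blinfun id_apply)
  then have zero: "X = 0" for X :: "'b \<Rightarrow>\<^sub>L 'b" by (intro blinfun_eqI) metis
  have "op_le X Y" for X Y :: "'b \<Rightarrow>\<^sub>L 'b"
    using zero[of X] zero[of Y] by (simp add: op_le_iff op_selfadjoint_zero)
  then show ?thesis by blast
next
  case True
  then obtain x :: 'a where "x \<noteq> 0" by blast
  then have scalar_le: "a \<le> b" if "op_le (op_scalar a) X" "op_le X (op_scalar b)" for a b and X :: "'a \<Rightarrow>\<^sub>L 'a"
    using op_le_trans[OF that] by (auto simp: op_le_iff blinfun.scaleR_left ip_simps ip_self dest!: spec[of _ x])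
  have "m \<le> m'" "m' < M'" "M' \<le> M"
    using assms(7) scalar_le by blast+
  have scalar_mono: "op_le (op_scalar a) (op_scalar b :: 'a \<Rightarrow>\<^sub>L 'a)" if "a \<le> b" for a b
    using that by (auto simp: op_le_iff op_selfadjoint_scaleR op_selfadjoint_id blinfun.scaleR_left
        ip_simps ip_self intro: mult_right_mono)
  have "m < M" using \<open>m \<le> m'\<close> \<open>m' < M'\<close> \<open>M' \<le> M\<close> by simp
  have A: "op_between m M A" and B: "op_between m M B"
    using assms(7) scalar_mono[of m M'] scalar_mono[of m' M] \<open>m \<le> m'\<close> \<open>m' < M'\<close> \<open>M' \<le> M\<close>
    unfolding op_between_iff by (auto intro: op_le_trans)
  have sposA: "op_spos A" and sposB: "op_spos B"
    using A B \<open>0 < m\<close> by (auto intro: op_between_spos)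
  define P where "P = op_powr A (-1)"
  define Q where "Q = op_powr B (-1)"
  have sposP: "op_spos P" and sposQ: "op_spos Q"
    unfolding P_def Q_def by (intro op_spos_op_powr sposA sposB)+
  have sa: "op_selfadjoint A" "op_selfadjoint B" "op_selfadjoint P" "op_selfadjoint Q"
    using sposA sposB sposP sposQ by (auto intro: op_spos_selfadjoint)
  define G where "G = geom_mean \<nu> A B"
  have sposG: "op_spos G" unfolding G_def by (rule op_spos_geom_mean[OF sposA sposB])
  define D where "D = arith_mean (1/2) P Q - geom_mean (1/2) P Q"
  define U where "U = arith_mean \<nu> A B + (2 * r * M * m) *\<^sub>R D"
  define \<kappa> where "\<kappa> = kantorovich (sqrt h') powr r\<^sub>1"
  have "0 < h'" using \<open>h' = M' / m'\<close> \<open>0 < M'\<close> \<open>0 < m'\<close> by simp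
  then have "0 < \<kappa>" using kantorovich_pos[of "sqrt h'"] by (simp add: \<kappa>_def)
  have "0 \<le> r" using \<open>r = min \<nu> (1 - \<nu>)\<close> \<open>0 \<le> \<nu>\<close> \<open>\<nu> \<le> 1\<close> by simp
  have "0 \<le> M * m" using \<open>0 < M\<close> \<open>0 < m\<close> by simp
  have saD: "op_selfadjoint D"
    unfolding D_def arith_mean_def
    by (intro op_selfadjoint_diff op_selfadjoint_add op_selfadjoint_scaleR sa op_spos_selfadjoint
        op_spos_geom_mean sposP sposQ)
  have posD: "op_positive D"
    using geom_mean_le_arith_mean[OF sposP sposQ] by (simp add: op_le_def D_def)
  have posU: "op_positive U"
    using op_spos_op_positive[OF sposA] op_spos_op_positive[OF sposB] posD \<open>0 \<le> \<nu>\<close> \<open>\<nu> \<le> 1\<close> \<open>0 \<le> r\<close> \<open>0 < M\<close> \<open>0 < m\<close>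
    unfolding U_def arith_mean_def op_positive_iff
    by (simp add: op_selfadjoint_add op_selfadjoint_scaleR blinfun.add_left blinfun.scaleR_left ip_simps)
  \<comment> \<open>Inversion turns the gap from \<open>m'\<close> to \<open>M'\<close> into the gap from \<open>1/M'\<close> to \<open>1/m'\<close>, of the same
    ratio.\<close>
  have young: "op_le (\<kappa> *\<^sub>R geom_mean \<nu> P Q + (2 * r) *\<^sub>R D) (arith_mean \<nu> P Q)"
  proof -
    have "(op_le P (op_scalar (1 / M')) \<and> op_le (op_scalar (1 / m')) Q)
        \<or> (op_le Q (op_scalar (1 / M')) \<and> op_le (op_scalar (1 / m')) P)"
      using assms(7) \<open>0 < M'\<close> \<open>0 < m'\<close> unfolding P_def Q_def
      by (auto intro: op_inverse_upper op_inverse_lower[OF sposA] op_inverse_lower[OF sposB])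
    moreover have "0 < 1 / M'" "1 / M' \<le> 1 / m'"
      using \<open>0 < M'\<close> \<open>0 < m'\<close> \<open>m' < M'\<close> by (auto simp: field_simps)
    moreover have "(1 / m') / (1 / M') = h'" using \<open>h' = M' / m'\<close> by simp
    ultimately show ?thesis
      using op_refined_young[OF sposP sposQ _ _ _ assms(9,10,12,13), of "1 / M'" "1 / m'"]
      by (simp only: \<kappa>_def D_def)
  qed
  have inverse_mean: "geom_mean \<nu> P Q = op_powr G (-1)"
    unfolding P_def Q_def G_def by (rule geom_mean_inverse[OF sposA sposB])
  have "op_le (U + (M * m * \<kappa>) *\<^sub>R op_powr G (-1)) (op_scalar (M + m))"
  proof -
    have "op_le (U + (M * m * \<kappa>) *\<^sub>R op_powr G (-1)) (arith_mean \<nu> A B + (M * m) *\<^sub>R arith_mean \<nu> P Q)"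
    proof -
      have "op_selfadjoint (arith_mean \<nu> A B)"
        unfolding arith_mean_def by (intro op_selfadjoint_add op_selfadjoint_scaleR sa)
      from op_le_add_right[OF op_le_scaleR[OF \<open>0 \<le> M * m\<close> young] this]
      show ?thesis
        by (simp add: U_def inverse_mean scaleR_add_right algebra_simps)
    qed
    also have "op_le (arith_mean \<nu> A B + (M * m) *\<^sub>R arith_mean \<nu> P Q) (op_scalar (M + m))"
    proof -
      have "op_le ((1 - \<nu>) *\<^sub>R (A + (M * m) *\<^sub>R P) + \<nu> *\<^sub>R (B + (M * m) *\<^sub>R Q))
          ((1 - \<nu>) *\<^sub>R op_scalar (M + m) + \<nu> *\<^sub>R op_scalar (M + m))"
        unfolding P_def Q_def using \<open>0 \<le> \<nu>\<close> \<open>\<nu> \<le> 1\<close>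
        by (intro op_le_add op_le_scaleR op_add_inverse_le A B \<open>0 < m\<close> \<open>m < M\<close>) auto
      moreover have "(1 - \<nu>) *\<^sub>R X + \<nu> *\<^sub>R X = X" for X :: "'a \<Rightarrow>\<^sub>L 'a"
        by (simp add: scaleR_left_diff_distrib)
      moreover have "(1 - \<nu>) *\<^sub>R (A + (M * m) *\<^sub>R P) + \<nu> *\<^sub>R (B + (M * m) *\<^sub>R Q)
          = arith_mean \<nu> A B + (M * m) *\<^sub>R arith_mean \<nu> P Q"
        by (simp only: arith_mean_def scaleR_add_right scaleR_scaleR ac_simps)
      ultimately show ?thesis by (simp only:)
    qed
    finally show ?thesis .
  qed
  note bound = op_powr_positive_map_le[OF \<open>positive_unital_map \<Phi>\<close> posU sposG _ _ _ _ \<open>2 \<le> p\<close> this]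
  have positive: "0 < M + m" "0 < M * m * \<kappa>" using \<open>0 < M\<close> \<open>0 < m\<close> \<open>0 < \<kappa>\<close> by simp_all
  have const_eq: "(kantorovich h / (4 powr (2 / p - 1) * kantorovich (sqrt h') powr r\<^sub>1)) powr p
      = (M + m) powr (2 * p) / (16 * (M * m * \<kappa>) powr p)"
    unfolding \<open>h = M / m\<close> \<kappa>_def[symmetric]
    using kantorovich_constant[OF \<open>0 < m\<close> \<open>0 < M\<close> \<open>0 < \<kappa>\<close>] \<open>2 \<le> p\<close> by simp
  have PhiG: "op_spos (\<Phi> G)" "op_le (\<Phi> G) (\<Phi> G)"
    using positive_unital_map_spos[OF \<open>positive_unital_map \<Phi>\<close> sposG]
    by (auto simp: op_le_iff op_spos_selfadjoint)
  have ando: "op_le (\<Phi> G) (geom_mean \<nu> (\<Phi> A) (\<Phi> B))"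
    unfolding G_def by (rule positive_map_geom_mean_le[OF \<open>positive_unital_map \<Phi>\<close> sposA sposB \<open>0 \<le> \<nu>\<close> \<open>\<nu> \<le> 1\<close>])
  have mean: "op_spos (geom_mean \<nu> (\<Phi> A) (\<Phi> B))"
    by (intro op_spos_geom_mean positive_unital_map_spos[OF \<open>positive_unital_map \<Phi>\<close>] sposA sposB)
  show ?thesis
    unfolding const_eq op_inverse_eq_op_powr[OF sposA] op_inverse_eq_op_powr[OF sposB]
      P_def[symmetric] Q_def[symmetric] D_def[symmetric] U_def[symmetric] G_def[symmetric]
    using bound[OF PhiG positive] bound[OF mean ando positive] by blast
qed

end
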